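(* Let $q$ be an odd prime power. Let $n,j,i$ be integers with $0\leq i\leq j$ and $i+j\leq n$, such that $n-j$ is even. Let $\delta,\varepsilon\in\{0,\pm1\}$ and $\zeta,\lambda\in\{\pm1\}$ with $j-i-\delta\equiv1\equiv n-\varepsilon\pmod{2}$. Write $\gamma$ for $\gamma_{(i,j,\delta),(n,\varepsilon),(n-j,\zeta),\varepsilon}$ if $n(j-i)$ is even, and for $\gamma_{(i,j,0,\lambda),(n,0),(n-j,\zeta),0}$ if $n(j-i)$ is odd. Then \begin{align*} \gamma &=\frac{1}{2}q^{j(n-j)-\left(\frac{j+1-\varepsilon^2}{2}\right)^{2}}\sum_{m=0}^{\frac{j-i-1+\delta^2}{2}}\Bigg(\chi_{1,\frac{j+1-\varepsilon^2}{2}-m}(q)\genfrac{[}{]}{0pt}{}{\frac{j-i-1+\delta^2}{2}}{m}_{q^2}q^{m(j+i-n+m+1-\delta^2-\varepsilon^2)}\\ &\qquad+\zeta q^{\frac{1}{2}(j-n)+(1-\varepsilon^2)j}\chi_{1,\frac{j-1+\varepsilon^2}{2}-m}(q)\genfrac{[}{]}{0pt}{}{\frac{j-i-1-\delta^2}{2}}{m}_{q^2}q^{m(j+i-n+m-1+\delta^2+\varepsilon^2)}\\ &\qquad-\delta\zeta q^{\frac{1}{2}(i-n)+(1-\varepsilon^2)j}\chi_{1,\frac{j-1+\varepsilon^2}{2}-m}(q)\genfrac{[}{]}{0pt}{}{\frac{j-i}{2}-1}{m}_{q^2}q^{m(j+i-n+m+\varepsilon^2)}\\ &\qquad+\varepsilon\zeta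 q^{-\frac{1}{2}j}\chi_{1,\frac{j}{2}-m}(q)\genfrac{[}{]}{0pt}{}{\frac{j-i-1-\delta^2}{2}}{m}_{q^2}q^{m(j+i-n+m+\delta^2)}\\ &\qquad+\delta\varepsilon\zeta q^{-\frac{1}{2}i}\chi_{1,\frac{j}{2}-m}(q)\genfrac{[}{]}{0pt}{}{\frac{j-i}{2}-1}{m-1}_{q^2}q^{m(j+i-n+m-1)}\\ &\qquad+\lambda q^{\frac{1}{2}(j+i-n)}\chi_{1,\frac{j-1}{2}-m}(q)\genfrac{[}{]}{0pt}{}{\frac{j-i-1}{2}}{m}_{q^2}q^{m(j+i-n+m+1)}\Bigg), \end{align*} where $\lambda$ is only considered if $n(j-i)$ is odd, and is treated as $0$ otherwise.
   Context: Forms and types. $q$ is an odd prime power. A quadratic form $Q$ on $\mathbb{F}_q^m$ has an associated symmetric bilinear form $f$ with $Q(v)=f(v,v)$; its radical is $\{v:\forall w,\ f(v,w)=0\}$, and $Q$ is non-degenerate if its radical is $0$. A non-degenerate quadratic form on $\mathbb{F}_q^m$ has a type: $0$ (parabolic) if $m$ is odd; if $m$ is even, the type is $1$ (hyperbolic) if the maximum dimension of a totally isotropic subspace (one on which $Q$ vanishes) is $m/2$, and $-1$ (elliptic) if it is $m/2-1$. The $0$-dimensional space has type $1$. "A quadratic form of type $\varepsilon$ on $\mathbb{F}_q^n$" always means a non-degenerate one. All subspace dimensions are vector space dimensions. Given such a form, a subspace $\pi$ is $i$-singular if the radical of the form restricted to $\pi$ has dimension $i$; non-singular means $0$-singular.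 The type of an $i$-singular $j$-space $\pi$ is the type of the non-degenerate form induced on $\pi/\mathrm{rad}(\pi)$. Let $\perp$ be the orthogonal polarity $\pi\mapsto\pi^\perp=\{x: f(x,y)=0\ \forall y\in\pi\}$. If $n$ and $j-i$ are both odd, the perp type of an $i$-singular $j$-space $\pi$ (which has type $0$) is the type, $1$ or $-1$, of the $i$-singular $(n-j)$-space $\pi^\perp$. Counts. Fix a quadratic form of type $\varepsilon$ on $\mathbb{F}_q^n$. If $n(j-i)$ is even or $n=i+j$, fix an $i$-singular $j$-space $\pi$ of type $\delta$; then $\gamma_{(i,j,\delta),(n,\varepsilon),(k,\zeta),\eta}$ is the number of non-singular $k$-spaces $\sigma$ of type $\zeta$ such that $\sigma\cap\pi$ is trivial and $\langle\pi,\sigma\rangle$ is a non-singular $(k+j)$-space of type $\eta$. If $n(j-i)$ is odd (so $\varepsilon=\delta=0$), fix an $i$-singular $j$-space $\pi$ of type $0$ and perp type $\lambda$; then $\gamma_{(i,j,0,\lambda),(n,0),(k,\zeta),\eta}$ is the number of non-singular $k$-spaces $\sigma$ of type $\zeta$ such that $\sigma\cap\pi$ is trivial and $\langle\pi,\sigma\rangle$ is a non-singular $(k+j)$-space of type $\eta$. (If moreover $n=i+j$, the perp type is always $1$.) These numbers do not depend on the choice of $\pi$; they are only defined, and the formula is only asserted, for parameters for which such a $\pi$ exists. Functions. For integers $b\geq a\geq0$: $\psi^{-}_{a,b}(q)=\prod_{k=a}^{b}(q^k-1)$, $\chi_{a,b}(q)=\prod_{k=a}^{b}(q^{2k-1}-1)$,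 and $\psi^-_{a,a-1}(q)=\chi_{a,a-1}(q)=1$ for $a\ge0$. For integers $b\ge a\ge0$, $\genfrac{[}{]}{0pt}{}{b}{a}_{q}=\psi^-_{b-a+1,b}(q)/\psi^-_{1,a}(q)$; moreover $\genfrac{[}{]}{0pt}{}{b}{a}_{q}=0$ if $a<0$ or $0\leq b<a$, and $\genfrac{[}{]}{0pt}{}{-1}{0}_{q}=1$. A summand carrying a zero coefficient ($\delta=0$, $\varepsilon=0$, or $\lambda$ treated as $0$), or a zero Gaussian coefficient, is read as $0$ even if another symbol in it is then undefined (e.g. has a non-integer index). *)

theory Defs
  imports Complex_Main "HOL-Library.Set_Algebras" "HOL-Library.Cardinality"
begin

text \<open>
  The underlying space is an arbitrary finite vector space over a finite field. With
  \<open>n\<close> its dimension it is a copy of \<open>F\<^sub>q\<^sup>n\<close>, and \<open>n = 0\<close> is not excluded, as it would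
  be for coordinate vectors indexed by a type. The form \<open>f\<close> is determined by \<open>Q\<close> when
  the field has odd order, the only case considered.
\<close>

locale quadratic_space = vector_space scale
  for scale :: "'a::{field,finite} \<Rightarrow> 'v::{ab_group_add,finite} \<Rightarrow> 'v" +
  fixes Q :: "'v \<Rightarrow> 'a" and f :: "'v \<Rightarrow> 'v \<Rightarrow> 'a"
  assumes form_linear: "Vector_Spaces.linear scale (*) (f x)"
    and form_sym: "f x y = f y x"
    and quadratic_form: "Q x = f x x"
begin

definition radical :: "'v set \<Rightarrow> 'v set" where
  "radical U = {v \<in> U. \<forall>w\<in>U. f v w = 0}"

definition perp :: "'v set \<Rightarrow> 'v set" where
  "perp U = {x. \<forall>y\<in>U. f x y = 0}"

definition singular_space :: "int \<Rightarrow> int \<Rightarrow> 'v set \<Rightarrow> bool" where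
  "singular_space i j U \<longleftrightarrow> subspace U \<and> int (dim U) = j \<and> int (dim (radical U)) = i"

end

text \<open>
  The type of a non-degenerate form on an \<open>m\<close>-dimensional space whose maximal
  totally isotropic subspace dimension is \<open>w\<close>, as a relation.
\<close>

definition type_by_index :: "nat \<Rightarrow> nat \<Rightarrow> int \<Rightarrow> bool" where
  "type_by_index m w \<epsilon> \<longleftrightarrow>
     (odd m \<and> \<epsilon> = 0) \<or> (even m \<and> w = m div 2 \<and> \<epsilon> = 1) \<or> (even m \<and> w + 1 = m div 2 \<and> \<epsilon> = - 1)"

context quadratic_space
begin

definition isotropic_index :: "'v set \<Rightarrow> nat" where
  "isotropic_index U = Max {dim W | W. subspace W \<and> W \<subseteq> U \<and> (\<forall>v\<in>W. Q v = 0)}"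

definition nonsingular_of_type :: "int \<Rightarrow> int \<Rightarrow> 'v set \<Rightarrow> bool" where
  "nonsingular_of_type m \<epsilon> U \<longleftrightarrow>
     singular_space 0 m U \<and> type_by_index (dim U) (isotropic_index U) \<epsilon>"

text \<open>
  The quotient of \<open>U\<close> by a subspace \<open>R\<close> consists of the cosets \<open>v +o R\<close>.
  Addition of cosets is elementwise addition of sets. In the scalar multiple the
  summand \<open>R\<close> is needed only for the scalar 0. The zero vector is \<open>R\<close>.
\<close>

definition quotient_space :: "'v set \<Rightarrow> 'v set \<Rightarrow> 'v set set" where
  "quotient_space U R = (\<lambda>v. v +o R) ` U"

definition coset_scale :: "'v set \<Rightarrow> 'a \<Rightarrow> 'v set \<Rightarrow> 'v set" where
  "coset_scale R c A = scale c ` A + R"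

definition coset_subspace :: "'v set \<Rightarrow> 'v set set \<Rightarrow> bool" where
  "coset_subspace R \<W> \<longleftrightarrow>
     \<W> \<subseteq> quotient_space UNIV R \<and> R \<in> \<W> \<and>
     (\<forall>A\<in>\<W>. \<forall>B\<in>\<W>. A + B \<in> \<W>) \<and> (\<forall>c. \<forall>A\<in>\<W>. coset_scale R c A \<in> \<W>)"

definition coset_span :: "'v set \<Rightarrow> 'v set set \<Rightarrow> 'v set set" where
  "coset_span R \<B> = coset_subspace R hull \<B>"

definition coset_basis :: "'v set \<Rightarrow> 'v set set \<Rightarrow> 'v set set \<Rightarrow> bool" where
  "coset_basis R \<W> \<B> \<longleftrightarrow>
     \<B> \<subseteq> \<W> \<and> coset_span R \<B> = \<W> \<and> (\<forall>A\<in>\<B>. A \<notin> coset_span R (\<B> - {A}))"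

definition coset_dim :: "'v set \<Rightarrow> 'v set set \<Rightarrow> nat" where
  "coset_dim R \<W> = card (SOME \<B>. coset_basis R \<W> \<B>)"

text \<open>
  The form induced on cosets: \<open>Q\<close> is constant on every coset of the radical contained
  in the subspace, and its value there is the only element of the image.
\<close>

definition induced_form :: "'v set \<Rightarrow> 'a" where
  "induced_form A = the_elem (Q ` A)"

definition quotient_isotropic_index :: "'v set \<Rightarrow> 'v set \<Rightarrow> nat" where
  "quotient_isotropic_index U R =
     Max {coset_dim R \<W> | \<W>. coset_subspace R \<W> \<and> \<W> \<subseteq> quotient_space U R \<and>
                              (\<forall>A\<in>\<W>. induced_form A = 0)}"

definition has_type :: "'v set \<Rightarrow> int \<Rightarrow> bool" where
  "has_type U \<delta> \<longleftrightarrow>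
     type_by_index (coset_dim (radical U) (quotient_space U (radical U)))
                   (quotient_isotropic_index U (radical U)) \<delta>"

definition has_perp_type :: "'v set \<Rightarrow> int \<Rightarrow> bool" where
  "has_perp_type U \<mu> \<longleftrightarrow> has_type (perp U) \<mu>"

text \<open>
  The number \<open>\<gamma>\<close> is attached to the chosen subspace \<open>\<pi>\<close>; that it depends only on the
  parameters of \<open>\<pi>\<close> is part of what a formula for all such \<open>\<pi>\<close> asserts.
\<close>

definition gamma :: "'v set \<Rightarrow> int \<Rightarrow> int \<Rightarrow> int \<Rightarrow> nat" where
  "gamma \<pi> k \<zeta> \<eta> = card {\<sigma>. nonsingular_of_type k \<zeta> \<sigma> \<and> \<sigma> \<inter> \<pi> = {0} \<and>
                              nonsingular_of_type (k + int (dim \<pi>)) \<eta> (span (\<pi> \<union> \<sigma>))}"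

end

text \<open>The empty products give the value 1 for \<open>b = a - 1\<close>.\<close>

definition psi_minus :: "int \<Rightarrow> int \<Rightarrow> real \<Rightarrow> real" where
  "psi_minus a b x = (\<Prod>k=a..b. x powi k - 1)"

definition chi :: "int \<Rightarrow> int \<Rightarrow> real \<Rightarrow> real" where
  "chi a b x = (\<Prod>k=a..b. x powi (2 * k - 1) - 1)"

text \<open>
  The value 1 for \<open>b = -1\<close>, \<open>a = 0\<close> is a convention needed when the top index drops
  below 0. The last case also covers \<open>b < 0\<close> with \<open>(b, a) \<noteq> (-1, 0)\<close>, \<open>a \<ge> 0\<close>, where the
  coefficient is otherwise left undefined.
\<close>

definition gauss_coeff :: "int \<Rightarrow> int \<Rightarrow> real \<Rightarrow> real" where
  "gauss_coeff b a x =
     (if 0 \<le> a \<and> a \<le> b then psi_minus (b - a + 1) b x / psi_minus 1 a x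
      else if b = - 1 \<and> a = 0 then 1
      else 0)"

end

(*
  Since n - j is even, gamma counts the non-degenerate complements of \<pi> of type \<zeta>, so it is half of
  G0 + \<zeta> G1, where G0 counts the non-degenerate complements and G1 adds up their types. Both are
  instances of a sum G(V, \<pi>) of a weight over the complements of a subspace \<pi> in a non-degenerate
  space V.

  If \<pi> is spanned by X and a vector x, every complement \<sigma> of \<pi> lies in exactly one hyperplane
  \<sigma> + X = w\<^sup>\<perp> with w orthogonal to X and f w x = 1, so G(V, \<pi>) is the sum of G(w\<^sup>\<perp>, X) over these w.
  For anisotropic x the isotropic w give degenerate hyperplanes. Reflections show that their contribution
  is the same for all of them, so it can be eliminated by comparing with the case of isotropic x. This
  expresses G for rank d of \<pi> by the values for rank d - 1, with radicals of dimension i and i + 1.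
  For a totally isotropic \<pi> the degenerate hyperplanes are handled by splitting off two hyperbolic
  planes, which leads from i to i - 1 and i - 2. The closed form satisfies the same recursions by the
  Pascal rule for Gaussian coefficients and the recursion of the factor chi.
*)

theory Submission
  imports Defs "HOL-Library.FuncSet"
begin

section \<open>The quadratic character of a finite field of odd order\<close>

text \<open>The type is too coarse an invariant for the induction: it is 0 in odd dimension, while
  the hyperplanes alternate in parity and the orthogonal complements that occur may be degenerate.
  It is replaced by a sign 1 or -1, defined for every subspace through the number of solutions of
  \<open>Q x = c\<close>. In even rank the sign is the type. In odd rank it is a discriminant
  character, and only the product of two such signs is a type, namely the perp type; this is the
  origin of the \<open>lam\<close> term.

  The sum over the hyperplanes \<open>perp {w}\<close> is computable because its summand depends on
  \<open>w\<close> only through \<open>Q w\<close>, and for \<open>Q w\<close> non-zero it has the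
  form \<open>a + b * qchar (Q w)\<close>: the sign of the hyperplane is a fixed sign times
  \<open>qchar (Q w)\<close>, and the closed forms are affine in that sign. So only the level counts
  of one orthogonal complement and three sums of the quadratic character enter. Their values depend
  on the parity of a rank, which is why everything falls into four parity classes.\<close>

definition qchar :: "'a::{field,finite} \<Rightarrow> real" where
  "qchar c = (if c = 0 then 0 else if \<exists>t. c = t\<^sup>2 then 1 else - 1)"

lemma qchar_0 [simp]: "qchar 0 = 0"
  by (simp add: qchar_def)

lemma qchar_values: "c \<noteq> 0 \<Longrightarrow> qchar c = 1 \<or> qchar c = - 1"
  by (simp add: qchar_def)

lemma qchar_power2 [simp]: "t \<noteq> 0 \<Longrightarrow> qchar (t\<^sup>2) = 1"
  by (auto simp: qchar_def)

lemma qchar_1 [simp]: "qchar 1 = 1"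
  using qchar_power2[of 1] by simp

lemma qchar_mult_self: "c \<noteq> 0 \<Longrightarrow> qchar c * qchar c = 1"
  using qchar_values[of c] by auto

text \<open>In characteristic 2 the translation by 1 is an involution without fixed points, which
  would split the field into pairs.\<close>

lemma two_neq_zero_if_odd_card:
  assumes "odd CARD('a::{field,finite})"
  shows "(2::'a) \<noteq> 0"
proof
  assume two: "(2::'a) = 0"
  have inv: "x + 1 + 1 = x" for x :: 'a
    using two by (metis add.assoc add.right_neutral one_add_one)
  define P where "P = (\<lambda>x::'a. {x, x + 1})"
  have "card (\<Union>(range P)) = 2 * card (range P)"
  proof -
    have "card (\<Union>(range P)) = sum card (range P)"
    proof (rule card_Union_disjoint)
      show "pairwise disjnt (range P)"
        unfolding pairwise_def disjnt_def P_def using inv by auto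
    qed (auto simp: P_def)
    also have "\<dots> = sum (\<lambda>_. 2) (range P)"
      by (rule sum.cong) (auto simp: P_def)
    finally show ?thesis by simp
  qed
  moreover have "\<Union>(range P) = UNIV"
    by (auto simp: P_def)
  ultimately show False
    using assms by simp
qed

context
  assumes odd_card: "odd CARD('a::{field,finite})"
begin

lemma card_sqrt:
  fixes c :: 'a
  shows "real (card {t. t\<^sup>2 = c}) = 1 + qchar c"
proof -
  have two: "(2::'a) \<noteq> 0"
    by (rule two_neq_zero_if_odd_card[OF odd_card])
  consider "c = 0" | t where "c \<noteq> 0" "c = t\<^sup>2" | "c \<noteq> 0" "\<nexists>t. c = t\<^sup>2"
    by blast
  then show ?thesis
  proof cases
    case 1
    then have "{t. t\<^sup>2 = c} = {0}"
      by auto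
    then show ?thesis
      using 1 by simp
  next
    case 2
    then have "{u. u\<^sup>2 = c} = {t, - t}"
      by (auto simp: power2_eq_iff)
    moreover have "t \<noteq> - t"
      using 2 two by (metis mult_2 mult_eq_0_iff neg_eq_iff_add_eq_0 zero_power2)
    ultimately show ?thesis
      using 2 by (auto simp: qchar_def)
  next
    case 3
    then have "{u. u\<^sup>2 = c} = {}"
      by auto
    then show ?thesis
      using 3 by (auto simp: qchar_def)
  qed
qed

lemma sum_qchar: "(\<Sum>c::'a\<in>UNIV. qchar c) = 0"
proof -
  have "real CARD('a) = real (card (\<Union>c::'a\<in>UNIV. {t::'a. t\<^sup>2 = c}))"
    by (rule arg_cong[where f = "\<lambda>A. real (card A)"]) auto
  also have "\<dots> = (\<Sum>c::'a\<in>UNIV. real (card {t::'a. t\<^sup>2 = c}))"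
    by (subst card_UN_disjoint) auto
  also have "\<dots> = real CARD('a) + (\<Sum>c::'a\<in>UNIV. qchar c)"
    by (simp add: card_sqrt sum.distrib)
  finally show ?thesis
    by simp
qed

lemma sum_qchar_comp:
  fixes h :: "'a \<Rightarrow> 'a"
  assumes "bij h"
  shows "(\<Sum>c\<in>UNIV. qchar (h c)) = 0"
  using sum.reindex_bij_betw[OF assms, of qchar] sum_qchar by simp

text \<open>Multiplication by \<open>c\<close> permutes the field and the values of
  \<open>qchar\<close> add up to 0, before and after the multiplication. For a non-square
  \<open>c\<close> this balance leaves no room for a product of two non-squares to be a
  non-square.\<close>

lemma qchar_mult:
  fixes c d :: 'a
  shows "qchar (c * d) = qchar c * qchar d"
proof -
  have sq: "qchar (t\<^sup>2 * d) = qchar d" if "t \<noteq> 0" for t d :: 'a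
  proof -
    have "(\<exists>u. t\<^sup>2 * d = u\<^sup>2) \<longleftrightarrow> (\<exists>u. d = u\<^sup>2)"
    proof
      assume "\<exists>u. t\<^sup>2 * d = u\<^sup>2"
      then obtain u where "t\<^sup>2 * d = u\<^sup>2" by blast
      then have "d = (u / t)\<^sup>2"
        using that by (simp add: power_divide eq_divide_eq mult.commute)
      then show "\<exists>u. d = u\<^sup>2" by blast
    next
      assume "\<exists>u. d = u\<^sup>2"
      then show "\<exists>u. t\<^sup>2 * d = u\<^sup>2"
        by (metis power_mult_distrib)
    qed
    then show ?thesis
      using that by (simp add: qchar_def)
  qed
  have *: "(\<Sum>x::'a\<in>UNIV. qchar x + qchar (c * x)) = 0" if "c \<noteq> 0"
  proof -
    have "bij ((*) c)"
      using that by (rule_tac o_bij[where g = "\<lambda>x. x / c"]) (auto simp: fun_eq_iff)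
    then show ?thesis
      by (simp add: sum.distrib sum_qchar sum_qchar_comp)
  qed
  consider "c = 0 \<or> d = 0" | t where "c \<noteq> 0" "d \<noteq> 0" "c = t\<^sup>2"
    | "c \<noteq> 0" "d \<noteq> 0" "\<nexists>t. c = t\<^sup>2"
    by blast
  then show ?thesis
  proof cases
    case 1
    then show ?thesis by auto
  next
    case 2
    then show ?thesis
      using sq[of t d] by auto
  next
    case 3
    have neg: "qchar c = - 1"
      using 3 by (simp add: qchar_def)
    \<comment> \<open>For a non-square \<open>c\<close> every summand of \<open>*\<close> is non-positive, so all of them vanish.\<close>
    have le: "qchar x + qchar (c * x) \<le> 0" for x
    proof (cases "\<exists>t. x = t\<^sup>2")
      case True
      then obtain t where t: "x = t\<^sup>2" by blast
      show ?thesis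
      proof (cases "t = 0")
        case False
        then have "qchar (c * x) = - 1"
          using sq[of t c] neg t by (simp add: mult.commute)
        then show ?thesis
          using False t by simp
      qed (simp add: t)
    next
      case False
      then have "x \<noteq> 0"
        by (metis zero_power2)
      then have "qchar x = - 1"
        using False by (simp add: qchar_def)
      moreover have "qchar (c * x) \<le> 1"
        by (simp add: qchar_def)
      ultimately show ?thesis by simp
    qed
    have "\<forall>x\<in>UNIV. - (qchar x + qchar (c * x)) = 0"
    proof (rule iffD1[OF sum_nonneg_eq_0_iff])
      show "(\<Sum>x\<in>UNIV. - (qchar x + qchar (c * x))) = 0"
        using *[OF 3(1)] by (simp only: sum_negf minus_zero)
      show "0 \<le> - (qchar x + qchar (c * x))" for x
        using le[of x] by linarith
    qed simp
    then have "qchar d + qchar (c * d) = 0"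
      by (metis UNIV_I neg_equal_0_iff_equal)
    then show ?thesis
      using neg by simp
  qed
qed

lemma qchar_divide:
  fixes c d :: 'a
  shows "qchar (c / d) = qchar c * qchar d"
proof (cases "d = 0")
  case False
  then have "qchar c = qchar (c / d) * qchar d"
    by (simp flip: qchar_mult)
  then show ?thesis
    using qchar_mult_self[OF False] by (simp add: mult.assoc)
qed simp

text \<open>For non-zero \<open>c\<close> the product is \<open>qchar (1 + e / c)\<close>, whose
  argument runs once through all elements except 1. The missing value \<open>qchar 1\<close>
  accounts for the -1.\<close>

lemma sum_qchar_shift:
  fixes e :: 'a
  assumes "e \<noteq> 0"
  shows "(\<Sum>c\<in>UNIV. qchar c * qchar (c + e)) = - 1"
proof -
  have "(\<Sum>c\<in>UNIV. qchar c * qchar (c + e)) = (\<Sum>c\<in>UNIV - {0}. qchar c * qchar (c + e))"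
    by (simp add: sum.remove[of UNIV 0])
  also have "\<dots> = (\<Sum>c\<in>UNIV - {0}. qchar (1 + e / c))"
  proof (rule sum.cong)
    fix c assume "c \<in> UNIV - {0::'a}"
    then have "1 + e / c = (c + e) / c"
      by (simp add: add_divide_distrib)
    then show "qchar c * qchar (c + e) = qchar (1 + e / c)"
      by (simp add: qchar_divide)
  qed simp
  also have "\<dots> = (\<Sum>u\<in>UNIV - {1::'a}. qchar u)"
    by (rule sum.reindex_bij_witness[of _ "\<lambda>u. e / (u - 1)" "\<lambda>c. 1 + e / c"])
      (use assms in \<open>auto simp: field_simps\<close>)
  also have "\<dots> = - 1"
    using sum_qchar by (simp add: sum.remove[of UNIV 1])
  finally show ?thesis .
qed

text \<open>After dividing by \<open>- z\<close>, sum over the squares: a value \<open>c\<close> is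
  attained by \<open>1 + qchar c\<close> elements, so the sum is a complete character sum, which is
  0, plus a correlation of \<open>qchar\<close> with its shift.\<close>

lemma sum_qchar_quadratic:
  fixes c z :: 'a
  assumes "z \<noteq> 0"
  shows "(\<Sum>t\<in>UNIV. qchar (c - z * t\<^sup>2))
    = (if c = 0 then real CARD('a) - 1 else - 1) * qchar (- z)"
proof -
  have *: "(\<Sum>t\<in>UNIV. qchar (t\<^sup>2 + e)) = - 1" if "e \<noteq> 0" for e :: 'a
  proof -
    have "(\<Sum>t\<in>UNIV. qchar (t\<^sup>2 + e))
      = (\<Sum>t\<in>UNIV. \<Sum>c\<in>UNIV. if t\<^sup>2 = c then qchar (c + e) else 0)"
      by (rule sum.cong) simp_all
    also have "\<dots> = (\<Sum>c\<in>UNIV. \<Sum>t\<in>UNIV. if t\<^sup>2 = c then qchar (c + e) else 0)"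
      by (rule sum.swap)
    also have "\<dots> = (\<Sum>c\<in>UNIV. real (card {t. t\<^sup>2 = c}) * qchar (c + e))"
      by (rule sum.cong) (simp_all add: sum.If_cases)
    also have "\<dots> = (\<Sum>c\<in>UNIV. qchar (c + e)) + (\<Sum>c\<in>UNIV. qchar c * qchar (c + e))"
      by (simp add: card_sqrt distrib_right sum.distrib)
    also have "(\<Sum>c\<in>UNIV. qchar (c + e)) = 0"
      by (rule sum_qchar_comp) (rule o_bij[where g = "\<lambda>x. x - e"], auto simp: fun_eq_iff)
    also have "(\<Sum>c\<in>UNIV. qchar c * qchar (c + e)) = - 1"
      by (rule sum_qchar_shift[OF that])
    finally show ?thesis by simp
  qed
  have eq: "qchar (c - z * t\<^sup>2) = qchar (- z) * qchar (t\<^sup>2 + - c / z)" for t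
    using assms by (subst qchar_mult[symmetric]) (simp add: algebra_simps)
  show ?thesis
  proof (cases "c = 0")
    case True
    have "(\<Sum>t::'a\<in>UNIV. qchar (t\<^sup>2)) = (\<Sum>t::'a\<in>UNIV - {0}. 1)"
      by (subst sum.remove[of UNIV 0]) (auto intro: sum.cong)
    then have "(\<Sum>t::'a\<in>UNIV. qchar (t\<^sup>2)) = real CARD('a) - 1"
      by (simp add: card_Diff_singleton of_nat_diff)
    moreover have "qchar (c - z * t\<^sup>2) = qchar (- z) * qchar (t\<^sup>2)" for t
      using True by (simp flip: qchar_mult)
    ultimately show ?thesis
      using True by (simp only: flip: sum_distrib_left) simp
  next
    case False
    then show ?thesis
      using assms *[of "- c / z"] by (simp add: eq flip: sum_distrib_left)
  qed
qed

end

section \<open>The sums in the closed form\<close>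

lemma psi_minus_empty: "b < a \<Longrightarrow> psi_minus a b x = 1"
  by (simp add: psi_minus_def)

lemma psi_minus_first:
  assumes "a \<le> b"
  shows "psi_minus a b x = (x powi a - 1) * psi_minus (a + 1) b x"
proof -
  have "{a..b} = insert a {a + 1..b}"
    using assms by auto
  then show ?thesis
    by (simp add: psi_minus_def)
qed

lemma psi_minus_last:
  assumes "a \<le> b"
  shows "psi_minus a b x = psi_minus a (b - 1) x * (x powi b - 1)"
proof -
  have "{a..b} = insert b {a..b - 1}"
    using assms by auto
  then show ?thesis
    by (simp add: psi_minus_def mult.commute)
qed

lemma psi_minus_pos:
  assumes "x > 1" and "a \<ge> 1"
  shows "psi_minus a b x > 0"
  unfolding psi_minus_def
proof (intro prod_pos ballI)
  fix k assume "k \<in> {a..b}"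
  then have "x powi k > 1"
    using assms by (simp add: one_less_power_int)
  then show "0 < x powi k - 1" by simp
qed

lemma chi_empty: "b < 1 \<Longrightarrow> chi 1 b x = 1"
  by (simp add: chi_def)

lemma chi_last:
  assumes "1 \<le> b"
  shows "chi 1 b x = (x powi (2 * b - 1) - 1) * chi 1 (b - 1) x"
proof -
  have "{1..b} = insert b {1..b - 1}"
    using assms by auto
  then show ?thesis
    by (simp add: chi_def)
qed

lemma gauss_coeff_0:
  assumes "t \<ge> - 1"
  shows "gauss_coeff t 0 x = 1"
  using assms by (auto simp: gauss_coeff_def psi_minus_empty)

lemma gauss_coeff_neg: "m < 0 \<Longrightarrow> gauss_coeff t m x = 0"
  by (simp add: gauss_coeff_def)

lemma gauss_coeff_gt:
  assumes "t \<ge> - 1" and "m > t" and "m > 0"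
  shows "gauss_coeff t m x = 0"
  using assms by (simp add: gauss_coeff_def)

text \<open>Of the two Pascal rules this is the one whose power \<open>x powi m\<close> merges with
  the quadratic exponent in \<open>gsum\<close>. At \<open>s = 0\<close> it holds because the
  coefficient with top -1 and bottom 0 is 1 by convention.\<close>

lemma gauss_coeff_Pascal:
  assumes "x > 1" and "0 \<le> m" and "m \<le> s"
  shows "gauss_coeff s m x = x powi m * gauss_coeff (s - 1) m x + gauss_coeff (s - 1) (m - 1) x"
proof -
  consider "m = 0" | "m > 0" "m = s" | "m > 0" "m < s"
    using assms by linarith
  then show ?thesis
  proof cases
    case 1
    then show ?thesis
      using assms by (simp add: gauss_coeff_0 gauss_coeff_neg)
  next
    case 2
    have "psi_minus 1 s x \<noteq> 0" "psi_minus 1 (s - 1) x \<noteq> 0"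
      using psi_minus_pos[OF assms(1), of 1] by (metis less_irrefl order_refl)+
    then have "gauss_coeff s s x = 1" "gauss_coeff (s - 1) (s - 1) x = 1"
      using 2 by (simp_all add: gauss_coeff_def)
    then show ?thesis
      using 2 by (simp add: gauss_coeff_gt)
  next
    case 3
    define P where "P = psi_minus (s - m + 1) (s - 1) x"
    define R where "R = psi_minus 1 (m - 1) x"
    have R: "R > 0" and xm: "x powi m - 1 > 0"
      using psi_minus_pos[OF assms(1), of 1 "m - 1"] 3 assms(1)
      by (simp_all add: R_def one_less_power_int)
    have "gauss_coeff s m x = P * (x powi s - 1) / (R * (x powi m - 1))"
      using 3 psi_minus_last[of "s - m + 1" s x] psi_minus_last[of 1 m x]
      by (simp add: gauss_coeff_def P_def R_def)
    moreover have "gauss_coeff (s - 1) m x = (x powi (s - m) - 1) * P / (R * (x powi m - 1))"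
      using 3 psi_minus_first[of "s - m" "s - 1" x] psi_minus_last[of 1 m x]
      by (simp add: gauss_coeff_def P_def R_def)
    moreover have "gauss_coeff (s - 1) (m - 1) x = P / R"
      using 3 by (simp add: gauss_coeff_def P_def R_def)
    moreover have "P / R = P * (x powi m - 1) / (R * (x powi m - 1))"
      using xm by simp
    moreover have "x powi m * x powi (s - m) = x powi s"
      using assms(1) by (simp flip: power_int_add)
    ultimately show ?thesis
      by (simp add: algebra_simps flip: add_divide_distrib)
  qed
qed

text \<open>The common shape of the six sums of the closed form. The range \<open>s\<close> is
  separate from the top index \<open>t\<close>, since all six share one range while their Gaussian
  coefficients have top \<open>s\<close> or \<open>s - 1\<close>; \<open>u\<close> is the offset of
  the lower index and \<open>c\<close> the linear coefficient of the exponent.\<close>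

definition gsum :: "real \<Rightarrow> int \<Rightarrow> int \<Rightarrow> int \<Rightarrow> int \<Rightarrow> int \<Rightarrow> real" where
  "gsum q J s t u c =
     (\<Sum>m = 0..s. chi 1 (J - m) q * gauss_coeff t (m - u) (q\<^sup>2) * q powi (m * (m + c)))"

context
  fixes q :: real
  assumes q: "q > 1"
begin

lemma powi_mult: "q powi a * q powi b = q powi (a + b)"
  using q by (simp add: power_int_add)

text \<open>The factor \<open>(q^2) powi m\<close> of the Pascal rule raises the linear coefficient
  of the exponent by 2.\<close>

lemma gsum_Pascal:
  "gsum q J s s 0 c = gsum q J s (s - 1) 0 (c + 2) + gsum q J s (s - 1) 1 c"
  unfolding gsum_def sum.distrib[symmetric]
proof (rule sum.cong)
  fix m assume m: "m \<in> {0..s}"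
  have "(q\<^sup>2) powi m * q powi (m * (m + c)) = q powi (m * (m + (c + 2)))"
  proof -
    have "(q\<^sup>2) powi m = q powi (2 * m)"
      by (simp add: power_int_mult)
    then show ?thesis
      unfolding powi_mult by (simp only: powi_mult) (simp add: algebra_simps)
  qed
  moreover have "gauss_coeff s m (q\<^sup>2)
      = (q\<^sup>2) powi m * gauss_coeff (s - 1) m (q\<^sup>2) + gauss_coeff (s - 1) (m - 1) (q\<^sup>2)"
    using m q by (intro gauss_coeff_Pascal) (auto simp: one_less_power)
  ultimately show "chi 1 (J - m) q * gauss_coeff s (m - 0) (q\<^sup>2) * q powi (m * (m + c))
    = chi 1 (J - m) q * gauss_coeff (s - 1) (m - 0) (q\<^sup>2) * q powi (m * (m + (c + 2)))
      + chi 1 (J - m) q * gauss_coeff (s - 1) (m - 1) (q\<^sup>2) * q powi (m * (m + c))"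
    by (simp add: algebra_simps)
qed simp

text \<open>Split off the last factor \<open>q powi (2 * (J - m) - 1) - 1\<close> of
  \<open>chi\<close>; its dependence on \<open>m\<close> lowers the linear coefficient by 2. For
  \<open>m \<ge> J\<close> there is no factor to split off, but there the bound on \<open>t\<close>
  makes the Gaussian coefficient vanish.\<close>

lemma gsum_chi:
  assumes "t \<le> J - 1" and "1 \<le> J" and "- 1 \<le> t"
  shows "gsum q J s t 0 c = q powi (2 * J - 1) * gsum q (J - 1) s t 0 (c - 2) - gsum q (J - 1) s t 0 c"
  unfolding gsum_def sum_distrib_left sum_subtractf[symmetric]
proof (rule sum.cong)
  fix m assume m: "m \<in> {0..s}"
  show "chi 1 (J - m) q * gauss_coeff t (m - 0) (q\<^sup>2) * q powi (m * (m + c))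
    = q powi (2 * J - 1) * (chi 1 (J - 1 - m) q * gauss_coeff t (m - 0) (q\<^sup>2) * q powi (m * (m + (c - 2))))
      - chi 1 (J - 1 - m) q * gauss_coeff t (m - 0) (q\<^sup>2) * q powi (m * (m + c))"
  proof (cases "m \<le> J - 1")
    case True
    have "chi 1 (J - m) q = (q powi (2 * (J - m) - 1) - 1) * chi 1 (J - 1 - m) q"
      using chi_last[of "J - m" q] True by (simp add: algebra_simps)
    moreover have "q powi (2 * (J - m) - 1) * q powi (m * (m + c))
        = q powi (2 * J - 1) * q powi (m * (m + (c - 2)))"
      unfolding powi_mult by (simp add: algebra_simps)
    ultimately show ?thesis
      unfolding diff_zero by algebra
  next
    case False
    then have "gauss_coeff t m (q\<^sup>2) = 0"
      using assms by (intro gauss_coeff_gt) auto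
    then show ?thesis by simp
  qed
qed simp

lemma gsum_trim:
  assumes "1 \<le> s"
  shows "gsum q J s (s - 1) 0 c = gsum q J (s - 1) (s - 1) 0 c"
proof -
  have "{0..s} = insert s {0..s - 1}"
    using assms by auto
  then show ?thesis
    using assms by (simp add: gsum_def gauss_coeff_gt)
qed

lemma gsum_shift:
  assumes "1 \<le> s"
  shows "gsum q J s (s - 1) 1 c = q powi (c + 1) * gsum q (J - 1) (s - 1) (s - 1) 0 (c + 2)"
proof -
  have "{0..s} = insert 0 {1..s}"
    using assms by auto
  then have "gsum q J s (s - 1) 1 c
    = (\<Sum>m = 1..s. chi 1 (J - m) q * gauss_coeff (s - 1) (m - 1) (q\<^sup>2) * q powi (m * (m + c)))"
    by (simp add: gsum_def gauss_coeff_neg)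
  also have "\<dots> = (\<Sum>m = 0..s - 1. chi 1 (J - (m + 1)) q * gauss_coeff (s - 1) m (q\<^sup>2)
      * q powi ((m + 1) * (m + 1 + c)))"
    by (rule sum.reindex_bij_witness[of _ "\<lambda>m. m + 1" "\<lambda>m. m - 1"]) auto
  also have "\<dots> = q powi (c + 1) * gsum q (J - 1) (s - 1) (s - 1) 0 (c + 2)"
    unfolding gsum_def sum_distrib_left
  proof (rule sum.cong)
    fix m :: int
    have "q powi ((m + 1) * (m + 1 + c)) = q powi (c + 1) * q powi (m * (m + (c + 2)))"
      unfolding powi_mult by (simp add: algebra_simps)
    then show "chi 1 (J - (m + 1)) q * gauss_coeff (s - 1) m (q\<^sup>2) * q powi ((m + 1) * (m + 1 + c))
      = q powi (c + 1) * (chi 1 (J - 1 - m) q * gauss_coeff (s - 1) (m - 0) (q\<^sup>2) * q powi (m * (m + (c + 2))))"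
      by (simp add: algebra_simps)
  qed simp
  finally show ?thesis .
qed

lemma gsum_0: "t \<ge> - 1 \<Longrightarrow> gsum q J 0 t 0 c = chi 1 J q"
  by (simp add: gsum_def gauss_coeff_0)

lemma gsum_0_1: "gsum q J 0 t 1 c = 0"
  by (simp add: gsum_def gauss_coeff_neg)

end

text \<open>
  The number of non-degenerate complements (\<open>total\<close>) and the sum of their types (\<open>signed\<close>). The two
  letters are the parities of the rank \<open>d\<close> and of the dimension \<open>j\<close> of the subspace; \<open>I\<close> and \<open>s\<close> are
  the halves, rounded down, of \<open>i\<close> and \<open>d\<close>, and the complements have dimension \<open>2 K\<close>. The signs \<open>b\<close>
  and \<open>a\<close> are those of the subspace and of the whole space, and \<open>l\<close> is their product.
\<close>

definition total_ee :: "real \<Rightarrow> int \<Rightarrow> int \<Rightarrow> int \<Rightarrow> real" where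
  "total_ee q I s K = q powi (4 * (I + s) * K - (I + s)\<^sup>2) * gsum q (I + s) s s 0 (2 * I - 2 * K - 1)"

definition signed_ee :: "real \<Rightarrow> int \<Rightarrow> int \<Rightarrow> int \<Rightarrow> real \<Rightarrow> real \<Rightarrow> real" where
  "signed_ee q I s K b a = q powi (4 * (I + s) * K - (I + s)\<^sup>2) *
     ((q powi (- K) - b * q powi (- (K + s)) + a * q powi (- (I + s)))
        * gsum q (I + s) s (s - 1) 0 (2 * I - 2 * K + 1)
      + a * b * q powi (- I) * gsum q (I + s) s (s - 1) 1 (2 * I - 2 * K - 1))"

definition total_eo :: "real \<Rightarrow> int \<Rightarrow> int \<Rightarrow> int \<Rightarrow> real" where
  "total_eo q I s K = q powi ((2 * (I + s) + 1) * (2 * K) - (I + s + 1)\<^sup>2)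
     * gsum q (I + s + 1) s s 0 (2 * I - 2 * K + 1)"

definition signed_eo :: "real \<Rightarrow> int \<Rightarrow> int \<Rightarrow> int \<Rightarrow> real \<Rightarrow> real" where
  "signed_eo q I s K b = q powi ((2 * (I + s) + 1) * (2 * K) - (I + s + 1)\<^sup>2)
     * (q powi (2 * (I + s) + 1 - K) - b * q powi (2 * (I + s) + 1 - K - s))
     * gsum q (I + s) s (s - 1) 0 (2 * I - 2 * K + 1)"

definition total_oe :: "real \<Rightarrow> int \<Rightarrow> int \<Rightarrow> int \<Rightarrow> real" where
  "total_oe q I s K = q powi ((2 * (I + s) + 2) * (2 * K) - (I + s + 1)\<^sup>2)
     * gsum q (I + s + 1) s s 0 (2 * I - 2 * K + 1)"

definition signed_oe :: "real \<Rightarrow> int \<Rightarrow> int \<Rightarrow> int \<Rightarrow> real \<Rightarrow> real" where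
  "signed_oe q I s K a = total_oe q I s K * (q powi (- K) + a * q powi (- (I + s + 1)))"

definition total_oo :: "real \<Rightarrow> int \<Rightarrow> int \<Rightarrow> int \<Rightarrow> real \<Rightarrow> real" where
  "total_oo q I s K l = q powi ((2 * (I + s) + 1) * (2 * K) - (I + s + 1)\<^sup>2)
     * (gsum q (I + s + 1) s s 0 (2 * I - 2 * K + 1)
        + l * q powi (I - K) * gsum q (I + s) s s 0 (2 * I - 2 * K + 1))"

definition signed_oo :: "real \<Rightarrow> int \<Rightarrow> int \<Rightarrow> int \<Rightarrow> real" where
  "signed_oo q I s K = q powi ((2 * (I + s) + 1) * (2 * K) - (I + s + 1)\<^sup>2)
     * q powi (2 * (I + s) + 1 - K) * gsum q (I + s) s s 0 (2 * I - 2 * K - 1)"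

section \<open>Recursions of the closed forms in the rank\<close>

context
  fixes q :: real
  assumes q: "q > 1"
begin


text \<open>The right-hand side is the recursion for a radical of even dimension: \<open>g\<close>
  is the value for a radical enlarged by one dimension, and the \<open>total_oo\<close> term comes
  from the non-degenerate hyperplanes. By the Pascal rule all values are combinations of
  \<open>S1\<close> and \<open>S2\<close>; the mixed terms cancel and \<open>u * u = 1\<close> does
  the rest.\<close>

lemma total_ee_step:
  fixes I s K :: int and a b u :: real
  assumes "1 \<le> s" and "u * u = 1"
  defines "g \<equiv> total_oe q I (s - 1) K"
  shows "total_ee q I s K = g + u * (q powi (I + K) * total_oo q I (s - 1) K u - g * q powi (I - K))"
proof -
  define p where "p = q powi (4 * (I + s) * K - (I + s)\<^sup>2)"
  define e where "e = q powi (I - K)"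
  define S1 where "S1 = gsum q (I + s) (s - 1) (s - 1) 0 (2 * I - 2 * K + 1)"
  define S2 where "S2 = gsum q (I + s - 1) (s - 1) (s - 1) 0 (2 * I - 2 * K + 1)"
  define p2 where "p2 = q powi ((2 * (I + (s - 1)) + 1) * (2 * K) - (I + (s - 1) + 1)\<^sup>2)"
  have ee: "q powi (2 * I - 2 * K) = e * e"
    unfolding e_def powi_mult[OF q] by (simp add: algebra_simps)
  have 1: "total_ee q I s K = p * (S1 + e * e * S2)"
    unfolding total_ee_def p_def S1_def S2_def
    using gsum_Pascal[OF q, of "I + s" s "2 * I - 2 * K - 1"] ee
      gsum_trim[OF q assms(1), of "I + s" "2 * I - 2 * K + 1"]
      gsum_shift[OF q assms(1), of "I + s" "2 * I - 2 * K - 1"] by (simp add: algebra_simps)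
  have 2: "g = p * S1"
    unfolding g_def total_oe_def p_def S1_def by (simp add: algebra_simps)
  have 3: "total_oo q I (s - 1) K u = p2 * (S1 + u * e * S2)"
    unfolding total_oo_def p2_def S1_def S2_def e_def by (simp add: algebra_simps)
  have 4: "q powi (I + K) * p2 = p * e"
    unfolding p2_def p_def e_def powi_mult[OF q] by (simp add: algebra_simps power2_eq_square)
  show ?thesis
    unfolding 1 2 3 e_def[symmetric] using 4 assms(2) by algebra
qed

text \<open>The hyperplane value brings in a third sum \<open>S3\<close> with a smaller linear
  coefficient, which the recursion of \<open>chi\<close> eliminates.\<close>

lemma signed_ee_step:
  fixes I s K :: int and a b u :: real
  assumes "1 \<le> s" and "0 \<le> I" and "a * a = 1" and "b * b = 1"
  defines "g \<equiv> signed_oe q I (s - 1) K a"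
  shows "signed_ee q I s K b a
    = g + a * b * (q powi (I + K) * signed_oo q I (s - 1) K - g * q powi (I - K))"
proof -
  define p where "p = q powi (4 * (I + s) * K - (I + s)\<^sup>2)"
  define e where "e = q powi (I - K)"
  define k where "k = q powi (- K)"
  define z where "z = q powi (- I)"
  define y where "y = q powi (2 * (I + s) - 1)"
  define j where "j = q powi (- (I + s))"
  define S1 where "S1 = gsum q (I + s) (s - 1) (s - 1) 0 (2 * I - 2 * K + 1)"
  define S2 where "S2 = gsum q (I + s - 1) (s - 1) (s - 1) 0 (2 * I - 2 * K + 1)"
  define S3 where "S3 = gsum q (I + s - 1) (s - 1) (s - 1) 0 (2 * I - 2 * K - 1)"
  define p2 where "p2 = q powi ((2 * (I + (s - 1)) + 1) * (2 * K) - (I + (s - 1) + 1)\<^sup>2)"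
  have ee: "q powi (2 * I - 2 * K) = e * e"
    unfolding e_def powi_mult[OF q] by (simp add: algebra_simps)
  have ks: "q powi (- (K + s)) = e * j" and ze: "z * e = k"
    unfolding e_def j_def z_def k_def powi_mult[OF q] by (simp_all add: algebra_simps)
  have 1: "signed_ee q I s K b a = p * ((k - b * (e * j) + a * j) * S1 + a * b * z * (e * e * S2))"
  proof -
    have "gsum q (I + s) s (s - 1) 0 (2 * I - 2 * K + 1) = S1"
      unfolding S1_def by (rule gsum_trim[OF q assms(1)])
    moreover have "gsum q (I + s) s (s - 1) 1 (2 * I - 2 * K - 1) = e * e * S2"
      using gsum_shift[OF q assms(1), of "I + s" "2 * I - 2 * K - 1"] ee
      unfolding S2_def by (simp add: algebra_simps)
    ultimately show ?thesis
      unfolding signed_ee_def ks p_def k_def j_def z_def by simp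
  qed
  have 2: "g = p * S1 * (k + a * j)"
    unfolding g_def signed_oe_def total_oe_def p_def S1_def k_def j_def by (simp add: algebra_simps)
  have 3: "signed_oo q I (s - 1) K = p2 * (k * y) * S3"
    unfolding signed_oo_def p2_def S3_def k_def y_def powi_mult[OF q] by (simp add: algebra_simps)
  have 4: "q powi (I + K) * p2 = p * e"
    unfolding p2_def p_def e_def powi_mult[OF q] by (simp add: algebra_simps power2_eq_square)
  have 5: "S1 = y * S3 - S2"
    using gsum_chi[OF q, of "s - 1" "I + s" "s - 1" "2 * I - 2 * K + 1"] assms(1,2)
    unfolding S1_def S2_def S3_def y_def by (simp add: algebra_simps)
  show ?thesis
    unfolding 1 2 3 e_def[symmetric] using 4 5 assms(3,4) ze by algebra
qed

text \<open>The bracket is a multiple of \<open>y * S3 - S1\<close>, which the recursion of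
  \<open>chi\<close> identifies with the second sum of \<open>total_oo\<close>.\<close>

lemma total_oo_step:
  fixes I s K :: int and a b u :: real
  assumes "0 \<le> s" and "0 \<le> I"
  defines "g \<equiv> total_eo q I s K"
  shows "total_oo q I s K u = g + u * (q powi (I + K) * total_ee q I s K - g * q powi (I - K))"
proof -
  define p where "p = q powi ((2 * (I + s) + 1) * (2 * K) - (I + s + 1)\<^sup>2)"
  define p2 where "p2 = q powi (4 * (I + s) * K - (I + s)\<^sup>2)"
  define e where "e = q powi (I - K)"
  define y where "y = q powi (2 * (I + s) + 1)"
  define S1 where "S1 = gsum q (I + s + 1) s s 0 (2 * I - 2 * K + 1)"
  define S2 where "S2 = gsum q (I + s) s s 0 (2 * I - 2 * K + 1)"
  define S3 where "S3 = gsum q (I + s) s s 0 (2 * I - 2 * K - 1)"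
  have 1: "total_oo q I s K u = p * (S1 + u * e * S2)" "g = p * S1" "total_ee q I s K = p2 * S3"
    by (simp_all add: g_def total_oo_def total_eo_def total_ee_def p_def p2_def e_def S1_def S2_def S3_def)
  have 2: "q powi (I + K) * p2 = p * e * y"
    unfolding p2_def p_def e_def y_def powi_mult[OF q] by (simp add: algebra_simps power2_eq_square)
  have 3: "S1 = y * S3 - S2"
    using gsum_chi[OF q, of s "I + s + 1" s "2 * I - 2 * K + 1"] assms(1,2)
    unfolding S1_def S2_def S3_def y_def by (simp add: algebra_simps)
  show ?thesis
    unfolding 1 e_def[symmetric] using 2 3 by algebra
qed

text \<open>The Pascal rule writes the single sum of \<open>signed_oo\<close> as
  \<open>T + T2\<close>, and these are the two sums that occur in \<open>signed_ee\<close>.\<close>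

lemma signed_oo_step:
  fixes I s K :: int and a b u :: real
  assumes "a * a = 1" and "b * b = 1"
  defines "g \<equiv> signed_eo q I s K b"
  shows "signed_oo q I s K = g + a * b * (q powi (I + K) * signed_ee q I s K b a - g * q powi (I - K))"
proof -
  define p where "p = q powi ((2 * (I + s) + 1) * (2 * K) - (I + s + 1)\<^sup>2)"
  define p2 where "p2 = q powi (4 * (I + s) * K - (I + s)\<^sup>2)"
  define e where "e = q powi (I - K)"
  define k where "k = q powi (- K)"
  define z where "z = q powi (- I)"
  define w where "w = q powi (- s)"
  define y where "y = q powi (2 * (I + s) + 1)"
  define T where "T = gsum q (I + s) s (s - 1) 0 (2 * I - 2 * K + 1)"
  define T2 where "T2 = gsum q (I + s) s (s - 1) 1 (2 * I - 2 * K - 1)"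
  have pw: "q powi (2 * (I + s) + 1 - K) = y * k" "q powi (2 * (I + s) + 1 - K - s) = y * k * w"
      "q powi (- (K + s)) = k * w" "q powi (- (I + s)) = z * w" "z * e = k"
    unfolding y_def k_def w_def z_def e_def powi_mult[OF q] by (simp_all add: algebra_simps)
  have 1: "signed_oo q I s K = p * (y * k) * (T + T2)"
    unfolding signed_oo_def pw p_def T_def T2_def
    using gsum_Pascal[OF q, of "I + s" s "2 * I - 2 * K - 1"] by (simp add: algebra_simps)
  have 2: "g = p * (y * k - b * (y * k * w)) * T"
    unfolding g_def signed_eo_def pw p_def T_def by simp
  have 3: "signed_ee q I s K b a = p2 * ((k - b * (k * w) + a * (z * w)) * T + a * b * z * T2)"
    unfolding signed_ee_def pw p2_def T_def T2_def k_def z_def by simp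
  have 4: "q powi (I + K) * p2 = p * e * y"
    unfolding p2_def p_def e_def y_def powi_mult[OF q] by (simp add: algebra_simps power2_eq_square)
  show ?thesis
    unfolding 1 2 3 e_def[symmetric] using 4 pw(5) assms(1,2) by algebra
qed

lemma total_eo_step:
  fixes I s K :: int and a b u :: real
  assumes "1 \<le> s" and "0 \<le> I" and "u * u = 1"
  defines "g \<equiv> total_oo q (I + 1) (s - 1) K u"
  shows "total_eo q I s K
    = g + u * (g * q powi (I + 1 - K) - q powi (I + K + 1) * total_oe q I (s - 1) K)"
proof -
  define p where "p = q powi ((2 * (I + s) + 1) * (2 * K) - (I + s + 1)\<^sup>2)"
  define p2 where "p2 = q powi ((2 * (I + (s - 1)) + 2) * (2 * K) - (I + (s - 1) + 1)\<^sup>2)"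
  define e where "e = q powi (I + 1 - K)"
  define y where "y = q powi (2 * (I + s) + 1)"
  define S1 where "S1 = gsum q (I + s + 1) (s - 1) (s - 1) 0 (2 * I - 2 * K + 3)"
  define S2 where "S2 = gsum q (I + s) (s - 1) (s - 1) 0 (2 * I - 2 * K + 3)"
  define S3 where "S3 = gsum q (I + s) (s - 1) (s - 1) 0 (2 * I - 2 * K + 1)"
  have ee: "q powi (2 * I - 2 * K + 2) = e * e"
    unfolding e_def powi_mult[OF q] by (simp add: algebra_simps)
  have 1: "total_eo q I s K = p * (S1 + e * e * S2)"
    unfolding total_eo_def p_def S1_def S2_def
    using gsum_Pascal[OF q, of "I + s + 1" s "2 * I - 2 * K + 1"] ee
      gsum_trim[OF q assms(1), of "I + s + 1" "2 * I - 2 * K + 3"]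
      gsum_shift[OF q assms(1), of "I + s + 1" "2 * I - 2 * K + 1"] by (simp add: algebra_simps)
  have 2: "g = p * (S1 + u * e * S2)" "total_oe q I (s - 1) K = p2 * S3"
    unfolding g_def total_oo_def total_oe_def p_def p2_def S1_def S2_def S3_def e_def
    by (simp_all add: algebra_simps)
  have 3: "q powi (I + K + 1) * p2 = p * e * y"
    unfolding p2_def p_def e_def y_def powi_mult[OF q] by (simp add: algebra_simps power2_eq_square)
  have 4: "S1 = y * S3 - S2"
    using gsum_chi[OF q, of "s - 1" "I + s + 1" "s - 1" "2 * I - 2 * K + 3"] assms(1,2)
    unfolding S1_def S2_def S3_def y_def by (simp add: algebra_simps)
  show ?thesis
    unfolding 1 2 e_def[symmetric] using 3 4 assms(3) by algebra
qed

text \<open>The hyperplane value \<open>signed_oe\<close> is affine in the sign \<open>a\<close>. In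
  a recursion for a radical of odd dimension its constant and its linear part enter with different
  factors, hence the two separate products with \<open>t\<close>.\<close>

lemma signed_eo_step:
  fixes I s K :: int and a b u :: real
  assumes "1 \<le> s" and "a * a = 1"
  defines "g \<equiv> signed_oo q (I + 1) (s - 1) K" and "t \<equiv> total_oe q I (s - 1) K"
  shows "signed_eo q I s K b
    = g + u * (g * q powi (I + 1 - K) - q powi (I + K + 1) * (t * q powi (- K)))
      - a * b * (q powi (I + K) * (t * (a * q powi (- (I + s)))))"
proof -
  define p where "p = q powi ((2 * (I + s) + 1) * (2 * K) - (I + s + 1)\<^sup>2)"
  define p2 where "p2 = q powi ((2 * (I + (s - 1)) + 2) * (2 * K) - (I + (s - 1) + 1)\<^sup>2)"
  define e where "e = q powi (I + 1 - K)"
  define k where "k = q powi (- K)"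
  define w where "w = q powi (- s)"
  define j where "j = q powi (- (I + s))"
  define y where "y = q powi (2 * (I + s) + 1)"
  define S3 where "S3 = gsum q (I + s) (s - 1) (s - 1) 0 (2 * I - 2 * K + 1)"
  have pw: "q powi (2 * (I + s) + 1 - K) = y * k" "q powi (2 * (I + s) + 1 - K - s) = y * k * w"
    unfolding y_def k_def w_def powi_mult[OF q] by (simp_all add: algebra_simps)
  have 1: "signed_eo q I s K b = p * (y * k - b * (y * k * w)) * S3"
    unfolding signed_eo_def pw p_def S3_def gsum_trim[OF q assms(1)] by simp
  have 2: "g = p * (y * k) * S3" "t = p2 * S3"
    unfolding g_def t_def signed_oo_def total_oe_def pw[symmetric] p_def p2_def S3_def
    by (simp_all add: algebra_simps)
  have 3: "q powi (I + K + 1) * p2 = p * e * y" "q powi (I + K) * p2 * j = p * y * k * w"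
    unfolding p2_def p_def e_def y_def j_def k_def w_def powi_mult[OF q]
    by (simp_all add: algebra_simps power2_eq_square)
  show ?thesis
    unfolding 1 2 e_def[symmetric] k_def[symmetric] j_def[symmetric] using 3 assms(2) by algebra
qed

text \<open>The bracket vanishes and \<open>g\<close> already equals the left-hand side; the form is
  kept parallel to the other recursions.\<close>

lemma total_oe_step:
  fixes I s K :: int and a b u :: real
  defines "g \<equiv> total_ee q (I + 1) s K"
  shows "total_oe q I s K
    = g + u * (g * q powi (I + 1 - K) - q powi (I + K + 1) * total_eo q I s K)"
proof -
  define S where "S = gsum q (I + s + 1) s s 0 (2 * I - 2 * K + 1)"
  define p where "p = q powi ((2 * (I + s) + 2) * (2 * K) - (I + s + 1)\<^sup>2)"
  define p2 where "p2 = q powi ((2 * (I + s) + 1) * (2 * K) - (I + s + 1)\<^sup>2)"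
  have 1: "total_oe q I s K = p * S" "g = p * S" "total_eo q I s K = p2 * S"
    unfolding total_oe_def g_def total_ee_def total_eo_def S_def p_def p2_def
    by (simp_all add: algebra_simps)
  have 2: "q powi (I + K + 1) * p2 = p * q powi (I + 1 - K)"
    unfolding p2_def p_def powi_mult[OF q] by (simp add: algebra_simps power2_eq_square)
  show ?thesis
    unfolding 1 using 2 by algebra
qed

text \<open>For \<open>s = 0\<close> the rank is 0 and the sign \<open>b\<close> must be 1: then
  \<open>signed_eo\<close> and the shifted sum \<open>T2\<close> vanish. For positive
  \<open>s\<close> the recursion of \<open>chi\<close> replaces \<open>y * S3\<close> by
  \<open>T + S2\<close>, and \<open>S2\<close> is \<open>T2\<close> up to a power of
  \<open>q\<close>.\<close>

lemma signed_oe_step: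
  fixes I s K :: int and a b u :: real
  assumes "0 \<le> s" and "0 \<le> I" and "a * a = 1" and "b * b = 1" and "s = 0 \<Longrightarrow> b = 1"
  defines "g \<equiv> signed_ee q (I + 1) s K b a"
  shows "signed_oe q I s K a
    = g + a * b * (g * q powi (I + 1 - K) - q powi (I + K + 1) * signed_eo q I s K b)"
proof -
  define p where "p = q powi ((2 * (I + s) + 2) * (2 * K) - (I + s + 1)\<^sup>2)"
  define p2 where "p2 = q powi ((2 * (I + s) + 1) * (2 * K) - (I + s + 1)\<^sup>2)"
  define e where "e = q powi (I + 1 - K)"
  define k where "k = q powi (- K)"
  define z where "z = q powi (- (I + 1))"
  define w where "w = q powi (- s)"
  define y where "y = q powi (2 * (I + s) + 1)"
  define T where "T = gsum q (I + s + 1) s (s - 1) 0 (2 * I - 2 * K + 3)"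
  define T2 where "T2 = gsum q (I + s + 1) s (s - 1) 1 (2 * I - 2 * K + 1)"
  define S3 where "S3 = gsum q (I + s) s (s - 1) 0 (2 * I - 2 * K + 1)"
  have pw: "q powi (2 * (I + s) + 1 - K) = y * k" "q powi (2 * (I + s) + 1 - K - s) = y * k * w"
      "q powi (- (K + s)) = k * w" "q powi (- (I + s + 1)) = z * w" "q powi (- (I + 1 + s)) = z * w" "z * e = k"
    unfolding y_def k_def w_def z_def e_def powi_mult[OF q] by (simp_all add: algebra_simps)
  have 1: "signed_oe q I s K a = p * (T + T2) * (k + a * (z * w))"
    unfolding signed_oe_def total_oe_def pw p_def T_def T2_def k_def
    using gsum_Pascal[OF q, of "I + s + 1" s "2 * I - 2 * K + 1"] by (simp add: algebra_simps)
  have 2: "g = p * ((k - b * (k * w) + a * (z * w)) * T + a * b * z * T2)"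
    unfolding g_def signed_ee_def pw p_def T_def T2_def k_def z_def
    by (simp add: algebra_simps)
  have 3: "signed_eo q I s K b = p2 * (y * k - b * (y * k * w)) * S3"
    unfolding signed_eo_def pw p2_def S3_def by simp
  have 4: "q powi (I + K + 1) * p2 = p * e"
    unfolding p2_def p_def e_def powi_mult[OF q] by (simp add: algebra_simps power2_eq_square)
  show ?thesis
  proof (cases "s = 0")
    case True
    then have "b = 1" "w = 1" "T2 = 0"
      using assms(5) by (simp_all add: w_def T2_def gsum_0_1[OF q])
    then show ?thesis
      unfolding 1 2 3 e_def[symmetric] using pw(6) assms(3) by algebra
  next
    case False
    then have s: "1 \<le> s"
      using assms(1) by simp
    define S2 where "S2 = gsum q (I + s) s (s - 1) 0 (2 * I - 2 * K + 3)"
    have ee: "q powi (2 * I - 2 * K + 2) = e * e"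
      unfolding e_def powi_mult[OF q] by (simp add: algebra_simps)
    have 5: "T2 = e * e * S2"
      using gsum_shift[OF q s, of "I + s + 1" "2 * I - 2 * K + 1"] ee
        gsum_trim[OF q s, of "I + s" "2 * I - 2 * K + 3"]
      unfolding T2_def S2_def by (simp add: algebra_simps)
    have 6: "T = y * S3 - S2"
      using gsum_chi[OF q, of "s - 1" "I + s + 1" s "2 * I - 2 * K + 3"] s assms(2)
      unfolding T_def S2_def S3_def y_def by (simp add: algebra_simps)
    have "g + a * b * (g * e - q powi (I + K + 1) * signed_eo q I s K b)
      = p * ((k - b * (k * w) + a * (z * w)) * T + a * b * z * T2
        + a * b * e * ((k - b * (k * w) + a * (z * w)) * T + a * b * z * T2 - (k - b * (k * w)) * (y * S3)))"
      unfolding 2 3 using 4 by algebra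
    also have "y * S3 = T + S2"
      using 6 by simp
    also have "(k - b * (k * w) + a * (z * w)) * T + a * b * z * T2
        + a * b * e * ((k - b * (k * w) + a * (z * w)) * T + a * b * z * T2 - (k - b * (k * w)) * (T + S2))
      = (T + T2) * (k + a * (z * w))"
      using 5 pw(6) assms(3,4) by algebra
    finally show ?thesis
      unfolding 1 e_def by (simp add: mult.assoc)
  qed
qed

section \<open>The closed forms in rank 0 and their recursion\<close>

lemma total_eo_0:
  "total_eo q I 0 K = q powi ((2 * I + 1) * (2 * K) - (I + 1)\<^sup>2) * chi 1 (I + 1) q"
  by (simp add: total_eo_def gsum_0[OF q])

lemma total_ee_0: "total_ee q I 0 K = q powi (4 * I * K - I\<^sup>2) * chi 1 I q"
  by (simp add: total_ee_def gsum_0[OF q])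

lemma signed_eo_0: "signed_eo q I 0 K 1 = 0"
  by (simp add: signed_eo_def)

lemma signed_ee_0: "signed_ee q I 0 K 1 a = q powi (4 * I * K - I\<^sup>2) * (a * q powi (- I)) * chi 1 I q"
  by (simp add: signed_ee_def gsum_0[OF q] gsum_0_1[OF q])

text \<open>Removing two hyperbolic planes lowers the dimension of the ambient space by 4 and that
  of the isotropic subspace by 2, so \<open>K\<close> drops by 1. At \<open>I = 0\<close> the factor
  \<open>q powi (2 * I) - 1\<close> of the smaller case is zero.\<close>

lemma total_eo_base:
  assumes "0 \<le> I"
  shows "total_eo q I 0 K = q powi (2 * K - 1) * ((q - 1) * total_ee q I 0 K
    + (q powi (2 * I) - 1) * (q powi (2 * K - 1) * (q powi (2 * I - 1) * total_eo q (I - 1) 0 (K - 1))))"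
proof -
  define p where "p = q powi (4 * I * K - I\<^sup>2)"
  define y where "y = q powi (2 * I)"
  have 1: "total_eo q I 0 K = q powi ((2 * I + 1) * (2 * K) - (I + 1)\<^sup>2) * ((q * y - 1) * chi 1 I q)"
    using chi_last[of "I + 1" q] assms q
    unfolding total_eo_0 y_def by (simp add: power_int_add)
  have 2: "total_eo q (I - 1) 0 (K - 1) = q powi ((2 * I - 1) * (2 * K - 2) - I\<^sup>2) * chi 1 I q"
    unfolding total_eo_0 by (simp add: algebra_simps)
  have 3: "y * q powi ((2 * I + 1) * (2 * K) - (I + 1)\<^sup>2) = q powi (2 * K - 1) * p"
    unfolding y_def p_def powi_mult[OF q] by (simp add: algebra_simps power2_eq_square)
  have 4: "y * (q powi (2 * K - 1) * (q powi (2 * I - 1) * q powi ((2 * I - 1) * (2 * K - 2) - I\<^sup>2))) = p"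
    unfolding y_def p_def powi_mult[OF q] by (simp add: algebra_simps power2_eq_square)
  have y: "y \<noteq> 0"
    using q by (simp add: y_def)
  define A where "A = q powi (2 * K - 1)"
  define B where "B = q powi (2 * I - 1)"
  define D where "D = q powi ((2 * I - 1) * (2 * K - 2) - I\<^sup>2)"
  define X where "X = chi 1 I q"
  have 5: "y * (A * ((q - 1) * (p * X) + (y - 1) * (A * (B * (D * X)))))
    = A * ((q - 1) * y * p * X + (y - 1) * (y * (A * (B * D))) * X)"
    by (simp add: algebra_simps)
  have "y * total_eo q I 0 K = q powi (2 * K - 1) * p * ((q * y - 1) * chi 1 I q)"
    unfolding 1 using 3 by algebra
  also have "\<dots> = y * (q powi (2 * K - 1) * ((q - 1) * total_ee q I 0 K
    + (q powi (2 * I) - 1) * (q powi (2 * K - 1) * (q powi (2 * I - 1) * total_eo q (I - 1) 0 (K - 1)))))"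
    unfolding 2 total_ee_0 p_def[symmetric] y_def[symmetric] A_def[symmetric]
      B_def[symmetric] D_def[symmetric] X_def[symmetric]
    unfolding 5 4[folded A_def B_def D_def] by (simp add: algebra_simps)
  finally show ?thesis
    using y by simp
qed

lemma ee_base_factor:
  "q powi (2 * K - 1) * (q powi (2 * K - 1) * (q powi (2 * I - 2) * q powi (4 * (I - 1) * (K - 1) - (I - 1)\<^sup>2)))
    = q powi (4 * I * K - I\<^sup>2 - 1)"
  unfolding powi_mult[OF q] by (simp add: algebra_simps power2_eq_square)

lemma total_ee_base:
  assumes "1 \<le> I"
  shows "total_ee q I 0 K = q powi (2 * K - 1) * ((q - 1) * total_eo q (I - 1) 0 K
    + (q powi (2 * I - 1) - 1) * (q powi (2 * K - 1) * (q powi (2 * I - 2) * total_ee q (I - 1) 0 (K - 1))))"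
proof -
  define p where "p = q powi (4 * I * K - I\<^sup>2 - 1)"
  have 1: "q powi (4 * I * K - I\<^sup>2) = q * p"
    using powi_mult[OF q, of 1 "4 * I * K - I\<^sup>2 - 1"] by (simp add: p_def)
  have 2: "q powi (2 * K - 1) * q powi ((2 * (I - 1) + 1) * (2 * K) - (I - 1 + 1)\<^sup>2) = p"
    unfolding p_def powi_mult[OF q] by (simp add: algebra_simps)
  define A where "A = q powi (2 * K - 1)"
  define B where "B = q powi (2 * I - 2)"
  define C where "C = q powi (2 * I - 1)"
  define D where "D = q powi (4 * (I - 1) * (K - 1) - (I - 1)\<^sup>2)"
  define R where "R = q powi ((2 * (I - 1) + 1) * (2 * K) - (I - 1 + 1)\<^sup>2)"
  define X where "X = chi 1 (I - 1) q"
  have 3: "chi 1 (I - 1 + 1) q = (C - 1) * X" "chi 1 I q = (C - 1) * X"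
    using chi_last[OF assms, of q] by (simp_all add: C_def X_def)
  have 4: "A * ((q - 1) * (R * ((C - 1) * X)) + (C - 1) * (A * (B * (D * X))))
    = (q - 1) * (A * R) * ((C - 1) * X) + (C - 1) * (A * (A * (B * D))) * X"
    by (simp add: algebra_simps)
  show ?thesis
    unfolding total_ee_0 total_eo_0 1 3 A_def[symmetric] B_def[symmetric] C_def[symmetric]
      D_def[symmetric] R_def[symmetric] X_def[symmetric]
    unfolding 4 2[folded A_def R_def] ee_base_factor[of K I, folded p_def A_def B_def D_def]
    by (simp add: algebra_simps)
qed

lemma signed_ee_base:
  assumes "1 \<le> I"
  shows "signed_ee q I 0 K 1 a = q powi (2 * K - 1) *
    ((q powi (2 * I - 1) - 1) * (q powi (2 * K - 1) * (q powi (2 * I - 2) * signed_ee q (I - 1) 0 (K - 1) 1 a)))"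
proof -
  define p where "p = q powi (4 * I * K - I\<^sup>2 - 1)"
  have 1: "q powi (4 * I * K - I\<^sup>2) * q powi (- I) = p * q powi (- (I - 1))"
    unfolding p_def powi_mult[OF q] by (simp add: algebra_simps)
  define A where "A = q powi (2 * K - 1)"
  define B where "B = q powi (2 * I - 2)"
  define C where "C = q powi (2 * I - 1)"
  define D where "D = q powi (4 * (I - 1) * (K - 1) - (I - 1)\<^sup>2)"
  define R where "R = q powi (4 * I * K - I\<^sup>2)"
  define S where "S = q powi (- I)"
  define T where "T = q powi (- (I - 1))"
  define X where "X = chi 1 (I - 1) q"
  have 3: "chi 1 I q = (C - 1) * X"
    using chi_last[OF assms, of q] by (simp add: C_def X_def)
  show ?thesis
    unfolding signed_ee_0 3 A_def[symmetric] B_def[symmetric] C_def[symmetric]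
      D_def[symmetric] R_def[symmetric] S_def[symmetric] T_def[symmetric] X_def[symmetric]
    using 1[folded R_def S_def T_def] ee_base_factor[of K I, folded p_def A_def B_def D_def]
    by algebra
qed

end

section \<open>Quadratic spaces of odd order\<close>

locale odd_quadratic_space = quadratic_space scale Q f
  for scale :: "'a::{field,finite} \<Rightarrow> 'v::{ab_group_add,finite} \<Rightarrow> 'v"
    and Q :: "'v \<Rightarrow> 'a" and f :: "'v \<Rightarrow> 'v \<Rightarrow> 'a" +
  fixes q :: real
  assumes odd_card: "odd CARD('a)" and q_eq: "q = real CARD('a)"
begin

definition some_basis :: "'v set" where
  "some_basis = (SOME B. independent B \<and> span B = UNIV)"

lemma some_basis: "independent some_basis \<and> span some_basis = UNIV"
proof -
  obtain B where "independent B" "span B = (UNIV :: 'v set)"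
    using basis_exists[of "UNIV :: 'v set"] by (metis span_UNIV span_mono span_span subset_antisym top_greatest)
  then show ?thesis
    unfolding some_basis_def by (rule_tac someI[of _ B]) simp
qed

sublocale finite_dimensional_vector_space scale some_basis
  by unfold_locales (use some_basis in auto)

lemma two_neq_zero: "(2::'a) \<noteq> 0"
  by (rule two_neq_zero_if_odd_card[OF odd_card])

lemma q_gt_1: "q > 1"
proof -
  have "card {0, 1 :: 'a} \<le> CARD('a)"
    by (rule card_mono) auto
  then show ?thesis by (simp add: q_eq)
qed

section \<open>The bilinear form, isotropic subspaces and orthogonal spaces\<close>

lemma f_add_right: "f x (y + z) = f x y + f x z"
  and f_scale_right: "f x (scale c y) = c * f x y"
proof -
  interpret l: Vector_Spaces.linear scale "(*)" "f x"
    by (rule form_linear)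
  show "f x (y + z) = f x y + f x z"
    by (rule l.add)
  show "f x (scale c y) = c * f x y"
    by (rule l.scale)
qed

lemma f_add_left: "f (y + z) x = f y x + f z x"
  and f_scale_left: "f (scale c y) x = c * f y x"
  by (simp_all add: form_sym[of _ x] f_add_right f_scale_right)

lemma f_zero_right [simp]: "f x 0 = 0"
  using f_scale_right[of x 0 0] by simp

lemma f_zero_left [simp]: "f 0 x = 0"
  by (simp add: form_sym[of 0])

lemma f_minus_right: "f x (- y) = - f x y"
  using f_add_right[of x y "- y"] by (simp add: eq_neg_iff_add_eq_0 add.commute)

lemma f_minus_left: "f (- y) x = - f y x"
  by (simp add: form_sym[of _ x] f_minus_right)

lemma f_diff_right: "f x (y - z) = f x y - f x z"
  using f_add_right[of x y "- z"] by (simp add: f_minus_right)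

lemma f_diff_left: "f (y - z) x = f y x - f z x"
  by (simp add: form_sym[of _ x] f_diff_right)

lemmas f_simps = f_add_right f_add_left f_scale_right f_scale_left f_minus_right f_minus_left
  f_diff_right f_diff_left

lemma Q_add: "Q (x + y) = Q x + 2 * f x y + Q y"
  by (simp add: quadratic_form f_simps form_sym[of y x])

lemma Q_diff: "Q (x - y) = Q x - 2 * f x y + Q y"
  by (simp add: quadratic_form f_simps form_sym[of y x])

lemma Q_scale: "Q (scale c x) = c\<^sup>2 * Q x"
  by (simp add: quadratic_form f_simps power2_eq_square)

lemma Q_zero [simp]: "Q 0 = 0"
  by (simp add: quadratic_form)

lemma isotropic_orthogonal:
  assumes "subspace U" and "\<forall>x\<in>U. Q x = 0" and "x \<in> U" and "y \<in> U"
  shows "f x y = 0"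
  using assms subspace_add[OF assms(1,3,4)] two_neq_zero Q_add[of x y] by simp

lemma mem_perp_iff: "x \<in> perp U \<longleftrightarrow> (\<forall>y\<in>U. f x y = 0)"
  by (simp add: perp_def)

lemma subspace_perp: "subspace (perp U)"
  by (auto simp: subspace_def perp_def f_simps)

lemma perp_empty [simp]: "perp {} = UNIV"
  by (simp add: perp_def)

lemma perp_insert: "perp (insert x U) = perp {x} \<inter> perp U"
  by (auto simp: perp_def)

lemma perp_Un: "perp (X \<union> Y) = perp X \<inter> perp Y"
  by (auto simp: perp_def)

lemma perp_span: "perp (span X) = perp X"
proof
  show "perp (span X) \<subseteq> perp X"
    by (auto simp: perp_def span_base)
  show "perp X \<subseteq> perp (span X)"
  proof
    fix x assume "x \<in> perp X"
    then have "span X \<subseteq> {y. f x y = 0}"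
      by (intro span_minimal) (auto simp: mem_perp_iff subspace_def f_simps)
    then show "x \<in> perp (span X)"
      by (auto simp: mem_perp_iff)
  qed
qed

lemma perp_antimono: "X \<subseteq> Y \<Longrightarrow> perp Y \<subseteq> perp X"
  by (auto simp: perp_def)

lemma radical_eq: "radical U = U \<inter> perp U"
  by (auto simp: radical_def perp_def)

lemma subspace_radical: "subspace U \<Longrightarrow> subspace (radical U)"
  by (simp add: radical_eq subspace_inter subspace_perp)

section \<open>Adjoining a vector, and cardinalities of subspaces\<close>

lemma span_insert_subspace:
  assumes "subspace U"
  shows "span (insert x U) = (\<lambda>(c, u). u + scale c x) ` (UNIV \<times> U)"
proof -
  have *: "v \<in> span (insert x U) \<longleftrightarrow> (\<exists>c. v - scale c x \<in> U)" for v
    using assms by (simp add: span_insert span_eq_iff[THEN iffD2])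
  show ?thesis
  proof (intro set_eqI iffI)
    fix v assume "v \<in> span (insert x U)"
    then obtain c where "v - scale c x \<in> U"
      using * by blast
    then show "v \<in> (\<lambda>(c, u). u + scale c x) ` (UNIV \<times> U)"
      by (intro image_eqI[of _ _ "(c, v - scale c x)"]) auto
  next
    fix v assume "v \<in> (\<lambda>(c, u). u + scale c x) ` (UNIV \<times> U)"
    then obtain c u where "u \<in> U" "v = u + scale c x"
      by auto
    then show "v \<in> span (insert x U)"
      unfolding * by (intro exI[of _ c]) simp
  qed
qed

lemma inj_on_span_insert:
  assumes "subspace U" and "x \<notin> U"
  shows "inj_on (\<lambda>(c, u). u + scale c x) (UNIV \<times> U)"
proof (rule inj_onI, clarsimp)
  fix c u d w assume *: "u \<in> U" "w \<in> U" "u + scale c x = w + scale d x"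
  have "c = d"
  proof (rule ccontr)
    assume "c \<noteq> d"
    have "scale (c - d) x = w - u"
      using * by (simp add: scale_left_diff_distrib algebra_simps)
    then have "scale (1 / (c - d)) (w - u) = scale (1 / (c - d)) (scale (c - d) x)"
      by simp
    also have "\<dots> = x"
      using \<open>c \<noteq> d\<close> by (simp only: scale_scale) simp
    finally show False
      using assms * by (metis subspace_diff subspace_scale)
  qed
  then show "c = d \<and> u = w"
    using * by simp
qed

lemma sum_span_insert:
  fixes g :: "'v \<Rightarrow> 'b::comm_monoid_add"
  assumes "subspace U" and "x \<notin> U"
  shows "(\<Sum>v\<in>span (insert x U). g v) = (\<Sum>c\<in>UNIV. \<Sum>u\<in>U. g (u + scale c x))"
  unfolding span_insert_subspace[OF assms(1)] sum.reindex[OF inj_on_span_insert[OF assms]]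
  by (simp add: sum.cartesian_product case_prod_unfold)

lemma dim_span_insert:
  assumes "subspace U" and "x \<notin> U"
  shows "dim (span (insert x U)) = dim U + 1"
  using assms by (simp add: dim_insert span_eq_iff[THEN iffD2])

lemma card_subspace:
  assumes "subspace U"
  shows "real (card U) = q ^ dim U"
proof -
  have *: "real (card (span B)) = q ^ card B" if "independent B" for B
    using finiteI_independent[OF that] that
  proof (induction B)
    case empty
    then show ?case by simp
  next
    case (insert b B)
    then have "independent B" and b: "b \<notin> span B"
      using independent_insert by auto
    have "span (insert b (span B)) = span (insert b B)"
      by (simp add: span_insert span_span)
    then have "real (card (span (insert b B))) = (\<Sum>v\<in>span (insert b (span B)). 1)"
      unfolding card_eq_sum by simp
    also have "\<dots> = (\<Sum>c::'a\<in>UNIV. \<Sum>u\<in>span B. 1)"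
      by (rule sum_span_insert[OF subspace_span b])
    also have "\<dots> = q * real (card (span B))"
      by (simp add: q_eq)
    finally show ?case
      using insert \<open>independent B\<close> by simp
  qed
  obtain B where "B \<subseteq> U" "independent B" "U \<subseteq> span B" "card B = dim U"
    using basis_exists by metis
  then show ?thesis
    using * assms by (metis span_minimal subset_antisym)
qed

section \<open>Orthogonal complements in non-degenerate spaces\<close>

lemma dim_inter_perp_singleton:
  assumes "subspace A"
  shows "dim A \<le> dim (A \<inter> perp {x}) + 1"
proof (cases "A \<subseteq> perp {x}")
  case True
  then show ?thesis
    by (simp add: Int_absorb2)
next
  case False
  then obtain a where a: "a \<in> A" "f a x \<noteq> 0"
    unfolding perp_def by blast
  have "v \<in> span (insert a (A \<inter> perp {x}))" if "v \<in> A" for v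
  proof -
    have "v - scale (f v x / f a x) a \<in> A \<inter> perp {x}"
      using that a assms by (auto simp: mem_perp_iff f_simps intro: subspace_diff subspace_scale)
    then show ?thesis
      by (subst span_breakdown_eq) (metis span_base)
  qed
  then have "dim A \<le> dim (span (insert a (A \<inter> perp {x})))"
    by (intro dim_subset) auto
  also have "\<dots> \<le> dim (A \<inter> perp {x}) + 1"
    by (simp add: dim_insert)
  finally show ?thesis .
qed

lemma dim_le_dim_inter_perp:
  assumes "subspace A"
  shows "dim A \<le> dim (A \<inter> perp X) + dim X"
proof -
  have *: "dim A \<le> dim (A \<inter> perp B) + card B" if "finite B" for B
    using that
  proof (induction B)
    case (insert b B)
    have "dim (A \<inter> perp B) \<le> dim (A \<inter> perp B \<inter> perp {b}) + 1"
      by (intro dim_inter_perp_singleton subspace_inter assms subspace_perp)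
    then show ?case
      using insert by (simp add: perp_insert[of b B] Int_ac)
  qed simp
  obtain B where B: "B \<subseteq> X" "independent B" "X \<subseteq> span B" "card B = dim X"
    using basis_exists by metis
  have "perp X = perp B"
    using B by (metis perp_antimono perp_span subset_antisym)
  then show ?thesis
    using *[of B] B finiteI_independent by auto
qed

definition nondegenerate :: "'v set \<Rightarrow> bool" where
  "nondegenerate U \<longleftrightarrow> subspace U \<and> radical U = {0}"

lemma nondegenerateD:
  assumes "nondegenerate V"
  shows "subspace V" and "\<And>x. x \<in> V \<Longrightarrow> (\<And>y. y \<in> V \<Longrightarrow> f x y = 0) \<Longrightarrow> x = 0"
  using assms by (auto simp: nondegenerate_def radical_def)

lemma exists_complement:
  assumes "subspace X" and "X \<subseteq> V" and "subspace V"
  obtains Y where "subspace Y" and "Y \<subseteq> V" and "X \<inter> Y = {0}" and "span (X \<union> Y) = V"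
    and "dim X + dim Y = dim V"
proof -
  obtain B where B: "B \<subseteq> X" "independent B" "X \<subseteq> span B" "card B = dim X"
    using basis_exists by metis
  have "B \<subseteq> V" using B(1) assms(2) by blast
  then obtain C where C: "B \<subseteq> C" "C \<subseteq> V" "independent C" "V \<subseteq> span C"
    using maximal_independent_subset_extend B(2) by metis
  have spB: "span B = X"
    using B assms(1) by (metis span_minimal subset_antisym)
  have spC: "span C = V"
    using C assms(3) by (metis span_minimal subset_antisym)
  have fin: "finite C"
    using C(3) finiteI_independent by blast
  have "span (X \<union> span (C - B)) = span (B \<union> (C - B))"
    unfolding spB[symmetric] span_Un span_span ..
  also have "B \<union> (C - B) = C"
    using C(1) by blast
  finally have un: "span (X \<union> span (C - B)) = V"
    using spC by simp
  have d: "dim X + dim (span (C - B)) = dim V"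
  proof -
    have "independent (C - B)"
      using C(3) by (rule independent_mono) simp
    then have "dim (span (C - B)) = card (C - B)"
      by (simp add: dim_eq_card_independent)
    moreover have "card (C - B) = card C - card B"
      using fin C(1) by (simp add: card_Diff_subset finite_subset)
    moreover have "card C = dim V"
      using spC C(3) by (metis dim_eq_card_independent dim_span)
    moreover have "card B \<le> card C"
      using fin C(1) by (simp add: card_mono)
    ultimately show ?thesis
      using B by simp
  qed
  have "dim (span (X \<union> span (C - B))) + dim (X \<inter> span (C - B)) = dim X + dim (span (C - B))"
    using dim_sums_Int[OF assms(1), of "span (C - B)"] assms(1)
    by (simp add: span_Un span_eq_iff[THEN iffD2] del: dim_span)
  then have "dim (X \<inter> span (C - B)) = 0"
    using un d by simp
  then have "X \<inter> span (C - B) = {0}"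
    using dim_eq_0 subspace_0[OF assms(1)] by (auto simp: span_zero)
  then show ?thesis
    using that[of "span (C - B)"] un d C spC span_mono[of "C - B" C] by auto
qed

text \<open>Passing to the orthogonal space of \<open>X\<close> costs at most \<open>dim X\<close>
  dimensions. Together with a complement \<open>Y\<close> of \<open>X\<close> the cost is all of
  \<open>dim V\<close>, because only the radical remains, so neither bound can be strict.\<close>

lemma dim_perp:
  assumes "nondegenerate V" and "subspace X" and "X \<subseteq> V"
  shows "dim (V \<inter> perp X) + dim X = dim V"
proof -
  note V = nondegenerateD(1)[OF assms(1)]
  obtain Y where Y: "subspace Y" "Y \<subseteq> V" "span (X \<union> Y) = V" "dim X + dim Y = dim V"
    by (rule exists_complement[OF assms(2,3) V]) blast
  have "V \<inter> perp X \<inter> perp Y = radical V"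
    using perp_span[of "X \<union> Y"] Y(3) by (auto simp: radical_eq perp_Un)
  then have "dim (V \<inter> perp X \<inter> perp Y) = 0"
    using assms(1) by (simp add: nondegenerate_def)
  moreover have "dim (V \<inter> perp X) \<le> dim (V \<inter> perp X \<inter> perp Y) + dim Y"
    by (intro dim_le_dim_inter_perp subspace_inter V subspace_perp)
  moreover have "dim V \<le> dim (V \<inter> perp X) + dim X"
    by (rule dim_le_dim_inter_perp[OF V])
  ultimately show ?thesis
    using Y(4) by linarith
qed

lemma perp_perp:
  assumes "nondegenerate V" and "subspace X" and "X \<subseteq> V"
  shows "V \<inter> perp (V \<inter> perp X) = X"
proof (rule subspace_dim_equal[symmetric])
  show "X \<subseteq> V \<inter> perp (V \<inter> perp X)"
    using assms(3) form_sym by (auto simp: mem_perp_iff) metis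
  have "dim (V \<inter> perp (V \<inter> perp X)) + dim (V \<inter> perp X) = dim V"
    by (intro dim_perp assms(1) subspace_inter subspace_perp nondegenerateD(1)) auto
  then show "dim (V \<inter> perp (V \<inter> perp X)) \<le> dim X"
    using dim_perp[OF assms] by linarith
qed (use assms in \<open>auto intro: subspace_inter subspace_perp nondegenerateD(1)\<close>)

lemma exists_dual_vector:
  assumes "nondegenerate V" and "subspace X" and "X \<subseteq> V" and "x \<in> V" and "x \<notin> X"
  obtains w where "w \<in> V" and "w \<in> perp X" and "f w x = 1"
proof -
  have "x \<notin> V \<inter> perp (V \<inter> perp X)"
    using perp_perp[OF assms(1-3)] assms(5) by simp
  then obtain w where w: "w \<in> V" "w \<in> perp X" "f x w \<noteq> 0"
    using assms(4) by (auto simp: mem_perp_iff[of x])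
  show ?thesis
  proof (rule that[of "scale (1 / f x w) w"])
    show "scale (1 / f x w) w \<in> V" "scale (1 / f x w) w \<in> perp X"
      using w nondegenerateD(1)[OF assms(1)] by (auto intro: subspace_scale subspace_perp)
    show "f (scale (1 / f x w) w) x = 1"
      using w by (simp add: f_simps form_sym[of w x])
  qed
qed

text \<open>Along the isotropic direction \<open>x\<close> the norm of a dual vector
  \<open>w\<close> changes linearly, with slope \<open>2 * f w x = 2\<close>. Subtracting
  \<open>Q w / 2\<close> times \<open>x\<close> makes it isotropic, and
  \<open>x \<in> perp X\<close> keeps it orthogonal to \<open>X\<close>.\<close>

lemma exists_isotropic_dual_vector:
  assumes "nondegenerate V" and "subspace X" and "X \<subseteq> V" and "x \<in> V" and "x \<notin> X"
    and "Q x = 0" and "x \<in> perp X"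
  obtains w where "w \<in> V" and "w \<in> perp X" and "f w x = 1" and "Q w = 0"
proof -
  obtain w where w: "w \<in> V" "w \<in> perp X" "f w x = 1"
    by (rule exists_dual_vector[OF assms(1-5)])
  define u where "u = w - scale (Q w / 2) x"
  have "Q u = Q w - 2 * (Q w / 2)"
    using w assms(6) by (simp add: u_def Q_diff Q_scale f_simps)
  then have "Q u = 0"
    using two_neq_zero by simp
  moreover have "u \<in> V" "u \<in> perp X"
    using w assms nondegenerateD(1)[OF assms(1)]
    by (auto simp: u_def intro!: subspace_diff subspace_scale subspace_perp)
  moreover have "f u x = 1"
    using w assms(6) by (simp add: u_def f_simps flip: quadratic_form)
  ultimately show ?thesis
    by (rule that[of u, rotated -1])
qed

section \<open>The sign of a quadratic space\<close>

lemma mem_span_insert: "subspace U \<Longrightarrow> v \<in> span (insert x U) \<longleftrightarrow> (\<exists>c. v - scale c x \<in> U)"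
  by (simp add: span_insert span_eq_iff[THEN iffD2])

lemma exists_complement_insert:
  assumes "subspace X" and "r \<in> X" and "r \<noteq> 0"
  obtains Y where "subspace Y" and "Y \<subseteq> X" and "r \<notin> Y" and "X = span (insert r Y)"
    and "dim X = dim Y + 1"
proof -
  have sub: "span {r} \<subseteq> X"
    using assms by (intro span_minimal) auto
  obtain Y where Y: "subspace Y" "Y \<subseteq> X" "span {r} \<inter> Y = {0}"
      "dim (span {r}) + dim Y = dim X"
    using exists_complement[OF subspace_span sub assms(1)] by metis
  have rY: "r \<notin> Y"
    using Y(3) assms(3) span_base[of r "{r}"] by blast
  have "dim (span {r}) = 1"
    using assms(3) by (simp add: dim_insert)
  then have d: "dim X = dim Y + 1"
    using Y(4) by simp
  have "span (insert r Y) = X"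
  proof (rule subspace_dim_equal)
    show "span (insert r Y) \<subseteq> X"
      using Y(2) assms by (intro span_minimal) auto
  qed (use d dim_span_insert[OF Y(1) rY] assms in auto)
  then show ?thesis
    using that[OF Y(1,2) rY _ d] by simp
qed

definition level_count :: "'v set \<Rightarrow> 'a \<Rightarrow> real" where
  "level_count U c = real (card {v \<in> U. Q v = c})"

definition rank :: "'v set \<Rightarrow> nat" where
  "rank U = dim U - dim (radical U)"

text \<open>
  The number of solutions of \<open>Q x = c\<close> in a non-degenerate space of dimension \<open>r\<close>. The sign \<open>e\<close> is the
  type for even \<open>r\<close> and the quadratic character of the signed discriminant for odd \<open>r\<close>.
\<close>

definition level_formula :: "nat \<Rightarrow> real \<Rightarrow> 'a \<Rightarrow> real" where
  "level_formula r e c =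
     (if even r then q ^ r / q - e * q ^ (r div 2) / q + (if c = 0 then e * q ^ (r div 2) else 0)
      else q ^ r / q + e * qchar c * q ^ (r div 2))"

text \<open>Reading the sign off from solution counts makes it an isometry invariant by definition,
  for degenerate spaces and odd ranks as well.\<close>

definition has_sign :: "'v set \<Rightarrow> real \<Rightarrow> bool" where
  "has_sign U e \<longleftrightarrow> e \<in> {1, - 1} \<and>
     (\<forall>c. level_count U c = q ^ dim (radical U) * level_formula (rank U) e c)"

definition sign :: "'v set \<Rightarrow> real" where
  "sign U = (SOME e. has_sign U e)"

lemma q_pos [simp]: "q > 0" "q \<noteq> 0"
  using q_gt_1 by auto

text \<open>In odd rank the level 0 does not see the sign, hence the second level.\<close>

lemma level_formula_unique:
  assumes "level_formula r e 0 = level_formula r e' 0"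
    and "level_formula r e 1 = level_formula r e' 1"
  shows "e = e'"
proof (cases "even r")
  case True
  then show ?thesis
    using assms by (simp add: level_formula_def)
next
  case False
  then show ?thesis
    using assms by (simp add: level_formula_def)
qed

text \<open>An added orthogonal vector of norm \<open>z\<close> contributes \<open>z * t^2\<close>
  through its coefficient \<open>t\<close>. For even \<open>r\<close> only level 0 is special, and
  it is hit for \<open>1 + qchar c * qchar z\<close> values of \<open>t\<close>. For odd
  \<open>r\<close> the character of a quadratic polynomial is summed, which is where
  \<open>- z\<close> comes from.\<close>

lemma sum_level_formula:
  assumes "z \<noteq> 0"
  shows "(\<Sum>t\<in>UNIV. level_formula r e (c - z * t\<^sup>2))
    = level_formula (Suc r) (e * qchar (if even r then z else - z)) c"
proof (cases "even r")
  case True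
  have "{t. c - z * t\<^sup>2 = 0} = {t. t\<^sup>2 = c / z}"
    using assms by (auto simp: field_simps)
  then have "real (card {t. c - z * t\<^sup>2 = 0}) = 1 + qchar c * qchar z"
    using card_sqrt[OF odd_card, of "c / z"] by (simp add: qchar_divide[OF odd_card])
  moreover have "(\<Sum>t\<in>UNIV. if c - z * t\<^sup>2 = 0 then e * q ^ (r div 2) else 0)
    = real (card {t. c - z * t\<^sup>2 = 0}) * (e * q ^ (r div 2))"
    by (subst sum.If_cases) auto
  moreover have "(\<Sum>t\<in>UNIV. level_formula r e (c - z * t\<^sup>2))
    = q * (q ^ r / q - e * q ^ (r div 2) / q)
      + (\<Sum>t\<in>UNIV. if c - z * t\<^sup>2 = 0 then e * q ^ (r div 2) else 0)"
    using True by (simp only: level_formula_def if_True sum.distrib) (simp add: q_eq)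
  ultimately show ?thesis
    using True by (simp add: level_formula_def algebra_simps)
next
  case False
  then obtain k where "r = 2 * k + 1" by (rule oddE)
  have "(\<Sum>t\<in>UNIV. level_formula r e (c - z * t\<^sup>2))
    = q * (q ^ r / q) + e * (\<Sum>t\<in>UNIV. qchar (c - z * t\<^sup>2)) * q ^ (r div 2)"
    using False
    by (simp only: level_formula_def if_False sum.distrib sum_distrib_left sum_distrib_right)
      (simp add: q_eq)
  then show ?thesis
    using False \<open>r = 2 * k + 1\<close>
    by (simp add: level_formula_def sum_qchar_quadratic[OF odd_card assms] algebra_simps flip: q_eq)
qed

lemma anisotropic_split:
  assumes "subspace U" and "v \<in> U" and "Q v \<noteq> 0"
  defines "W \<equiv> U \<inter> perp {v}"
  shows "subspace W" and "v \<notin> W" and "span (insert v W) = U" and "dim U = dim W + 1"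
    and "radical W = radical U" and "rank U = Suc (rank W)"
proof -
  show W: "subspace W"
    unfolding W_def by (intro subspace_inter assms(1) subspace_perp)
  show nv: "v \<notin> W"
    using assms by (simp add: mem_perp_iff flip: quadratic_form)
  have dec: "u - scale (f u v / Q v) v \<in> W" if "u \<in> U" for u
    using that assms by (auto simp: mem_perp_iff f_simps intro: subspace_diff subspace_scale simp flip: quadratic_form)
  show sp: "span (insert v W) = U"
  proof
    show "span (insert v W) \<subseteq> U"
      using assms(1,2) by (intro span_minimal) (auto simp: W_def)
    show "U \<subseteq> span (insert v W)"
      using dec mem_span_insert[OF W] by blast
  qed
  show dU: "dim U = dim W + 1"
    using dim_span_insert[OF W nv] sp by simp
  show rad: "radical W = radical U"
  proof
    show "radical W \<subseteq> radical U"
    proof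
      fix x assume x: "x \<in> radical W"
      have "f x u = 0" if "u \<in> U" for u
      proof -
        have "f x (u - scale (f u v / Q v) v) = 0" "f x v = 0"
          using x dec[OF that] by (auto simp: radical_def W_def mem_perp_iff)
        then show ?thesis by (simp add: f_simps)
      qed
      then show "x \<in> radical U"
        using x by (auto simp: radical_def W_def)
    qed
    show "radical U \<subseteq> radical W"
      using assms(2) by (auto simp: radical_def W_def mem_perp_iff)
  qed
  have "dim (radical W) \<le> dim W"
    by (rule dim_subset) (auto simp: radical_def)
  then show "rank U = Suc (rank W)"
    by (simp add: rank_def rad dU)
qed

lemma level_count_eq_sum: "level_count U c = (\<Sum>v\<in>U. if Q v = c then 1 else 0)"
proof -
  have "finite U" by simp
  then show ?thesis
    by (simp add: level_count_def sum.If_cases Int_def)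
qed

lemma level_count_insert:
  assumes "subspace W" and "v \<notin> W" and "v \<in> perp W"
  shows "level_count (span (insert v W)) c = (\<Sum>t\<in>UNIV. level_count W (c - Q v * t\<^sup>2))"
proof -
  have "Q (u + scale t v) = Q u + t\<^sup>2 * Q v" if "u \<in> W" for u t
    using assms(3) that by (simp add: Q_add Q_scale f_simps mem_perp_iff form_sym[of u])
  then show ?thesis
    unfolding level_count_eq_sum sum_span_insert[OF assms(1,2)]
    by (intro sum.cong refl if_cong) (auto simp: algebra_simps)
qed

lemma has_sign_step:
  assumes "subspace U" and "v \<in> U" and "Q v \<noteq> 0" and "has_sign (U \<inter> perp {v}) e"
  shows "has_sign U (e * qchar (if even (rank (U \<inter> perp {v})) then Q v else - Q v))"
proof -
  define W where "W = U \<inter> perp {v}"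
  note s = anisotropic_split[OF assms(1-3), folded W_def]
  have "v \<in> perp W"
    by (auto simp: W_def mem_perp_iff form_sym)
  then have "level_count U c = (\<Sum>t\<in>UNIV. level_count W (c - Q v * t\<^sup>2))" for c
    using level_count_insert[OF s(1,2)] s(3) by simp
  also have "\<dots> c = q ^ dim (radical U) *
      level_formula (rank U) (e * qchar (if even (rank W) then Q v else - Q v)) c" for c
    using assms(3,4) sum_level_formula[of "Q v" "rank W" e c]
    by (simp add: has_sign_def s(5,6) flip: sum_distrib_left W_def)
  finally show ?thesis
    using assms(3,4) qchar_values[of "Q v"] qchar_values[of "- Q v"]
    unfolding has_sign_def W_def[symmetric] by auto
qed

text \<open>In rank 0 with sign 1 the level formula is the indicator of level 0. This normalises the
  zero form to sign 1, in accordance with the type of the 0-dimensional space.\<close>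

lemma has_sign_isotropic:
  assumes "subspace U" and "\<forall>x\<in>U. Q x = 0"
  shows "has_sign U 1"
proof -
  have "radical U = U"
    using isotropic_orthogonal[OF assms] by (auto simp: radical_def)
  moreover have "{v \<in> U. Q v = c} = (if c = 0 then U else {})" for c
    using assms by auto
  ultimately show ?thesis
    using card_subspace[OF assms(1)]
    by (simp add: has_sign_def rank_def level_formula_def level_count_def)
qed

lemma exists_has_sign: "subspace U \<Longrightarrow> \<exists>e. has_sign U e"
proof (induction "dim U" arbitrary: U)
  case 0
  then have "\<forall>x\<in>U. Q x = 0"
    by auto
  then show ?case
    using has_sign_isotropic 0 by blast
next
  case (Suc n)
  show ?case
  proof (cases "\<forall>x\<in>U. Q x = 0")
    case True
    then show ?thesis
      using has_sign_isotropic Suc by blast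
  next
    case False
    then obtain v where v: "v \<in> U" "Q v \<noteq> 0" by blast
    note s = anisotropic_split[OF Suc.prems v]
    then obtain e where "has_sign (U \<inter> perp {v}) e"
      using Suc by fastforce
    then show ?thesis
      using has_sign_step[OF Suc.prems v] by blast
  qed
qed

lemma has_sign_sign: "subspace U \<Longrightarrow> has_sign U (sign U)"
  unfolding sign_def by (rule someI_ex[OF exists_has_sign])

lemma sign_unique:
  assumes "has_sign U e"
  shows "sign U = e"
proof -
  have "has_sign U (sign U)"
    unfolding sign_def by (rule someI[of "has_sign U", OF assms])
  then have eq: "level_formula (rank U) (sign U) c = level_formula (rank U) e c" for c
    using assms by (simp add: has_sign_def)
  show ?thesis
    by (rule level_formula_unique[OF eq eq])
qed

lemma sign_values: "subspace U \<Longrightarrow> sign U = 1 \<or> sign U = - 1"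
  using has_sign_sign[of U] by (auto simp: has_sign_def)

lemma sign_mult_self: "subspace U \<Longrightarrow> sign U * sign U = 1"
  using sign_values[of U] by auto

lemma level_count_sign:
  "subspace U \<Longrightarrow> level_count U c = q ^ dim (radical U) * level_formula (rank U) (sign U) c"
  using has_sign_sign[of U] by (auto simp: has_sign_def)

lemma sign_isotropic: "subspace U \<Longrightarrow> \<forall>x\<in>U. Q x = 0 \<Longrightarrow> sign U = 1"
  by (intro sign_unique has_sign_isotropic)

lemma sign_step:
  assumes "subspace U" and "v \<in> U" and "Q v \<noteq> 0"
  shows "sign U = sign (U \<inter> perp {v}) * qchar (if even (rank (U \<inter> perp {v})) then Q v else - Q v)"
  by (intro sign_unique has_sign_step assms has_sign_sign subspace_inter subspace_perp)

text \<open>The new direction falls into the radical and multiplies every level count by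
  \<open>q\<close>.\<close>

lemma isotropic_extension:
  assumes "subspace U" and "w \<notin> U" and "w \<in> perp U" and "Q w = 0"
  defines "W \<equiv> span (insert w U)"
  shows "radical W = span (insert w (radical U))" and "dim (radical W) = dim (radical U) + 1"
    and "dim W = dim U + 1" and "rank W = rank U" and "sign W = sign U"
proof -
  have wr: "w \<notin> radical U"
    using assms by (auto simp: radical_def)
  note rU = subspace_radical[OF assms(1)]
  show rad: "radical W = span (insert w (radical U))"
  proof -
    have ww: "f w w = 0"
      using assms(4) by (simp add: quadratic_form)
    have wu: "f w u = 0" "f u w = 0" if "u \<in> U" for u
      using that assms(3) by (auto simp: mem_perp_iff form_sym[of u])
    have f: "f (u + scale c w) (u' + scale c' w) = f u u'" if "u \<in> U" "u' \<in> U" for u u' c c'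
      using that by (simp add: f_simps ww wu)
    have W: "v \<in> W \<longleftrightarrow> (\<exists>c. \<exists>u\<in>U. v = u + scale c w)" for v
      unfolding W_def span_insert_subspace[OF assms(1)] by auto
    have R: "v \<in> span (insert w (radical U)) \<longleftrightarrow> (\<exists>c. \<exists>u\<in>radical U. v = u + scale c w)" for v
      unfolding span_insert_subspace[OF rU] by auto
    show ?thesis
    proof (intro set_eqI iffI)
      fix v assume v: "v \<in> radical W"
      then obtain c u where u: "u \<in> U" "v = u + scale c w"
        using W by (auto simp: radical_def)
      have "f u u' = 0" if "u' \<in> U" for u'
      proof -
        have "u' \<in> W"
          using that by (simp add: W_def span_base)
        then show ?thesis
          using v f[OF u(1) that, of c 0] u(2) by (simp add: radical_def)
      qed
      then show "v \<in> span (insert w (radical U))"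
        using u unfolding R by (auto simp: radical_def)
    next
      fix v assume "v \<in> span (insert w (radical U))"
      then obtain c u where u: "u \<in> radical U" "v = u + scale c w"
        using R by blast
      then have "v \<in> W"
        using W by (auto simp: radical_def)
      moreover have "f v x = 0" if "x \<in> W" for x
        using that u f unfolding W by (auto simp: radical_def)
      ultimately show "v \<in> radical W"
        by (simp add: radical_def)
    qed
  qed
  show d1: "dim (radical W) = dim (radical U) + 1"
    unfolding rad by (rule dim_span_insert[OF rU wr])
  show d2: "dim W = dim U + 1"
    unfolding W_def by (rule dim_span_insert[OF assms(1,2)])
  show rk: "rank W = rank U"
    by (simp add: rank_def d1 d2)
  have "level_count W c = q * level_count U c" for c
    unfolding W_def level_count_insert[OF assms(1-3)] using assms(4) by (simp add: q_eq)
  then show "sign W = sign U"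
    using has_sign_sign[OF assms(1)]
    by (intro sign_unique) (simp add: has_sign_def rk d1)
qed

section \<open>Hyperbolic planes and the sign of an orthogonal complement\<close>

lemma perp_hyperbolic: "perp {s + p, s - p} = perp {s, p}"
proof -
  have "f x (s + p) + f x (s - p) = 2 * f x s" "f x (s + p) - f x (s - p) = 2 * f x p" for x
    by (simp_all add: f_simps)
  then have "f x (s + p) = 0 \<and> f x (s - p) = 0 \<longleftrightarrow> f x s = 0 \<and> f x p = 0" for x
    using two_neq_zero f_add_right[of x s p] f_diff_right[of x s p]
    by (metis add_0 diff_0_right mult_eq_0_iff)
  then show ?thesis
    by (auto simp: mem_perp_iff)
qed

text \<open>The plane has the orthogonal basis \<open>s + p\<close>, \<open>s - p\<close> of
  opposite norms. When these are split off one after the other the remaining rank changes parity in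
  between, so both steps produce the same character value and the product is 1.\<close>

lemma hyperbolic_split:
  assumes "subspace U" and "s \<in> U" and "p \<in> U" and "Q s = 0" and "Q p = 0" and "f s p \<noteq> 0"
  defines "W \<equiv> U \<inter> perp {s, p}"
  shows "subspace W" and "dim U = dim W + 2" and "radical W = radical U"
    and "rank U = rank W + 2" and "sign U = sign W"
proof -
  define v1 v2 where "v1 = s + p" and "v2 = s - p"
  define U1 where "U1 = U \<inter> perp {v1}"
  have Qv: "Q v1 = 2 * f s p" "Q v2 = - Q v1"
    using assms by (simp_all add: v1_def v2_def Q_add Q_diff)
  have nz: "Q v1 \<noteq> 0" "Q v2 \<noteq> 0"
    using Qv assms(6) two_neq_zero by auto
  have "f v2 v1 = 0"
    using assms(4,5) by (simp add: v1_def v2_def f_simps form_sym[of p s] flip: quadratic_form)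
  then have v2: "v2 \<in> U1" and v1: "v1 \<in> U"
    using assms(1-3) by (auto simp: U1_def v1_def v2_def mem_perp_iff intro: subspace_diff subspace_add)
  note s1 = anisotropic_split[OF assms(1) v1 nz(1), folded U1_def]
  note s2 = anisotropic_split[OF s1(1) v2 nz(2)]
  have W: "W = U1 \<inter> perp {v2}"
    using perp_hyperbolic[of s p] perp_insert[of "s + p" "{s - p}"]
    by (auto simp: W_def U1_def v1_def v2_def)
  show "subspace W" "dim U = dim W + 2" "radical W = radical U" "rank U = rank W + 2"
    using s1 s2 unfolding W by auto
  have "sign U = sign W * (qchar (if even (rank W) then Q v2 else - Q v2)
      * qchar (if even (rank U1) then Q v1 else - Q v1))"
    using sign_step[OF assms(1) v1 nz(1)] sign_step[OF s1(1) v2 nz(2)]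
    unfolding W U1_def[symmetric] by (simp add: mult.assoc)
  moreover have "rank U1 = Suc (rank W)"
    using s2(6) W by simp
  ultimately show "sign U = sign W"
    using nz Qv(2) qchar_mult_self[of "Q v1"] qchar_mult_self[of "- Q v1"] by (auto split: if_splits)
qed

lemma nondegenerate_anisotropic_split:
  assumes "nondegenerate V" and "v \<in> V" and "Q v \<noteq> 0"
  shows "nondegenerate (V \<inter> perp {v})"
  using anisotropic_split[OF nondegenerateD(1)[OF assms(1)] assms(2,3)] assms(1)
  by (simp add: nondegenerate_def)

lemma nondegenerate_hyperbolic_split:
  assumes "nondegenerate V" and "s \<in> V" and "p \<in> V" and "Q s = 0" and "Q p = 0" and "f s p \<noteq> 0"
  shows "nondegenerate (V \<inter> perp {s, p})"
  using hyperbolic_split[OF nondegenerateD(1)[OF assms(1)] assms(2-)] assms(1)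
  by (simp add: nondegenerate_def)

lemma rank_nondegenerate: "nondegenerate V \<Longrightarrow> rank V = dim V"
  by (simp add: rank_def nondegenerate_def)

lemma radical_perp:
  assumes "nondegenerate V" and "subspace X" and "X \<subseteq> V"
  shows "radical (V \<inter> perp X) = radical X"
  using perp_perp[OF assms] assms(3) by (auto simp: radical_eq)

text \<open>In \<open>V \<inter> perp Y\<close> the next vector \<open>r\<close> of \<open>X\<close>
  has an isotropic partner \<open>y\<close>. Both the removal of this hyperbolic pair and the return
  of \<open>r\<close> alone, as a vector of the radical, preserve the sign.\<close>

lemma sign_perp_isotropic:
  assumes "nondegenerate V" and "subspace X" and "X \<subseteq> V" and "\<forall>x\<in>X. Q x = 0"
  shows "sign (V \<inter> perp X) = sign V"
  using assms(2-)
proof (induction "dim X" arbitrary: X)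
  case 0
  then have "X = {0}"
    using subspace_0 by auto
  then show ?case
    by (simp add: perp_def)
next
  case (Suc n)
  then obtain r where r: "r \<in> X" "r \<noteq> 0"
    by (metis Zero_not_Suc dim_eq_0 singletonI subset_iff)
  then obtain Y where Y: "subspace Y" "Y \<subseteq> X" and rY: "r \<notin> Y" and X: "X = span (insert r Y)"
    using exists_complement_insert[OF Suc.prems(1)] by metis
  have dY: "n = dim Y"
    using dim_span_insert[OF Y(1) rY] Suc.hyps(2) X by simp
  have IH: "sign (V \<inter> perp Y) = sign V"
    using Suc.hyps(1)[OF dY Y(1)] Y(2) Suc.prems by auto
  have rp: "r \<in> perp Y"
    using isotropic_orthogonal[OF Suc.prems(1,3) r(1)] Y(2) by (auto simp: mem_perp_iff)
  obtain y where y: "y \<in> V" "y \<in> perp Y" "f y r = 1" "Q y = 0"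
    by (rule exists_isotropic_dual_vector[OF assms(1) Y(1) _ _ rY _ rp])
      (use Y(2) Suc.prems r in auto)
  define W where "W = V \<inter> perp Y"
  have W: "subspace W"
    unfolding W_def by (intro subspace_inter subspace_perp nondegenerateD(1)[OF assms(1)])
  define W2 where "W2 = W \<inter> perp {y, r}"
  have yW: "y \<in> W" and rW: "r \<in> W" and Qr: "Q r = 0"
    using y rp r Suc.prems by (auto simp: W_def)
  have h: "subspace W2" "sign W = sign W2"
    using hyperbolic_split[OF W yW rW y(4) Qr] y(3) by (auto simp: W2_def)
  have rW2: "r \<notin> W2" "r \<in> perp W2"
    using y(3) by (auto simp: W2_def mem_perp_iff form_sym)
  have "V \<inter> perp X = span (insert r W2)"
  proof
    show "V \<inter> perp X \<subseteq> span (insert r W2)"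
    proof
      fix x assume "x \<in> V \<inter> perp X"
      then have x: "x \<in> W" "f x r = 0"
        using r(1) Y(2) perp_antimono[OF Y(2)] by (auto simp: W_def mem_perp_iff)
      have "x - scale (f x y) r \<in> W2"
        using x W rW y(3) Qr
        by (auto simp: W2_def mem_perp_iff f_simps form_sym[of r y] simp flip: quadratic_form intro: subspace_diff subspace_scale)
      then show "x \<in> span (insert r W2)"
        using mem_span_insert[OF h(1)] by blast
    qed
    have "insert r W2 \<subseteq> V \<inter> perp X"
      using rW Qr unfolding X perp_span
      by (auto simp: W2_def W_def mem_perp_iff simp flip: quadratic_form)
    then show "span (insert r W2) \<subseteq> V \<inter> perp X"
      by (rule span_minimal) (intro subspace_inter subspace_perp nondegenerateD(1)[OF assms(1)])
  qed
  then show ?case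
    using isotropic_extension(5)[OF h(1) rW2 Qr] h(2) IH by (simp add: W_def)
qed

text \<open>An anisotropic vector \<open>v\<close> of \<open>X\<close> splits off from
  \<open>X\<close> and also from \<open>V \<inter> perp Y\<close>, where \<open>Y\<close> is the
  rest of \<open>X\<close>. Each time the sign changes by the character of \<open>Q v\<close> or of
  \<open>- Q v\<close>, according to a rank parity; the mismatches combine to the factor
  \<open>qchar (- 1)\<close>.\<close>

lemma sign_perp:
  assumes "nondegenerate V" and "subspace X" and "X \<subseteq> V"
  shows "sign (V \<inter> perp X) = sign V * sign X *
    (if odd (rank X) \<and> odd (rank (V \<inter> perp X)) then qchar (- 1 :: 'a) else 1)"
  using assms(2-)
proof (induction "rank X" arbitrary: X)
  case 0
  have "radical X = X"
  proof (rule subspace_dim_equal)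
    show "dim X \<le> dim (radical X)"
      using 0 by (simp add: rank_def)
  qed (use 0 in \<open>auto intro: subspace_inter subspace_perp simp: radical_eq\<close>)
  then have "\<forall>x\<in>X. Q x = 0"
    by (auto simp: radical_def quadratic_form)
  then show ?case
    using sign_perp_isotropic[OF assms(1) 0(2,3)] sign_isotropic[OF 0(2)] 0(1) by simp
next
  case (Suc n)
  have "\<not> (\<forall>x\<in>X. Q x = 0)"
  proof
    assume "\<forall>x\<in>X. Q x = 0"
    then have "radical X = X"
      using isotropic_orthogonal[OF Suc.prems(1)] by (auto simp: radical_def)
    then show False
      using Suc.hyps(2) by (simp add: rank_def)
  qed
  then obtain v where v: "v \<in> X" "Q v \<noteq> 0"
    by blast
  define Y where "Y = X \<inter> perp {v}"
  note sX = anisotropic_split[OF Suc.prems(1) v, folded Y_def]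
  define W where "W = V \<inter> perp Y"
  have W: "subspace W"
    unfolding W_def by (intro subspace_inter subspace_perp nondegenerateD(1)[OF assms(1)])
  have vW: "v \<in> W"
    using v Suc.prems by (auto simp: W_def Y_def mem_perp_iff form_sym)
  have WX: "W \<inter> perp {v} = V \<inter> perp X"
    using perp_span[of "insert v Y"] sX(3) perp_insert[of v Y] by (auto simp: W_def)
  note sW = anisotropic_split[OF W vW v(2), unfolded WX]
  have n: "n = rank Y" and YV: "Y \<subseteq> V"
    using Suc.hyps(2) sX(6) Suc.prems by (auto simp: Y_def)
  have IH: "sign W = sign V * sign Y * (if odd (rank Y) \<and> odd (rank W) then qchar (- 1 :: 'a) else 1)"
    using Suc.hyps(1)[OF n sX(1) YV] by (simp add: W_def)
  have 1: "sign W = sign (V \<inter> perp X) * qchar (if even (rank (V \<inter> perp X)) then Q v else - Q v)"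
    using sign_step[OF W vW v(2)] by (simp add: WX)
  have 2: "sign X = sign Y * qchar (if even (rank Y) then Q v else - Q v)"
    using sign_step[OF Suc.prems(1) v] by (simp add: Y_def)
  have m: "qchar (- Q v) = qchar (- 1 :: 'a) * qchar (Q v)"
    by (simp flip: qchar_mult[OF odd_card])
  have v1: "qchar (Q v) = 1 \<or> qchar (Q v) = - 1" "qchar (- 1 :: 'a) = 1 \<or> qchar (- 1 :: 'a) = - 1"
    using v(2) by (auto intro!: qchar_values)
  show ?case
    using IH 1 2 m v1 sX(6) sW(6) by (auto split: if_splits)
qed

section \<open>Sums over complements\<close>

definition complements :: "'v set \<Rightarrow> 'v set \<Rightarrow> 'v set set" where
  "complements V X = {\<sigma>. subspace \<sigma> \<and> \<sigma> \<subseteq> V \<and> \<sigma> \<inter> X = {0} \<and> dim \<sigma> + dim X = dim V}"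

definition complement_sum :: "('v set \<Rightarrow> real) \<Rightarrow> 'v set \<Rightarrow> 'v set \<Rightarrow> real" where
  "complement_sum E V X = (\<Sum>\<sigma>\<in>complements V X. E \<sigma>)"

lemma span_complement:
  assumes "\<sigma> \<in> complements V X" and "subspace X" and "X \<subseteq> V" and "subspace V"
  shows "span (\<sigma> \<union> X) = V"
proof (rule subspace_dim_equal)
  have "{x + y |x y. x \<in> \<sigma> \<and> y \<in> X} = span (\<sigma> \<union> X)"
    using assms(1,2) by (simp add: complements_def span_Un span_eq_iff[THEN iffD2])
  then show "dim V \<le> dim (span (\<sigma> \<union> X))"
    using assms(1) dim_sums_Int[of \<sigma> X] assms(2) by (simp add: complements_def)
  show "span (\<sigma> \<union> X) \<subseteq> V"
    using assms by (intro span_minimal) (auto simp: complements_def)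
qed (use assms in auto)

lemma dim_perp_singleton:
  assumes "nondegenerate V" and "w \<in> V" and "w \<noteq> 0"
  shows "dim V = dim (V \<inter> perp {w}) + 1"
proof -
  have "dim (V \<inter> perp (span {w})) + dim (span {w}) = dim V"
    by (rule dim_perp[OF assms(1)])
      (use assms(2) nondegenerateD(1)[OF assms(1)] in \<open>auto intro: span_minimal[THEN subsetD]\<close>)
  moreover have "dim (span {w}) = 1"
    using assms(3) by (simp add: dim_insert)
  ultimately show ?thesis
    by (simp add: perp_span)
qed

lemma complements_insert:
  assumes "nondegenerate V" and "subspace X" and "X \<subseteq> V" and "x \<in> V" and "x \<notin> X"
  shows "complements V (span (insert x X))
    = (\<Union>w\<in>{w \<in> V \<inter> perp X. f w x = 1}. complements (V \<inter> perp {w}) X)" (is "?L = ?R")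
proof (intro set_eqI iffI)
  note V = nondegenerateD(1)[OF assms(1)]
  have d: "dim (span (insert x X)) = dim X + 1"
    by (rule dim_span_insert[OF assms(2,5)])
  have dw: "dim V = dim (V \<inter> perp {w}) + 1" if "w \<in> V" "f w x = 1" for w
    using that by (intro dim_perp_singleton[OF assms(1)]) auto
  fix \<sigma>
  {
    assume "\<sigma> \<in> ?L"
    then have \<sigma>: "subspace \<sigma>" "\<sigma> \<subseteq> V" "\<sigma> \<inter> span (insert x X) = {0}"
        "dim \<sigma> + dim X + 1 = dim V"
      by (auto simp: complements_def d simp del: dim_span)
    have "x \<notin> span (\<sigma> \<union> X)"
    proof
      assume "x \<in> span (\<sigma> \<union> X)"
      then obtain s u where "s \<in> \<sigma>" "u \<in> X" "x = s + u"
        using \<sigma>(1) assms(2) by (auto simp: span_Un span_eq_iff[THEN iffD2])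
      then have "s \<in> span (insert x X)"
        by (metis add_diff_cancel_right' insertCI span_base span_diff)
      then have "s = 0"
        using \<sigma>(3) \<open>s \<in> \<sigma>\<close> by blast
      then show False
        using \<open>u \<in> X\<close> \<open>x = s + u\<close> assms(5) by simp
    qed
    then obtain w where w: "w \<in> V" "w \<in> perp (span (\<sigma> \<union> X))" "f w x = 1"
      using exists_dual_vector[OF assms(1) subspace_span _ assms(4), of "\<sigma> \<union> X"] \<sigma>(2) assms(3) V
      by (metis Un_least span_minimal)
    then have w': "w \<in> perp X" "\<sigma> \<subseteq> perp {w}"
      by (auto simp: perp_span mem_perp_iff form_sym[of _ w])
    have "X \<subseteq> span (insert x X)"
      by (meson insert_subset span_superset subset_trans subset_insertI)
    then have "\<sigma> \<inter> X = {0}"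
      using \<sigma>(1,3) assms(2) subspace_0 by blast
    then have "\<sigma> \<in> complements (V \<inter> perp {w}) X"
      using \<sigma> w' dw[OF w(1,3)] by (auto simp: complements_def)
    then show "\<sigma> \<in> ?R"
      using w w' by blast
  next
    assume "\<sigma> \<in> ?R"
    then obtain w where w: "w \<in> V" "w \<in> perp X" "f w x = 1" and "\<sigma> \<in> complements (V \<inter> perp {w}) X"
      by blast
    then have \<sigma>: "subspace \<sigma>" "\<sigma> \<subseteq> V" "\<sigma> \<subseteq> perp {w}" "\<sigma> \<inter> X = {0}"
        "dim \<sigma> + dim X = dim (V \<inter> perp {w})"
      by (auto simp: complements_def)
    have "v = 0" if v: "v \<in> \<sigma>" "v \<in> span (insert x X)" for v
    proof -
      obtain c where c: "v - scale c x \<in> X"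
        using v(2) mem_span_insert[OF assms(2)] by blast
      then have "f w (v - scale c x) = 0"
        using w(2) by (simp add: mem_perp_iff)
      moreover have "f w v = 0"
        using v(1) \<sigma>(3) by (auto simp: mem_perp_iff form_sym[of w])
      ultimately have "c = 0"
        using w(3) by (simp add: f_simps)
      then show ?thesis
        using c v(1) \<sigma>(4) by auto
    qed
    then have "\<sigma> \<inter> span (insert x X) = {0}"
      using \<sigma>(1) subspace_0 span_zero by blast
    then show "\<sigma> \<in> ?L"
      using \<sigma> dw[OF w(1,3)] by (auto simp: complements_def d simp del: dim_span)
  }
qed

lemma complement_sum_insert:
  assumes "nondegenerate V" and "subspace X" and "X \<subseteq> V" and "x \<in> V" and "x \<notin> X"
  shows "complement_sum E V (span (insert x X))
    = (\<Sum>w\<in>{w \<in> V \<inter> perp X. f w x = 1}. complement_sum E (V \<inter> perp {w}) X)"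
  unfolding complement_sum_def complements_insert[OF assms]
proof (rule sum.UNION_disjoint)
  note V = nondegenerateD(1)[OF assms(1)]
  show "\<forall>w\<in>{w \<in> V \<inter> perp X. f w x = 1}. \<forall>w'\<in>{w \<in> V \<inter> perp X. f w x = 1}. w \<noteq> w' \<longrightarrow>
    complements (V \<inter> perp {w}) X \<inter> complements (V \<inter> perp {w'}) X = {}"
  proof (intro ballI impI, rule ccontr)
    fix w w' assume w: "w \<in> {w \<in> V \<inter> perp X. f w x = 1}" "w' \<in> {w \<in> V \<inter> perp X. f w x = 1}"
      and "w \<noteq> w'" and "complements (V \<inter> perp {w}) X \<inter> complements (V \<inter> perp {w'}) X \<noteq> {}"
    then obtain \<sigma> where \<sigma>: "\<sigma> \<in> complements (V \<inter> perp {w}) X" "\<sigma> \<in> complements (V \<inter> perp {w'}) X"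
      by blast
    then have "\<sigma> \<in> complements V (span (insert x X))"
      unfolding complements_insert[OF assms] using w by blast
    then have sp: "span (\<sigma> \<union> span (insert x X)) = V"
      using assms V by (intro span_complement subspace_span span_minimal) auto
    \<comment> \<open>Both vectors vanish on \<sigma> and on \<open>X\<close> and take the value 1
      at \<open>x\<close>, so their difference is orthogonal to a spanning set of
      \<open>V\<close>.\<close>
    have "\<sigma> \<union> span (insert x X) \<subseteq> {v. f (w - w') v = 0}"
    proof (intro Un_least span_minimal)
      show "\<sigma> \<subseteq> {v. f (w - w') v = 0}"
      proof
        fix v assume "v \<in> \<sigma>"
        then have "f v w = 0" "f v w' = 0"
          using \<sigma> by (auto simp: complements_def mem_perp_iff)
        then show "v \<in> {v. f (w - w') v = 0}"
          by (simp add: f_simps form_sym[of _ v])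
      qed
      show "insert x X \<subseteq> {v. f (w - w') v = 0}"
        using w by (auto simp: mem_perp_iff f_simps)
      show "subspace {v. f (w - w') v = 0}"
        by (auto simp: subspace_def f_simps) 
    qed
    then have "V \<subseteq> {v. f (w - w') v = 0}"
      unfolding sp[symmetric] by (rule span_minimal) (auto simp: subspace_def f_add_right f_scale_right)
    then have "w - w' = 0"
      using w V by (intro nondegenerateD(2)[OF assms(1)]) (auto intro: subspace_diff)
    then show False
      using \<open>w \<noteq> w'\<close> by simp
  qed
qed simp_all

section \<open>Reflections\<close>

definition reflection :: "'v \<Rightarrow> 'v \<Rightarrow> 'v" where
  "reflection u x = x - scale (2 * f x u / Q u) u"

definition reflection_invariant :: "('v set \<Rightarrow> real) \<Rightarrow> bool" where
  "reflection_invariant E \<longleftrightarrow> (\<forall>u \<sigma>. Q u \<noteq> 0 \<longrightarrow> subspace \<sigma> \<longrightarrow> E (reflection u ` \<sigma>) = E \<sigma>)"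

lemma reflection_add: "reflection u (x + y) = reflection u x + reflection u y"
  by (simp add: reflection_def f_simps distrib_left add_divide_distrib scale_left_distrib)

lemma reflection_scale: "reflection u (scale c x) = scale c (reflection u x)"
  by (simp add: reflection_def f_simps scale_right_diff_distrib mult.left_commute)

context
  fixes u :: 'v
  assumes u: "Q u \<noteq> 0"
begin

lemma reflection_reflection [simp]: "reflection u (reflection u x) = x"
  using u by (simp add: reflection_def f_simps flip: quadratic_form scale_left_diff_distrib scale_left_distrib)

lemma f_reflection: "f (reflection u x) (reflection u y) = f x y"
  using u by (simp add: reflection_def f_simps form_sym[of u] flip: quadratic_form)

lemma Q_reflection [simp]: "Q (reflection u x) = Q x"
  by (simp add: quadratic_form f_reflection)

lemma inj_reflection: "inj (reflection u)"
  by (metis injI reflection_reflection)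

lemma subspace_reflection: "subspace \<sigma> \<Longrightarrow> subspace (reflection u ` \<sigma>)"
  unfolding subspace_def
  by (auto simp flip: reflection_add reflection_scale)
    (auto simp: image_iff reflection_def intro!: bexI[of _ 0])

lemma dim_reflection:
  assumes "subspace \<sigma>"
  shows "dim (reflection u ` \<sigma>) = dim \<sigma>"
proof -
  have "q ^ dim (reflection u ` \<sigma>) = q ^ dim \<sigma>"
    using card_subspace[OF subspace_reflection[OF assms]] card_subspace[OF assms]
      card_image[OF inj_on_subset[OF inj_reflection subset_UNIV], of \<sigma>] by simp
  then show ?thesis
    using q_gt_1 by (simp add: power_inject_exp)
qed

lemma radical_reflection: "radical (reflection u ` \<sigma>) = reflection u ` radical \<sigma>"
  by (auto simp: radical_def f_reflection)

end

text \<open>The reflection in \<open>y - w\<close> exchanges \<open>y\<close> and \<open>w\<close> and fixes \<open>X\<close> pointwise.\<close>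

lemma complement_sum_isotropic:
  assumes "reflection_invariant E" and "subspace V" and "X \<subseteq> V" and "w \<in> V" and "y \<in> V"
    and "w \<in> perp X" and "y \<in> perp X" and "Q w = 0" and "Q y = 0" and "f y w \<noteq> 0"
  shows "complement_sum E (V \<inter> perp {y}) X = complement_sum E (V \<inter> perp {w}) X"
proof -
  define u where "u = y - w"
  have Qu: "Q u = - 2 * f y w"
    using assms by (simp add: u_def Q_diff)
  then have u: "Q u \<noteq> 0"
    using assms(10) two_neq_zero by simp
  have swap: "reflection u w = y" "reflection u y = w"
  proof -
    have "f w u = f y w"
      using assms(8) by (simp add: u_def f_simps form_sym[of w y] flip: quadratic_form)
    then have "2 * f w u / Q u = - 1"
      using u unfolding Qu by simp
    then show "reflection u w = y"
      by (simp add: reflection_def u_def)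
    then show "reflection u y = w"
      using reflection_reflection[OF u, of w] by simp
  qed
  have fixed: "reflection u x = x" if "x \<in> X" for x
    using that assms(6,7) by (simp add: reflection_def u_def f_simps mem_perp_iff form_sym[of x])
  have V: "reflection u v \<in> V" if "v \<in> V" for v
    using that assms by (auto simp: reflection_def u_def intro!: subspace_diff subspace_scale)
  have img: "reflection u ` (V \<inter> perp {a}) = V \<inter> perp {reflection u a}" for a
  proof (intro set_eqI iffI)
    fix v assume "v \<in> reflection u ` (V \<inter> perp {a})"
    then show "v \<in> V \<inter> perp {reflection u a}"
      using V by (auto simp: mem_perp_iff f_reflection[OF u])
  next
    fix v assume "v \<in> V \<inter> perp {reflection u a}"
    then have "reflection u v \<in> V \<inter> perp {a}"
      using V f_reflection[OF u, of "reflection u v" a] u by (auto simp: mem_perp_iff)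
    then show "v \<in> reflection u ` (V \<inter> perp {a})"
      using reflection_reflection[OF u, of v] by (metis image_eqI)
  qed
  have compl: "reflection u ` \<sigma> \<in> complements (V \<inter> perp {reflection u a}) X"
    if \<sigma>: "\<sigma> \<in> complements (V \<inter> perp {a}) X" for \<sigma> a
  proof -
    have sub: "subspace (V \<inter> perp {a})"
      by (intro subspace_inter assms subspace_perp)
    have "reflection u ` \<sigma> \<inter> X = reflection u ` (\<sigma> \<inter> X)"
    proof (intro set_eqI iffI)
      fix v assume v: "v \<in> reflection u ` \<sigma> \<inter> X"
      then obtain s where s: "s \<in> \<sigma>" "v = reflection u s"
        by blast
      then have "s = v"
        using reflection_reflection[OF u, of s] fixed[of v] v by simp
      then show "v \<in> reflection u ` (\<sigma> \<inter> X)"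
        using s v by blast
    next
      fix v assume "v \<in> reflection u ` (\<sigma> \<inter> X)"
      then obtain s where s: "s \<in> \<sigma>" "s \<in> X" "v = reflection u s"
        by blast
      then show "v \<in> reflection u ` \<sigma> \<inter> X"
        using fixed[of s] by (metis IntI imageI)
    qed
    also have "\<dots> = {0}"
      using \<sigma> by (simp add: complements_def reflection_def)
    finally show ?thesis
      using \<sigma> dim_reflection[OF u sub] dim_reflection[OF u, of \<sigma>] subspace_reflection[OF u, of \<sigma>]
      unfolding complements_def img[symmetric] by auto
  qed
  have invol: "reflection u ` reflection u ` \<sigma> = \<sigma>" for \<sigma>
    using u by (simp add: image_image)
  show ?thesis
    unfolding complement_sum_def
    by (rule sum.reindex_bij_witness[of _ "image (reflection u)" "image (reflection u)"])
      (use compl[of _ y] compl[of _ w] assms(1) u in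
        \<open>auto simp: invol swap reflection_invariant_def complements_def\<close>)
qed

section \<open>Summation over hyperplanes by the norm of their normal vectors\<close>

lemma sum_by_level:
  fixes g :: "'a \<Rightarrow> real"
  shows "(\<Sum>y\<in>A. g (Q y)) = (\<Sum>c\<in>UNIV. real (card {y \<in> A. Q y = c}) * g c)"
proof -
  have "(\<Sum>y\<in>A. g (Q y)) = (\<Sum>y\<in>A. \<Sum>c\<in>UNIV. if Q y = c then g c else 0)"
    by simp
  also have "\<dots> = (\<Sum>c\<in>UNIV. \<Sum>y\<in>A. if Q y = c then g c else 0)"
    by (rule sum.swap)
  also have "\<dots> = (\<Sum>c\<in>UNIV. real (card {y \<in> A. Q y = c}) * g c)"
    by (rule sum.cong) (simp_all add: sum.If_cases Int_def)
  finally show ?thesis .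
qed

lemma double_half: "2 * (a / 2) = (a :: 'a)"
  using two_neq_zero by simp

text \<open>The vectors \<open>y\<close> with \<open>f y w = 1\<close> are
  \<open>y0 + x + t w\<close> with \<open>x\<close> orthogonal to the hyperbolic pair. As
  \<open>w\<close> is isotropic, the norm is affine in \<open>t\<close> with slope 2, so for each
  \<open>x\<close> exactly one \<open>t\<close> reaches the level \<open>c\<close>.\<close>

lemma card_level_affine:
  assumes "subspace W" and "w \<in> W" and "y0 \<in> W" and "Q w = 0" and "Q y0 = 0" and "f y0 w = 1"
  shows "real (card {y \<in> W. f y w = 1 \<and> Q y = c}) = q ^ (dim W - 2)"
proof -
  define U where "U = W \<inter> perp {y0, w}"
  have U: "subspace U" "dim W = dim U + 2"
    using hyperbolic_split[OF assms(1,3,2,5,4)] assms(6) by (simp_all add: U_def)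
  have w0: "f w w = 0" "f y0 y0 = 0" "f w y0 = 1"
    using assms by (simp_all add: form_sym[of w y0] flip: quadratic_form)
  have "bij_betw (\<lambda>x. y0 + x + scale ((c - Q x) / 2) w) U {y \<in> W. f y w = 1 \<and> Q y = c}"
  proof (rule bij_betwI[where g = "\<lambda>y. y - y0 - scale (f y y0) w"])
    show "(\<lambda>x. y0 + x + scale ((c - Q x) / 2) w) \<in> U \<rightarrow> {y \<in> W. f y w = 1 \<and> Q y = c}"
    proof
      fix x assume x: "x \<in> U"
      then have fx: "f x w = 0" "f x y0 = 0" "f y0 x = 0" "f w x = 0"
        by (auto simp: U_def mem_perp_iff form_sym[of _ x])
      have "Q (y0 + x + scale ((c - Q x) / 2) w) = Q x + 2 * ((c - Q x) / 2)"
        using assms(4,5) by (simp add: Q_add Q_scale f_simps fx w0 assms(6))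
      then have "Q (y0 + x + scale ((c - Q x) / 2) w) = c"
        by (simp only: double_half) simp
      then show "y0 + x + scale ((c - Q x) / 2) w \<in> {y \<in> W. f y w = 1 \<and> Q y = c}"
        using x assms by (auto simp: U_def f_simps w0 fx intro!: subspace_add subspace_scale)
    qed
    show "(\<lambda>y. y - y0 - scale (f y y0) w) \<in> {y \<in> W. f y w = 1 \<and> Q y = c} \<rightarrow> U"
    proof
      fix y assume y: "y \<in> {y \<in> W. f y w = 1 \<and> Q y = c}"
      then have "y - y0 - scale (f y y0) w \<in> W"
        using assms by (auto intro!: subspace_diff subspace_scale)
      then show "y - y0 - scale (f y y0) w \<in> U"
        using y assms by (auto simp: U_def mem_perp_iff f_simps w0)
    qed
    show "y0 + x + scale ((c - Q x) / 2) w - y0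
        - scale (f (y0 + x + scale ((c - Q x) / 2) w) y0) w = x" if "x \<in> U" for x
      using that by (auto simp: U_def mem_perp_iff f_simps w0)
    show "y0 + (y - y0 - scale (f y y0) w)
        + scale ((c - Q (y - y0 - scale (f y y0) w)) / 2) w = y"
      if "y \<in> {y \<in> W. f y w = 1 \<and> Q y = c}" for y
    proof -
      have "Q (y - y0 - scale (f y y0) w) = c - 2 * f y y0"
        using that assms(4,5) by (simp add: Q_diff Q_scale f_simps w0 assms(6))
      then have "(c - Q (y - y0 - scale (f y y0) w)) / 2 = f y y0"
        using two_neq_zero by simp
      then show ?thesis by simp
    qed
  qed
  then have "card U = card {y \<in> W. f y w = 1 \<and> Q y = c}"
    by (rule bij_betw_same_card)
  then show ?thesis
    using card_subspace[OF U(1)] U(2) by simp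
qed

lemma sum_const_plus_qchar:
  "(\<Sum>c::'a\<in>UNIV - {0}. a + b * qchar c) = (q - 1) * a"
proof -
  have "(\<Sum>c::'a\<in>UNIV - {0}. qchar c) = 0"
    using sum_qchar[OF odd_card] by (simp add: sum.remove[of UNIV "0::'a"])
  then show ?thesis
    by (simp add: sum.distrib q_eq card_Diff_singleton of_nat_diff flip: sum_distrib_left)
qed

text \<open>All levels of the affine space of normal vectors are equally large, so the character
  part cancels over the non-zero levels and only \<open>a\<close> survives. The isotropic normal
  vectors all contribute as much as \<open>w\<close> itself, by reflections.\<close>

lemma complement_sum_insert_isotropic:
  assumes "reflection_invariant E" and "nondegenerate V" and "subspace X" and "X \<subseteq> V"
    and "w \<in> V" and "w \<in> perp X" and "w \<notin> X" and "Q w = 0"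
    and "\<And>y. y \<in> V \<Longrightarrow> y \<in> perp X \<Longrightarrow> f y w = 1 \<Longrightarrow> Q y \<noteq> 0 \<Longrightarrow>
      complement_sum E (V \<inter> perp {y}) X = a + b * qchar (Q y)"
  shows "complement_sum E V (span (insert w X))
    = q ^ (dim V - dim X - 2) * ((q - 1) * a + complement_sum E (V \<inter> perp {w}) X)"
proof -
  define W where "W = V \<inter> perp X"
  note V = nondegenerateD(1)[OF assms(2)]
  have W: "subspace W"
    unfolding W_def by (intro subspace_inter V subspace_perp)
  obtain y0 where y0: "y0 \<in> V" "y0 \<in> perp X" "f y0 w = 1" "Q y0 = 0"
    by (rule exists_isotropic_dual_vector[OF assms(2,3,4,5,7,8,6)])
  have dW: "dim W = dim V - dim X"
    using dim_perp[OF assms(2-4)] by (simp add: W_def)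
  let ?Z = "complement_sum E (V \<inter> perp {w}) X"
  have "complement_sum E V (span (insert w X))
    = (\<Sum>y\<in>{y \<in> W. f y w = 1}. if Q y = 0 then ?Z else a + b * qchar (Q y))"
    unfolding complement_sum_insert[OF assms(2,3,4,5,7)] W_def[symmetric]
    using assms complement_sum_isotropic[OF assms(1) V assms(4,5)]
    by (intro sum.cong) (auto simp: W_def)
  also have "\<dots> = (\<Sum>c\<in>UNIV. real (card {y \<in> W. f y w = 1 \<and> Q y = c}) * (if c = 0 then ?Z else a + b * qchar c))"
    by (subst sum_by_level) simp
  also have "\<dots> = q ^ (dim W - 2) * (\<Sum>c\<in>UNIV. if c = 0 then ?Z else a + b * qchar (c::'a))"
    using card_level_affine[OF W _ _ assms(8) y0(4,3)] assms y0 by (simp add: W_def sum_distrib_left)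
  also have "(\<Sum>c\<in>UNIV. if c = 0 then ?Z else a + b * qchar (c::'a))
    = ?Z + (\<Sum>c::'a\<in>UNIV - {0}. a + b * qchar c)"
    by (subst sum.remove[of UNIV 0]) (auto intro!: sum.cong)
  also have "\<dots> = (q - 1) * a + ?Z"
    by (simp add: sum_const_plus_qchar)
  finally show ?thesis
    by (simp add: dW)
qed


lemma anisotropic_sum_regroup:
  fixes a s n g d :: real
  shows "a * (d - n) + s + n * (g * q / d - (q - 1) * a) = a * (d - n * q) + s + g * (n * q) / d"
  by (simp add: algebra_simps)

context
  fixes E :: "'v set \<Rightarrow> real" and V X :: "'v set" and v :: 'v and z :: 'a and a b g :: real
  assumes prems: "reflection_invariant E" "nondegenerate V" "subspace X" "X \<subseteq> V"
      "v \<in> V" "v \<in> perp X" "Q v = z" "z \<noteq> 0"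
    and aniso: "\<And>y. y \<in> V \<Longrightarrow> y \<in> perp X \<Longrightarrow> Q y \<noteq> 0 \<Longrightarrow>
      complement_sum E (V \<inter> perp {y}) X = a + b * qchar (Q y)"
    and iso: "\<And>w. w \<in> V \<Longrightarrow> w \<in> perp X \<Longrightarrow> w \<notin> X \<Longrightarrow> Q w = 0 \<Longrightarrow>
      complement_sum E V (span (insert w X)) = g"
begin

text \<open>The normal vectors with \<open>f w v = 1\<close> are \<open>x + v / z\<close> with
  \<open>x\<close> in \<open>W\<close>, of norm \<open>Q x + 1 / z\<close>, so the isotropic ones
  come from level \<open>- 1 / z\<close> of \<open>W\<close>. Their unknown contribution is solved
  for in the formula for \<open>span (insert w X)\<close>, whose value is \<open>g\<close>.\<close>

lemma complement_sum_insert_anisotropic: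
  defines "W \<equiv> V \<inter> perp (span (insert v X))"
  shows "complement_sum E V (span (insert v X))
    = a * (q ^ dim W - level_count W (- 1 / z)) + b * (\<Sum>c\<in>UNIV. level_count W c * qchar (c + 1 / z))
      + level_count W (- 1 / z) * (g * q / q ^ dim W - (q - 1) * a)"
proof -
  note V = nondegenerateD(1)[OF prems(2)]
  have vX: "v \<notin> X"
    using prems(6-8) by (auto simp: mem_perp_iff simp flip: quadratic_form)
  have W: "W = V \<inter> perp X \<inter> perp {v}" and subW: "subspace W"
    unfolding W_def perp_span perp_insert[of v X] by (auto intro!: subspace_inter V subspace_perp)
  have dW: "dim V = dim X + dim W + 1"
    using dim_perp[OF prems(2) subspace_span, of "insert v X"] dim_span_insert[OF prems(3) vX] prems(4,5)
      span_minimal[OF _ V, of "insert v X"] by (simp add: W_def)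
  let ?h = "\<lambda>c::'a. if c = 0 then g * q / q ^ dim W - (q - 1) * a else a + b * qchar c"
  have h: "complement_sum E (V \<inter> perp {w}) X = ?h (Q w)" if w: "w \<in> V" "w \<in> perp X" "f w v = 1" for w
  proof (cases "Q w = 0")
    case True
    have wX: "w \<notin> X"
      using w(3) prems(6) by (auto simp: mem_perp_iff form_sym[of w v])
    obtain y0 where y0: "y0 \<in> V" "y0 \<in> perp X" "f y0 w = 1" "Q y0 = 0"
      by (rule exists_isotropic_dual_vector[OF prems(2,3,4) w(1) wX True w(2)])
    have "g = q ^ (dim V - dim X - 2) * ((q - 1) * a + complement_sum E (V \<inter> perp {w}) X)"
      using complement_sum_insert_isotropic[OF prems(1-4) w(1,2) wX True aniso] iso[OF w(1,2) wX True]
      by simp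
    \<comment> \<open>The exponent \<open>dim V - dim X - 2\<close> is \<open>dim W - 1\<close> in
      truncated subtraction, so \<open>W\<close> must be non-zero; the hyperbolic pair in
      \<open>V \<inter> perp X\<close> ensures it.\<close>
    moreover have "dim W > 0"
    proof -
      have "subspace (V \<inter> perp X)"
        by (intro subspace_inter V subspace_perp)
      from hyperbolic_split(2)[OF this, of y0 w] have "2 \<le> dim (V \<inter> perp X)"
        using y0 w True by simp
      then show ?thesis
        using dim_perp[OF prems(2-4)] dW by simp
    qed
    then have "dim W = Suc (dim V - dim X - 2)"
      using dW by simp
    ultimately show ?thesis
      using True by (simp add: field_simps)
  qed (use aniso w in auto)
  have vv: "f v v = z"
    using prems(7) by (simp flip: quadratic_form)
  have img: "{w \<in> V \<inter> perp X. f w v = 1} = (\<lambda>x. x + scale (1 / z) v) ` W"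
  proof (intro set_eqI iffI)
    fix w assume w: "w \<in> {w \<in> V \<inter> perp X. f w v = 1}"
    have "w - scale (1 / z) v \<in> V \<inter> perp X"
      using w prems(5,6) V by (auto intro!: subspace_diff subspace_scale subspace_perp)
    then have "w - scale (1 / z) v \<in> W"
      using w prems(8) by (auto simp: W mem_perp_iff[of _ "{v}"] f_simps vv)
    then show "w \<in> (\<lambda>x. x + scale (1 / z) v) ` W"
      by (rule rev_image_eqI) simp
  next
    fix w assume "w \<in> (\<lambda>x. x + scale (1 / z) v) ` W"
    then obtain x where x: "x \<in> W" "w = x + scale (1 / z) v"
      by blast
    then have "w \<in> V \<inter> perp X"
      using prems(5,6) V by (auto simp: W intro!: subspace_add subspace_scale subspace_perp)
    then show "w \<in> {w \<in> V \<inter> perp X. f w v = 1}"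
      using x prems(8) by (auto simp: W mem_perp_iff f_simps vv)
  qed
  have Qx: "Q (x + scale (1 / z) v) = Q x + 1 / z" if "x \<in> W" for x
    using that prems(7,8) by (simp add: W mem_perp_iff Q_add Q_scale f_simps power2_eq_square)
  have "complement_sum E V (span (insert v X)) = (\<Sum>w\<in>{w \<in> V \<inter> perp X. f w v = 1}. ?h (Q w))"
    unfolding complement_sum_insert[OF prems(2-5) vX] using h by (intro sum.cong) auto
  also have "\<dots> = (\<Sum>x\<in>W. ?h (Q x + 1 / z))"
    unfolding img using Qx by (subst sum.reindex) (auto simp: inj_on_def intro!: sum.cong)
  also have "\<dots> = (\<Sum>c\<in>UNIV. level_count W c * ?h (c + 1 / z))"
    using sum_by_level[of "\<lambda>c. ?h (c + 1 / z)" W] by (simp add: level_count_def)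
  \<comment> \<open>Since \<open>qchar 0 = 0\<close>, the generic expression has the value
    \<open>a\<close> at argument 0, and the correction at \<open>c = - 1 / z\<close> is the true
    value minus \<open>a\<close>.\<close>
  also have "\<dots> = (\<Sum>c\<in>UNIV. a * level_count W c + b * (level_count W c * qchar (c + 1 / z))
      + (if c = - 1 / z then level_count W c * (?h 0 - a) else 0))"
    using prems(8) by (intro sum.cong) (auto simp: eq_neg_iff_add_eq_0 algebra_simps)
  also have "\<dots> = a * (\<Sum>c\<in>UNIV. level_count W c) + b * (\<Sum>c\<in>UNIV. level_count W c * qchar (c + 1 / z))
      + level_count W (- 1 / z) * (?h 0 - a)"
    by (simp add: sum.distrib sum_distrib_left)
  also have "(\<Sum>c\<in>UNIV. level_count W c) = q ^ dim W"
    using sum_by_level[of "\<lambda>_. 1" W] card_subspace[OF subW] by (simp add: level_count_def)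
  finally show ?thesis
    by (simp add: algebra_simps)
qed

text \<open>In even rank the level counts of \<open>W\<close> are constant except at level 0, so the
  sum against the shifted character only retains the value \<open>qchar (1 / z)\<close>
  there.\<close>

lemma complement_sum_insert_anisotropic_even:
  assumes "dim (radical (V \<inter> perp (span (insert v X)))) = i"
    and "rank (V \<inter> perp (span (insert v X))) = 2 * m"
  shows "complement_sum E V (span (insert v X))
    = g + sign (V \<inter> perp (span (insert v X))) * (q ^ (i + m) * (a + b * qchar z) - g / q ^ m)"
proof -
  define W where "W = V \<inter> perp (span (insert v X))"
  have W: "subspace W"
    unfolding W_def by (intro subspace_inter subspace_perp nondegenerateD(1)[OF prems(2)])
  have rk: "rank W = 2 * m" and i: "dim (radical W) = i"
    using assms by (simp_all add: W_def)
  then have d: "dim W = i + 2 * m"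
    using dim_subset[of "radical W" W] by (auto simp: rank_def radical_def)
  have N: "level_count W c = q ^ i * (q ^ (2 * m) / q - sign W * q ^ m / q + (if c = 0 then sign W * q ^ m else 0))" for c
    using level_count_sign[OF W] by (simp add: level_formula_def rk i)
  have "(\<Sum>c\<in>UNIV. level_count W c * qchar (c + 1 / z))
    = (\<Sum>c\<in>UNIV. q ^ i * (q ^ (2 * m) / q - sign W * q ^ m / q) * qchar (c + 1 / z)
      + (if c = 0 then q ^ i * sign W * q ^ m * qchar (c + 1 / z) else 0))"
    unfolding N by (intro sum.cong) (auto simp: algebra_simps)
  also have "\<dots> = q ^ i * (q ^ (2 * m) / q - sign W * q ^ m / q) * (\<Sum>c\<in>UNIV. qchar (c + 1 / z))
      + q ^ i * sign W * q ^ m * qchar (1 / z)"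
    by (simp add: sum.distrib flip: sum_distrib_left)
  also have "(\<Sum>c\<in>UNIV. qchar (c + 1 / z)) = 0"
    by (rule sum_qchar_comp[OF odd_card]) (rule o_bij[where g = "\<lambda>x. x - 1 / z"], auto simp: fun_eq_iff)
  also have "qchar (1 / z) = qchar z"
    by (simp add: qchar_divide[OF odd_card])
  finally have S: "(\<Sum>c\<in>UNIV. level_count W c * qchar (c + 1 / z)) = q ^ i * sign W * q ^ m * qchar z"
    by simp
  have base: "complement_sum E V (span (insert v X))
    = a * (q ^ dim W - level_count W (- 1 / z)) + b * (\<Sum>c\<in>UNIV. level_count W c * qchar (c + 1 / z))
      + level_count W (- 1 / z) * (g * q / q ^ dim W - (q - 1) * a)"
    unfolding W_def by (rule complement_sum_insert_anisotropic)
  define N1 where "N1 = level_count W (- 1 / z)"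
  have qm: "q ^ (2 * m) = q ^ m * q ^ m"
    by (simp add: mult_2 power_add)
  have N1: "N1 * q = q ^ i * (q ^ m * q ^ m - sign W * q ^ m)"
    unfolding N1_def N qm using prems(8) by (simp flip: diff_divide_distrib)
  have "complement_sum E V (span (insert v X)) = a * (q ^ i * (q ^ m * q ^ m) - N1 * q)
    + b * (q ^ i * sign W * q ^ m * qchar z) + g * (N1 * q) / (q ^ i * (q ^ m * q ^ m))"
    using base
    unfolding S d power_add qm N1_def[symmetric]
    by (simp only: anisotropic_sum_regroup)
  also have "g * (N1 * q) / (q ^ i * (q ^ m * q ^ m)) = g - sign W * g / q ^ m"
    unfolding N1 by (simp add: right_diff_distrib diff_divide_distrib)
  finally show ?thesis
    unfolding N1 W_def[symmetric] by (simp add: power_add algebra_simps)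
qed

text \<open>In odd rank the level counts vary with the character itself. Its correlation with a
  shift is -1 whatever \<open>z\<close> is, and \<open>qchar (- z)\<close> enters through the count
  at level \<open>- 1 / z\<close>.\<close>

lemma complement_sum_insert_anisotropic_odd:
  assumes "dim (radical (V \<inter> perp (span (insert v X)))) = i"
    and "rank (V \<inter> perp (span (insert v X))) = 2 * m + 1"
  shows "complement_sum E V (span (insert v X))
    = g + sign (V \<inter> perp (span (insert v X))) *
        (qchar (- z) * (g / q ^ m - q ^ (i + m + 1) * a) - q ^ (i + m) * b)"
proof -
  define W where "W = V \<inter> perp (span (insert v X))"
  have W: "subspace W"
    unfolding W_def by (intro subspace_inter subspace_perp nondegenerateD(1)[OF prems(2)])
  have rk: "rank W = 2 * m + 1" and i: "dim (radical W) = i"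
    using assms by (simp_all add: W_def)
  then have d: "dim W = i + 2 * m + 1"
    using dim_subset[of "radical W" W] by (auto simp: rank_def radical_def)
  have N: "level_count W c = q ^ i * (q ^ (2 * m) + sign W * qchar c * q ^ m)" for c
    using level_count_sign[OF W] by (simp add: level_formula_def rk i)
  have "(\<Sum>c\<in>UNIV. level_count W c * qchar (c + 1 / z))
    = (\<Sum>c\<in>UNIV. q ^ i * q ^ (2 * m) * qchar (c + 1 / z)
      + q ^ i * sign W * q ^ m * (qchar c * qchar (c + 1 / z)))"
    unfolding N by (intro sum.cong) (auto simp: algebra_simps)
  also have "\<dots> = q ^ i * q ^ (2 * m) * (\<Sum>c\<in>UNIV. qchar (c + 1 / z))
      + q ^ i * sign W * q ^ m * (\<Sum>c\<in>UNIV. qchar c * qchar (c + 1 / z))"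
    by (simp only: sum.distrib sum_distrib_left)
  also have "(\<Sum>c\<in>UNIV. qchar (c + 1 / z)) = 0"
    by (rule sum_qchar_comp[OF odd_card]) (rule o_bij[where g = "\<lambda>x. x - 1 / z"], auto simp: fun_eq_iff)
  also have "(\<Sum>c\<in>UNIV. qchar c * qchar (c + 1 / z)) = - 1"
    using prems(8) by (intro sum_qchar_shift[OF odd_card]) simp
  finally have S: "(\<Sum>c\<in>UNIV. level_count W c * qchar (c + 1 / z)) = - (q ^ i * sign W * q ^ m)"
    by simp
  have "qchar (- 1 / z) = qchar (- z)"
    using qchar_divide[OF odd_card, of "- 1" z] qchar_mult[OF odd_card, of "- 1" z] by simp
  have base: "complement_sum E V (span (insert v X))
    = a * (q ^ dim W - level_count W (- 1 / z)) + b * (\<Sum>c\<in>UNIV. level_count W c * qchar (c + 1 / z))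
      + level_count W (- 1 / z) * (g * q / q ^ dim W - (q - 1) * a)"
    unfolding W_def by (rule complement_sum_insert_anisotropic)
  define N1 where "N1 = level_count W (- 1 / z)"
  have qm: "q ^ (2 * m) = q ^ m * q ^ m"
    by (simp add: mult_2 power_add)
  have N1: "N1 * q = q ^ i * (q ^ m * q ^ m * q + sign W * qchar (- z) * (q ^ m * q))"
    unfolding N1_def N \<open>qchar (- 1 / z) = qchar (- z)\<close> qm by (simp add: algebra_simps)
  have "complement_sum E V (span (insert v X)) = a * (q ^ i * (q ^ m * q ^ m) * q - N1 * q)
    + b * - (q ^ i * sign W * q ^ m) + g * (N1 * q) / (q ^ i * (q ^ m * q ^ m) * q)"
    using base
    unfolding S d power_add qm N1_def[symmetric]
    by (simp only: power_one_right anisotropic_sum_regroup)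
  also have "g * (N1 * q) / (q ^ i * (q ^ m * q ^ m) * q) = g + sign W * qchar (- z) * g / q ^ m"
    unfolding N1 by (simp add: distrib_left add_divide_distrib)
  finally show ?thesis
    unfolding N1 W_def[symmetric] by (simp add: power_add algebra_simps)
qed

end

text \<open>The properties shared by the indicator of non-degeneracy and its product with the sign,
  so that both sums over complements obey the same recursions.\<close>

definition admissible :: "('v set \<Rightarrow> real) \<Rightarrow> bool" where
  "admissible E \<longleftrightarrow> reflection_invariant E \<and>
     (\<forall>\<sigma>. subspace \<sigma> \<longrightarrow> \<not> nondegenerate \<sigma> \<longrightarrow> E \<sigma> = 0) \<and>
     (\<forall>\<sigma> s p. nondegenerate \<sigma> \<longrightarrow> s \<in> \<sigma> \<longrightarrow> p \<in> \<sigma> \<longrightarrow> Q s = 0 \<longrightarrow> Q p = 0 \<longrightarrow> f p s = 1 \<longrightarrow>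
        E \<sigma> = E (\<sigma> \<inter> perp {s, p}))"

lemma complement_sum_nondegenerate:
  assumes "admissible E"
  shows "complement_sum E V X = (\<Sum>\<sigma>\<in>{\<sigma> \<in> complements V X. nondegenerate \<sigma>}. E \<sigma>)"
  unfolding complement_sum_def
  by (rule sum.mono_neutral_right) (use assms in \<open>auto simp: admissible_def complements_def\<close>)

lemma span_hyperbolic_inter_perp:
  assumes "subspace \<sigma>" and "\<sigma> \<subseteq> perp {s, p}" and "Q s = 0" and "Q p = 0" and "f p s = 1"
  shows "span (insert s (insert p \<sigma>)) \<inter> perp {s, p} = \<sigma>"
proof
  have ff: "f s s = 0" "f p p = 0" "f s p = 1"
    using assms(3-5) by (simp_all add: form_sym[of s p] flip: quadratic_form)
  show "span (insert s (insert p \<sigma>)) \<inter> perp {s, p} \<subseteq> \<sigma>"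
  proof
    fix v assume v: "v \<in> span (insert s (insert p \<sigma>)) \<inter> perp {s, p}"
    then obtain a where "v - scale a s \<in> span (insert p \<sigma>)"
      by (auto simp: span_insert)
    then obtain b where b: "v - scale a s - scale b p \<in> \<sigma>"
      using mem_span_insert[OF assms(1)] by blast
    then have "f (v - scale a s - scale b p) s = 0" "f (v - scale a s - scale b p) p = 0"
      using assms(2) by (auto simp: mem_perp_iff)
    then have "a = 0" "b = 0"
      using v assms(5) by (simp_all add: f_simps ff mem_perp_iff)
    then show "v \<in> \<sigma>"
      using b by simp
  qed
  show "\<sigma> \<subseteq> span (insert s (insert p \<sigma>)) \<inter> perp {s, p}"
    using assms(2) by (auto intro: span_base)
qed

lemma span_hyperbolic_eq:
  assumes "subspace \<sigma>" and "s \<in> \<sigma>" and "p \<in> \<sigma>" and "Q s = 0" and "Q p = 0" and "f p s = 1"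
  shows "span (insert s (insert p (\<sigma> \<inter> perp {s, p}))) = \<sigma>"
proof
  show "span (insert s (insert p (\<sigma> \<inter> perp {s, p}))) \<subseteq> \<sigma>"
    using assms(1-3) by (intro span_minimal) auto
  have ff: "f s s = 0" "f p p = 0" "f s p = 1"
    using assms(4-6) by (simp_all add: form_sym[of s p] flip: quadratic_form)
  show "\<sigma> \<subseteq> span (insert s (insert p (\<sigma> \<inter> perp {s, p})))"
  proof
    fix v assume v: "v \<in> \<sigma>"
    let ?u = "v - scale (f v p) s - scale (f v s) p"
    have "?u \<in> \<sigma>"
      using v assms(1-3) by (intro subspace_diff subspace_scale)
    moreover have "?u \<in> perp {s, p}"
      using assms(6) by (simp add: mem_perp_iff f_simps ff)
    ultimately have "?u \<in> span (\<sigma> \<inter> perp {s, p})"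
      by (simp add: span_base)
    then show "v \<in> span (insert s (insert p (\<sigma> \<inter> perp {s, p})))"
      unfolding span_insert[of s] span_insert[of p] by blast
  qed
qed

text \<open>As \<open>V\<close> is the direct sum of \<sigma> and \<open>Z\<close>, each \<sigma>
  contains exactly one vector \<open>p0 + z\<close> with \<open>z\<close> in \<open>Z\<close>. It is
  an isotropic partner of \<open>s\<close>, and splitting off this hyperbolic plane leaves a
  complement of \<open>Z\<close> in a space smaller by two dimensions. The \<open>q ^ dim Z\<close>
  choices of \<open>z\<close> contribute equally.\<close>

lemma sum_complements_through_isotropic:
  assumes E: "admissible E" and V: "nondegenerate V" and Z: "subspace Z" "Z \<subseteq> V" "\<forall>x\<in>Z. Q x = 0"
    and s: "s \<in> V" "s \<in> perp Z" "s \<notin> Z" "Q s = 0"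
    and g: "\<And>V'. nondegenerate V' \<Longrightarrow> Z \<subseteq> V' \<Longrightarrow> dim V = dim V' + 2 \<Longrightarrow> sign V' = sign V \<Longrightarrow>
      complement_sum E V' Z = g"
  shows "(\<Sum>\<sigma>\<in>{\<sigma> \<in> complements V Z. nondegenerate \<sigma> \<and> s \<in> \<sigma>}. E \<sigma>) = q ^ dim Z * g"
proof -
  note subV = nondegenerateD(1)[OF V]
  obtain p0 where p0: "p0 \<in> V" "p0 \<in> perp Z" "f p0 s = 1" "Q p0 = 0"
    by (rule exists_isotropic_dual_vector[OF V Z(1,2) s(1,3,4,2)])
  define C where "C z = {\<sigma> \<in> complements V Z. nondegenerate \<sigma> \<and> s \<in> \<sigma> \<and> p0 + z \<in> \<sigma>}" for z
  have un: "{\<sigma> \<in> complements V Z. nondegenerate \<sigma> \<and> s \<in> \<sigma>} = (\<Union>z\<in>Z. C z)"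
  proof (intro set_eqI iffI)
    fix \<sigma> assume \<sigma>: "\<sigma> \<in> {\<sigma> \<in> complements V Z. nondegenerate \<sigma> \<and> s \<in> \<sigma>}"
    then have "p0 \<in> span (\<sigma> \<union> Z)"
      using span_complement[OF _ Z(1,2) subV] p0(1) by simp
    then obtain p z where "p \<in> \<sigma>" "z \<in> Z" "p0 = p + z"
      using \<sigma> Z(1) by (auto simp: span_Un span_eq_iff[THEN iffD2] complements_def)
    then have "\<sigma> \<in> C (- z)" "- z \<in> Z"
      using \<sigma> Z(1) by (auto simp: C_def subspace_neg)
    then show "\<sigma> \<in> (\<Union>z\<in>Z. C z)"
      by blast
  qed (auto simp: C_def)
  have disj: "C z \<inter> C z' = {}" if "z \<in> Z" "z' \<in> Z" "z \<noteq> z'" for z z'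
  proof (rule ccontr)
    assume "C z \<inter> C z' \<noteq> {}"
    then obtain \<sigma> where \<sigma>: "subspace \<sigma>" "\<sigma> \<inter> Z = {0}" "p0 + z \<in> \<sigma>" "p0 + z' \<in> \<sigma>"
      by (auto simp: C_def complements_def)
    then have "z - z' \<in> \<sigma>"
      using subspace_diff[of \<sigma> "p0 + z" "p0 + z'"] by simp
    then have "z - z' \<in> \<sigma> \<inter> Z"
      using that Z(1) by (simp add: subspace_diff)
    then show False
      using \<sigma>(2) that(3) by simp
  qed
  have each: "sum E (C z) = g" if z: "z \<in> Z" for z
  proof -
    define p where "p = p0 + z"
    have zz: "f z s = 0" "f p0 z = 0" "Q z = 0" "z \<in> V"
      using z s p0 Z by (auto simp: mem_perp_iff form_sym[of z])
    have p: "p \<in> V" "f p s = 1" "Q p = 0"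
      using p0 zz subV by (auto simp: p_def f_simps Q_add subspace_add)
    have pZ: "p \<in> perp Z"
      using p0(2) isotropic_orthogonal[OF Z(1,3) z] by (simp add: p_def mem_perp_iff f_simps)
    have fs: "f s p \<noteq> 0"
      using p(2) by (simp add: form_sym[of s])
    define V' where "V' = V \<inter> perp {s, p}"
    have V': "nondegenerate V'" "dim V = dim V' + 2" "sign V' = sign V"
      using hyperbolic_split[OF subV s(1) p(1) s(4) p(3) fs]
        nondegenerate_hyperbolic_split[OF V s(1) p(1) s(4) p(3) fs] by (auto simp: V'_def)
    have ZV': "Z \<subseteq> V'"
      using Z(2) s(2) pZ by (auto simp: V'_def mem_perp_iff form_sym[of _ s] form_sym[of _ p])
    have "sum E (C z) = (\<Sum>\<sigma>\<in>{\<sigma> \<in> complements V' Z. nondegenerate \<sigma>}. E \<sigma>)"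
    proof (rule sum.reindex_bij_witness[of _ "\<lambda>\<sigma>. span (insert s (insert p \<sigma>))" "\<lambda>\<sigma>. \<sigma> \<inter> perp {s, p}"])
      fix \<sigma> assume "\<sigma> \<in> C z"
      then have \<sigma>: "\<sigma> \<in> complements V Z" "subspace \<sigma>" "nondegenerate \<sigma>" "s \<in> \<sigma>" "p \<in> \<sigma>"
        by (auto simp: C_def p_def complements_def)
      show "span (insert s (insert p (\<sigma> \<inter> perp {s, p}))) = \<sigma>"
        by (rule span_hyperbolic_eq[OF \<sigma>(2,4,5) s(4) p(3,2)])
      show "E (\<sigma> \<inter> perp {s, p}) = E \<sigma>"
        using E \<sigma> s(4) p by (simp add: admissible_def)
      have "dim \<sigma> = dim (\<sigma> \<inter> perp {s, p}) + 2"
        by (rule hyperbolic_split(2)[OF \<sigma>(2,4,5) s(4) p(3) fs])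
      moreover have "nondegenerate (\<sigma> \<inter> perp {s, p})"
        by (rule nondegenerate_hyperbolic_split[OF \<sigma>(3,4,5) s(4) p(3) fs])
      moreover have "\<sigma> \<inter> perp {s, p} \<inter> Z = {0}"
        using \<sigma>(1) by (auto simp: complements_def mem_perp_iff)
      ultimately show "\<sigma> \<inter> perp {s, p} \<in> {\<sigma> \<in> complements V' Z. nondegenerate \<sigma>}"
        using \<sigma>(1) V'(2) by (auto simp: complements_def V'_def nondegenerate_def)
    next
      fix \<sigma> assume "\<sigma> \<in> {\<sigma> \<in> complements V' Z. nondegenerate \<sigma>}"
      then have \<sigma>: "subspace \<sigma>" "nondegenerate \<sigma>" "\<sigma> \<subseteq> V" "\<sigma> \<subseteq> perp {s, p}" "\<sigma> \<inter> Z = {0}"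
          "dim \<sigma> + dim Z = dim V'"
        by (auto simp: complements_def V'_def)
      let ?\<tau> = "span (insert s (insert p \<sigma>))"
      show eq: "?\<tau> \<inter> perp {s, p} = \<sigma>"
        by (rule span_hyperbolic_inter_perp[OF \<sigma>(1,4) s(4) p(3,2)])
      have sp: "s \<in> ?\<tau>" "p \<in> ?\<tau>"
        by (auto intro: span_base)
      have "dim ?\<tau> = dim \<sigma> + 2" "radical ?\<tau> = {0}"
        using hyperbolic_split[OF subspace_span sp s(4) p(3) fs] \<sigma>(2) unfolding eq
        by (simp_all add: nondegenerate_def)
      moreover have "?\<tau> \<subseteq> V"
        using s(1) p(1) \<sigma>(3) by (intro span_minimal subV) auto
      moreover have "?\<tau> \<inter> Z = {0}"
      proof -
        have "v \<in> \<sigma>" if "v \<in> ?\<tau>" "v \<in> Z" for v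
          using that ZV' eq unfolding V'_def by blast
        then show ?thesis
          using \<sigma>(5) span_zero[of "insert s (insert p \<sigma>)"] by auto
      qed
      ultimately show "?\<tau> \<in> C z"
        using \<sigma> V'(2) sp by (auto simp: C_def complements_def nondegenerate_def p_def simp del: dim_span)
    qed
    also have "\<dots> = g"
      using complement_sum_nondegenerate[OF E, of V' Z] g[OF V'(1) ZV' V'(2,3)] by simp
    finally show ?thesis .
  qed
  have "(\<Sum>\<sigma>\<in>(\<Union>z\<in>Z. C z). E \<sigma>) = (\<Sum>z\<in>Z. sum E (C z))"
    using disj by (intro sum.UNION_disjoint) auto
  then show ?thesis
    unfolding un using each card_subspace[OF Z(1)] by simp
qed


text \<open>
  A non-degenerate complement \<open>\<sigma>\<close> of \<open>Y\<close> in \<open>y\<^sup>\<perp>\<close> does not contain \<open>y\<close>, so it contains \<open>y - t\<close> for a unique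
  non-zero \<open>t\<close> in \<open>Y\<close>.
\<close>

lemma complement_sum_isotropic_perp:
  assumes E: "admissible E" and V: "nondegenerate V"
    and Y: "subspace Y" "Y \<subseteq> V" "\<forall>x\<in>Y. Q x = 0"
    and y: "y \<in> V" "y \<in> perp Y" "y \<notin> Y" "Q y = 0"
    and g: "\<And>V' Z. nondegenerate V' \<Longrightarrow> subspace Z \<Longrightarrow> Z \<subseteq> V' \<Longrightarrow> \<forall>x\<in>Z. Q x = 0 \<Longrightarrow>
      dim V = dim V' + 4 \<Longrightarrow> dim Y = dim Z + 1 \<Longrightarrow> sign V' = sign V \<Longrightarrow>
      complement_sum E V' Z = g"
  shows "complement_sum E (V \<inter> perp {y}) Y
    = (q ^ dim Y - 1) * (q ^ (dim V - dim Y - 2) * (q ^ (dim Y - 1) * g))"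
proof -
  note subV = nondegenerateD(1)[OF V]
  have y0: "y \<noteq> 0"
    using y(3) subspace_0[OF Y(1)] by auto
  define U where "U = V \<inter> perp {y}"
  have U: "subspace U" "dim V = dim U + 1" "Y \<subseteq> U" "y \<in> U"
    using dim_perp_singleton[OF V y(1) y0] y Y(2) subV
    by (auto simp: U_def mem_perp_iff form_sym[of _ y] intro: subspace_inter subspace_perp
        simp flip: quadratic_form)
  have yU: "f y x = 0" "f x y = 0" if "x \<in> U" for x
    using that by (auto simp: U_def mem_perp_iff form_sym[of y])
  define A where "A t = {\<sigma> \<in> complements U Y. nondegenerate \<sigma> \<and> y - t \<in> \<sigma>}" for t
  have un: "{\<sigma> \<in> complements U Y. nondegenerate \<sigma>} = (\<Union>t\<in>Y - {0}. A t)"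
  proof (intro set_eqI iffI)
    fix \<sigma> assume \<sigma>: "\<sigma> \<in> {\<sigma> \<in> complements U Y. nondegenerate \<sigma>}"
    then have "y \<in> span (\<sigma> \<union> Y)"
      using span_complement[OF _ Y(1) U(3,1)] U(4) by simp
    then obtain s t where st: "s \<in> \<sigma>" "t \<in> Y" "y = s + t"
      using \<sigma> Y(1) by (auto simp: span_Un span_eq_iff[THEN iffD2] complements_def)
    have "t \<noteq> 0"
    proof
      assume "t = 0"
      then have "y \<in> \<sigma>"
        using st by simp
      then have "y = 0"
        using \<sigma> yU by (auto simp: complements_def intro!: nondegenerateD(2)[of \<sigma>])
      then show False
        using y0 by simp
    qed
    then show "\<sigma> \<in> (\<Union>t\<in>Y - {0}. A t)"
      using \<sigma> st by (auto simp: A_def intro!: bexI[of _ t])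
  qed (auto simp: A_def)
  have disjA: "A t \<inter> A t' = {}" if "t \<in> Y" "t' \<in> Y" "t \<noteq> t'" for t t'
  proof (rule ccontr)
    assume "A t \<inter> A t' \<noteq> {}"
    then obtain \<sigma> where \<sigma>: "subspace \<sigma>" "\<sigma> \<inter> Y = {0}" "y - t \<in> \<sigma>" "y - t' \<in> \<sigma>"
      by (auto simp: A_def complements_def)
    then have "t' - t \<in> \<sigma>"
      using subspace_diff[of \<sigma> "y - t" "y - t'"] by simp
    then have "t' - t \<in> \<sigma> \<inter> Y"
      using that Y(1) by (simp add: subspace_diff)
    then show False
      using \<sigma>(2) that(3) by simp
  qed
  have sumA: "sum E (A t) = q ^ (dim V - dim Y - 2) * (q ^ (dim Y - 1) * g)" if t: "t \<in> Y" "t \<noteq> 0" for t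
  proof -
    obtain Z where Z: "subspace Z" "Z \<subseteq> Y" "t \<notin> Z" "Y = span (insert t Z)" "dim Y = dim Z + 1"
      by (rule exists_complement_insert[OF Y(1) t])
    have Yo: "f a b = 0" if "a \<in> Y" "b \<in> Y" for a b
      by (rule isotropic_orthogonal[OF Y(1,3) that])
    define s where "s = y - t"
    have sV: "s \<in> V" and sperp: "s \<in> perp Y" and Qs: "Q s = 0" and sY: "s \<notin> Y"
    proof -
      show "s \<in> V"
        using y(1) t(1) Y(2) subV by (auto simp: s_def intro: subspace_diff)
      show "s \<in> perp Y"
        using y(2) Yo t by (auto simp: s_def mem_perp_iff f_simps)
      show "Q s = 0"
        using y(2,4) t(1) Y(3) by (simp add: s_def Q_diff mem_perp_iff)
      show "s \<notin> Y"
        using y(3) subspace_add[OF Y(1) _ t(1), of s] by (auto simp: s_def)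
    qed
    \<comment> \<open>A vector orthogonal to \<sigma> and \<open>Z\<close> with value 1 at
      \<open>t\<close> also has value 1 at \<open>y\<close>, because \<open>y - t\<close> lies in
      \<sigma>. It is determined up to multiples of \<open>y\<close>, and isotropy singles out one
      of these. So each \<sigma> singles out one hyperbolic pair \<open>y\<close>, \<open>w\<close>,
      and is a complement of the smaller \<open>Z\<close> in the orthogonal space of that
      pair.\<close>
    define I where "I = {w \<in> V \<inter> perp Z. f w t = 1 \<and> f w y = 1 \<and> Q w = 0}"
    define B where "B w = {\<sigma> \<in> complements (V \<inter> perp {y, w}) Z. nondegenerate \<sigma> \<and> s \<in> \<sigma>}" for w
    have spU: "span (\<sigma> \<union> Y) = U" if "\<sigma> \<in> complements U Y" for \<sigma>
      by (rule span_complement[OF that Y(1) U(3,1)])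
    have V1: "nondegenerate (V \<inter> perp {y, w})" "dim V = dim (V \<inter> perp {y, w}) + 2"
      "sign (V \<inter> perp {y, w}) = sign V" if "w \<in> I" for w
      using nondegenerate_hyperbolic_split[OF V y(1), of w] hyperbolic_split[OF subV y(1), of w] y(4) that
      by (auto simp: I_def form_sym[of y])
    have AB: "A t = (\<Union>w\<in>I. B w)"
    proof (intro set_eqI iffI)
      fix \<sigma> assume "\<sigma> \<in> A t"
      then have \<sigma>: "\<sigma> \<in> complements U Y" "nondegenerate \<sigma>" "s \<in> \<sigma>" "subspace \<sigma>" "\<sigma> \<subseteq> U"
          "\<sigma> \<inter> Y = {0}" "dim \<sigma> + dim Y = dim U"
        by (auto simp: A_def s_def complements_def)
      have "t \<notin> span (\<sigma> \<union> Z)"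
      proof
        assume "t \<in> span (\<sigma> \<union> Z)"
        then obtain a b where ab: "a \<in> \<sigma>" "b \<in> Z" "t = a + b"
          using \<sigma>(4) Z(1) by (auto simp: span_Un span_eq_iff[THEN iffD2])
        then have "a = t - b"
          by simp
        then have "a \<in> \<sigma> \<inter> Y"
          using ab Z(2) subspace_diff[OF Y(1) t(1), of b] by auto
        then show False
          using \<sigma>(6) ab Z(3) by auto
      qed
      moreover have "span (\<sigma> \<union> Z) \<subseteq> V"
        using \<sigma>(5) Z(2) Y(2) by (intro span_minimal subV) (auto simp: U_def)
      ultimately obtain w0 where w0: "w0 \<in> V" "w0 \<in> perp (span (\<sigma> \<union> Z))" "f w0 t = 1"
        using exists_dual_vector[OF V subspace_span, of "\<sigma> \<union> Z" t] t(1) Y(2) by blast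
      then have w0': "f w0 a = 0" if "a \<in> \<sigma> \<or> a \<in> Z" for a
        using that by (auto simp: perp_span mem_perp_iff)
      have w0y: "f w0 y = 1"
        using w0'[of s] \<sigma>(3) w0(3) by (simp add: s_def f_simps)
      \<comment> \<open>Multiples of \<open>y\<close> change no value on \<open>U\<close>, and this
        one makes \<open>w\<close> isotropic because \<open>f w0 y = 1\<close>.\<close>
      define w where "w = w0 - scale (Q w0 / 2) y"
      have fw: "f w a = f w0 a" if "a \<in> U" for a
        using yU[OF that] by (simp add: w_def f_simps)
      have "Q w = Q w0 - 2 * (Q w0 / 2)"
        using y(4) w0y by (simp add: w_def Q_diff Q_scale f_simps)
      then have "Q w = 0"
        by (simp only: double_half) simp
      moreover have "w \<in> V"
        using w0(1) y(1) subV by (auto simp: w_def intro!: subspace_diff subspace_scale)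
      moreover have "w \<in> perp Z" "f w t = 1" "f w y = 1"
        using fw w0' w0(3) w0y U(3,4) Z(2) t(1) by (auto simp: mem_perp_iff)
      ultimately have wI: "w \<in> I"
        by (simp add: I_def)
      have "\<sigma> \<subseteq> V \<inter> perp {y, w}"
      proof
        fix x assume x: "x \<in> \<sigma>"
        then have "x \<in> U" "f x y = 0" "f x w = 0"
          using \<sigma>(5) yU(2)[of x] fw[of x] w0'[of x] by (auto simp: form_sym[of x w])
        then show "x \<in> V \<inter> perp {y, w}"
          by (auto simp: U_def mem_perp_iff)
      qed
      then have "\<sigma> \<in> B w"
        using \<sigma> Z V1(2)[OF wI] U(2) subspace_0[OF Z(1)] subspace_0[OF \<sigma>(4)]
        by (auto simp: B_def complements_def)
      then show "\<sigma> \<in> (\<Union>w\<in>I. B w)"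
        using wI by blast
    next
      fix \<sigma> assume "\<sigma> \<in> (\<Union>w\<in>I. B w)"
      then obtain w where w: "w \<in> I" "\<sigma> \<in> B w"
        by blast
      then have \<sigma>: "nondegenerate \<sigma>" "s \<in> \<sigma>" "subspace \<sigma>" "\<sigma> \<subseteq> V \<inter> perp {y, w}"
          "\<sigma> \<inter> Z = {0}" "dim \<sigma> + dim Z = dim (V \<inter> perp {y, w})"
        by (auto simp: B_def complements_def)
      have "v = 0" if v: "v \<in> \<sigma>" "v \<in> Y" for v
      proof -
        obtain c where c: "v - scale c t \<in> Z"
          using v(2) Z(4) mem_span_insert[OF Z(1)] by blast
        then have "f w (v - scale c t) = 0"
          using w(1) by (simp add: I_def mem_perp_iff)
        moreover have "f w v = 0"
          using v(1) \<sigma>(4) by (auto simp: mem_perp_iff form_sym[of w])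
        ultimately have "c = 0"
          using w(1) by (simp add: f_simps I_def)
        then show ?thesis
          using c v(1) \<sigma>(5) by auto
      qed
      then have "\<sigma> \<inter> Y = {0}"
        using subspace_0[OF \<sigma>(3)] subspace_0[OF Y(1)] by blast
      moreover have "\<sigma> \<subseteq> U"
        using \<sigma>(4) perp_insert[of y "{w}"] by (auto simp: U_def)
      ultimately show "\<sigma> \<in> A t"
        using \<sigma> V1(2)[OF w(1)] U(2) Z(5) by (auto simp: A_def complements_def s_def)
    qed
    have disjB: "B w \<inter> B w' = {}" if w: "w \<in> I" "w' \<in> I" "w \<noteq> w'" for w w'
    proof (rule ccontr)
      assume "B w \<inter> B w' \<noteq> {}"
      then obtain \<sigma> where \<sigma>: "\<sigma> \<in> B w" "\<sigma> \<in> B w'"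
        by blast
      then have "\<sigma> \<in> A t"
        using AB w(1) by blast
      then have sp: "span (\<sigma> \<union> Y) = U"
        by (intro spU) (simp add: A_def)
      \<comment> \<open>The difference of two candidates is orthogonal to \<open>U\<close>, the
        orthogonal space of \<open>y\<close> in \<open>V\<close>, so it is a multiple
        \<open>c\<close> of \<open>y\<close>. Comparing norms gives \<open>Q w = 2 * c\<close>,
        which forces \<open>c = 0\<close>.\<close>
      define d where "d = w - w'"
      have ker: "subspace {v. f d v = 0}"
        by (auto simp: subspace_def f_add_right f_scale_right)
      have "Y \<subseteq> {v. f d v = 0}"
        unfolding Z(4) using w by (intro span_minimal ker) (auto simp: I_def d_def f_simps mem_perp_iff)
      moreover have "f d v = 0" if "v \<in> \<sigma>" for v
      proof -
        have "f v w = 0" "f v w' = 0"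
          using that \<sigma> by (auto simp: B_def complements_def mem_perp_iff)
        then show ?thesis
          by (simp add: d_def f_simps form_sym[of _ v])
      qed
      ultimately have "U \<subseteq> {v. f d v = 0}"
        unfolding sp[symmetric] by (intro span_minimal ker) auto
      then have "d \<in> V \<inter> perp (V \<inter> perp (span {y}))"
        using w subV by (auto simp: d_def I_def mem_perp_iff U_def perp_span intro: subspace_diff)
      then have "d \<in> span {y}"
        using perp_perp[OF V subspace_span, of "{y}"] y(1) span_minimal[OF _ subV, of "{y}"] by simp
      then obtain c where "d = scale c y"
        by (auto simp: span_singleton)
      then have wc: "w = w' + scale c y"
        by (simp add: d_def algebra_simps)
      have "Q w = 2 * c"
        using w(2) y(4) unfolding wc by (simp add: I_def Q_add Q_scale f_simps)
      then have "c = 0"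
        using w(1) two_neq_zero by (simp add: I_def)
      then show False
        using wc w(3) by simp
    qed
    \<comment> \<open>The second hyperbolic plane, through \<open>s\<close>, is split off inside the
      orthogonal space of the first; together they account for the drop of the dimension by
      4.\<close>
    have sumB: "sum E (B w) = q ^ (dim Y - 1) * g" if w: "w \<in> I" for w
    proof -
      have "Z \<subseteq> V \<inter> perp {y, w}"
        using Z(2) Y(2) U(3) w yU by (auto simp: I_def mem_perp_iff form_sym[of _ w])
      moreover have "s \<in> V \<inter> perp {y, w}"
        using sV w y(2,4) t(1) by (auto simp: s_def I_def mem_perp_iff f_simps form_sym[of _ w] form_sym[of t y] simp flip: quadratic_form)
      moreover have "s \<in> perp Z" "s \<notin> Z" "\<forall>x\<in>Z. Q x = 0"
        using sperp sY Z(2) Y(3) by (auto simp: mem_perp_iff)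
      ultimately have "sum E (B w) = q ^ dim Z * g"
        unfolding B_def using V1[OF w] Z Y(3) Qs
        by (intro sum_complements_through_isotropic[OF E] g) auto
      then show ?thesis
        using Z(5) by simp
    qed
    have cardI: "real (card I) = q ^ (dim V - dim Y - 2)"
    proof -
      \<comment> \<open>Given \<open>f w y = 1\<close>, the condition \<open>f w t = 1\<close> says
        that \<open>f w s = 0\<close>. Thus \<open>I\<close> is the isotropic level of an affine
        hyperplane in \<open>V \<inter> perp X\<close>.\<close>
      define X where "X = span (insert s Z)"
      have sZ: "s \<notin> Z"
        using sY Z(2) by blast
      have X: "subspace X" "X \<subseteq> V" "dim X = dim Y"
        using span_minimal[OF _ subV, of "insert s Z"] sV Z(2) Y(2) dim_span_insert[OF Z(1) sZ] Z(5)
        by (auto simp: X_def)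
      have yX: "y \<notin> X"
      proof
        assume "y \<in> X"
        then obtain c where c: "y - scale c s \<in> Z"
          using mem_span_insert[OF Z(1)] by (auto simp: X_def)
        have eq: "y - scale c s = scale (1 - c) y + scale c t"
          by (simp add: s_def scale_right_diff_distrib scale_left_diff_distrib)
        then have "scale (1 - c) y + scale c t - scale c t \<in> Y"
          using c Z(2) t(1) Y(1) by (metis subsetD subspace_diff subspace_scale)
        then have *: "scale (1 - c) y \<in> Y"
          by simp
        have "c = 1"
        proof (rule ccontr)
          assume "c \<noteq> 1"
          have "scale (1 / (1 - c)) (scale (1 - c) y) \<in> Y"
            by (rule subspace_scale[OF Y(1) *])
          then show False
            using \<open>c \<noteq> 1\<close> y(3) by (simp only: scale_scale) simp
        qed
        then show False
          using eq c Z(3) by simp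
      qed
      have yperp: "y \<in> perp X"
        using y(2,4) Z(2) t(1) unfolding X_def perp_span
        by (auto simp: mem_perp_iff s_def f_simps simp flip: quadratic_form)
      obtain y1 where y1: "y1 \<in> V" "y1 \<in> perp X" "f y1 y = 1" "Q y1 = 0"
        by (rule exists_isotropic_dual_vector[OF V X(1,2) y(1) yX y(4) yperp])
      define W where "W = V \<inter> perp X"
      have "I = {w \<in> W. f w y = 1 \<and> Q w = 0}"
        unfolding W_def X_def perp_span by (auto simp: I_def s_def mem_perp_iff f_simps)
      moreover have "real (card {w \<in> W. f w y = 1 \<and> Q w = 0}) = q ^ (dim W - 2)"
        by (rule card_level_affine[of W y y1])
          (use y y1 yperp subV in \<open>auto simp: W_def intro: subspace_inter subspace_perp\<close>)
      moreover have "dim W = dim V - dim Y"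
        using dim_perp[OF V X(1,2)] X(3) by (simp add: W_def)
      ultimately show ?thesis
        by simp
    qed
    have "sum E (A t) = (\<Sum>w\<in>I. sum E (B w))"
      unfolding AB using disjB by (intro sum.UNION_disjoint) auto
    then show ?thesis
      using sumB cardI by simp
  qed
  have "complement_sum E U Y = sum E (\<Union>t\<in>Y - {0}. A t)"
    by (simp add: complement_sum_nondegenerate[OF E] un)
  also have "\<dots> = (\<Sum>t\<in>Y - {0}. sum E (A t))"
    using disjA by (intro sum.UNION_disjoint) auto
  also have "\<dots> = real (card (Y - {0})) * (q ^ (dim V - dim Y - 2) * (q ^ (dim Y - 1) * g))"
    using sumA by simp
  also have "real (card (Y - {0})) = q ^ dim Y - 1"
  proof -
    have "card (Y - {0}) = card Y - 1"
      using subspace_0[OF Y(1)] by simp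
    moreover have "card Y \<ge> 1"
      using subspace_0[OF Y(1)] by (metis One_nat_def Suc_leI card_gt_0_iff empty_iff finite)
    ultimately show ?thesis
      using card_subspace[OF Y(1)] by (simp add: of_nat_diff)
  qed
  finally show ?thesis
    by (simp add: U_def)
qed

section \<open>Evaluation of the sums over complements\<close>

definition nondeg_weight :: "'v set \<Rightarrow> real" where
  "nondeg_weight \<sigma> = (if nondegenerate \<sigma> then 1 else 0)"

definition sign_weight :: "'v set \<Rightarrow> real" where
  "sign_weight \<sigma> = (if nondegenerate \<sigma> then sign \<sigma> else 0)"

lemma sign_reflection:
  assumes "Q u \<noteq> 0" and "subspace \<sigma>"
  shows "sign (reflection u ` \<sigma>) = sign \<sigma>"
proof (rule sign_unique)
  have inj: "inj_on (reflection u) A" for A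
    using inj_reflection[OF assms(1)] by (rule inj_on_subset) simp
  have "{v \<in> reflection u ` \<sigma>. Q v = c} = reflection u ` {v \<in> \<sigma>. Q v = c}" for c
    using assms(1) by auto
  then have "level_count (reflection u ` \<sigma>) c = level_count \<sigma> c" for c
    by (simp add: level_count_def card_image[OF inj])
  moreover have "dim (radical (reflection u ` \<sigma>)) = dim (radical \<sigma>)"
    using dim_reflection[OF assms(1) subspace_radical[OF assms(2)]]
    by (simp add: radical_reflection[OF assms(1)])
  moreover have "rank (reflection u ` \<sigma>) = rank \<sigma>"
    using calculation dim_reflection[OF assms] by (simp add: rank_def)
  ultimately show "has_sign (reflection u ` \<sigma>) (sign \<sigma>)"
    using has_sign_sign[OF assms(2)] by (simp add: has_sign_def)
qed

lemma nondegenerate_reflection: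
  assumes "Q u \<noteq> 0" and "subspace \<sigma>"
  shows "nondegenerate (reflection u ` \<sigma>) \<longleftrightarrow> nondegenerate \<sigma>"
proof -
  have "reflection u ` radical \<sigma> = {0} \<longleftrightarrow> radical \<sigma> = {0}"
  proof
    assume "reflection u ` radical \<sigma> = {0}"
    then have "reflection u ` reflection u ` radical \<sigma> = {reflection u 0}"
      by simp
    then show "radical \<sigma> = {0}"
      using assms(1) by (simp add: image_image reflection_def[of u 0])
  qed (simp add: reflection_def)
  then show ?thesis
    using assms subspace_reflection[OF assms]
    by (simp add: nondegenerate_def radical_reflection[OF assms(1)])
qed

lemma admissible_nondeg_weight: "admissible nondeg_weight"
proof -
  have "nondegenerate (\<sigma> \<inter> perp {s, p})"
    if "nondegenerate \<sigma>" "s \<in> \<sigma>" "p \<in> \<sigma>" "Q s = 0" "Q p = 0" "f p s = 1" for \<sigma> s p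
    using nondegenerate_hyperbolic_split[OF that(1-5)] that(6) by (simp add: form_sym[of s p])
  then show ?thesis
    unfolding admissible_def reflection_invariant_def nondeg_weight_def
    by (simp add: nondegenerate_reflection)
qed

lemma admissible_sign_weight: "admissible sign_weight"
proof -
  have "nondegenerate (\<sigma> \<inter> perp {s, p}) \<and> sign \<sigma> = sign (\<sigma> \<inter> perp {s, p})"
    if "nondegenerate \<sigma>" "s \<in> \<sigma>" "p \<in> \<sigma>" "Q s = 0" "Q p = 0" "f p s = 1" for \<sigma> s p
    using nondegenerate_hyperbolic_split[OF that(1-5)] that(6)
      hyperbolic_split(5)[OF nondegenerateD(1)[OF that(1)] that(2-5)] by (simp add: form_sym[of s p])
  then show ?thesis
    unfolding admissible_def reflection_invariant_def sign_weight_def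
    by (simp add: nondegenerate_reflection sign_reflection)
qed

text \<open>The second letter stands for the parity of \<open>i + d\<close>, not of
  \<open>i\<close>: for odd \<open>d\<close> an even \<open>i\<close> leads to \<open>oo\<close> and
  an odd \<open>i\<close> to \<open>oe\<close>.\<close>

definition total_count :: "nat \<Rightarrow> nat \<Rightarrow> nat \<Rightarrow> real \<Rightarrow> real" where
  "total_count i d K u =
     (if even d
      then if even i then total_ee q (int (i div 2)) (int (d div 2)) (int K)
        else total_eo q (int (i div 2)) (int (d div 2)) (int K)
      else if even i then total_oo q (int (i div 2)) (int (d div 2)) (int K) u
        else total_oe q (int (i div 2)) (int (d div 2)) (int K))"

definition signed_count :: "nat \<Rightarrow> nat \<Rightarrow> nat \<Rightarrow> real \<Rightarrow> real \<Rightarrow> real" where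
  "signed_count i d K b a =
     (if even d
      then if even i then signed_ee q (int (i div 2)) (int (d div 2)) (int K) b a
        else signed_eo q (int (i div 2)) (int (d div 2)) (int K) b
      else if even i then signed_oo q (int (i div 2)) (int (d div 2)) (int K)
        else signed_oe q (int (i div 2)) (int (d div 2)) (int K) a)"

lemma sign_perp_singleton:
  assumes "nondegenerate V" and "y \<in> V" and "Q y \<noteq> 0" and "dim V = Suc n"
  shows "sign (V \<inter> perp {y}) = sign V * qchar (if even n then Q y else - Q y)"
proof -
  note s = anisotropic_split[OF nondegenerateD(1)[OF assms(1)] assms(2,3)]
  have "rank (V \<inter> perp {y}) = n"
    using s(6) assms(4) by (simp add: rank_nondegenerate[OF assms(1)])
  then have "sign V = sign (V \<inter> perp {y}) * qchar (if even n then Q y else - Q y)"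
    using sign_step[OF nondegenerateD(1)[OF assms(1)] assms(2,3)] by simp
  moreover have "qchar (if even n then Q y else - Q y) * qchar (if even n then Q y else - Q y) = 1"
    using assms(3) by (simp add: qchar_mult_self)
  ultimately show ?thesis
    by (simp add: mult.assoc)
qed

lemma dim_isotropic_le:
  assumes "nondegenerate V" and "subspace X" and "X \<subseteq> V"
  shows "dim (radical X) + dim X \<le> dim V"
proof -
  have "radical X \<subseteq> V \<inter> perp X"
    using assms(3) by (auto simp: radical_eq)
  then have "dim (radical X) \<le> dim (V \<inter> perp X)"
    by (rule dim_subset)
  then show ?thesis
    using dim_perp[OF assms] by simp
qed

text \<open>The start of the induction on the rank. There is no anisotropic vector in
  \<open>X\<close> to split off, so the contribution of the degenerate hyperplane
  \<open>perp {r}\<close> has to be computed; this is where dimension \<open>i - 1\<close> enters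
  besides \<open>i\<close>.\<close>

lemma complement_sum_totally_isotropic:
  assumes "nondegenerate V" and "subspace X" and "X \<subseteq> V" and "\<forall>x\<in>X. Q x = 0"
    and "dim V = 2 * K + dim X"
  shows "complement_sum nondeg_weight V X = total_count (dim X) 0 K 1 \<and>
    complement_sum sign_weight V X = signed_count (dim X) 0 K 1 (sign V)"
  using assms
proof (induction "dim X" arbitrary: V X K rule: less_induct)
  case less
  note V = less.prems(1) and X = less.prems(2,3,4) and dV = less.prems(5)
  note subV = nondegenerateD(1)[OF V]
  show ?case
  proof (cases "dim X = 0")
    case True
    then have "X = {0}"
      using X(1) subspace_0 by auto
    have "S = V" if "subspace S" "S \<subseteq> V" "dim S = dim V" for S
      using subspace_dim_equal[OF that(1) subV that(2)] that(3) by simp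
    then have "complements V X = {V}"
      unfolding \<open>X = {0}\<close> complements_def using subV subspace_0[OF subV] subspace_0 by auto
    then show ?thesis
      unfolding True using V
      by (simp add: complement_sum_def nondeg_weight_def sign_weight_def total_count_def
          signed_count_def total_ee_0[OF q_gt_1] signed_ee_0[OF q_gt_1] chi_empty)
  next
    case False
    then obtain r where r: "r \<in> X" "r \<noteq> 0"
      by (metis dim_eq_0 singletonI subset_iff)
    obtain Y where Y: "subspace Y" "Y \<subseteq> X" "r \<notin> Y" "X = span (insert r Y)" "dim X = dim Y + 1"
      by (rule exists_complement_insert[OF X(1) r])
    have Yiso: "\<forall>x\<in>Y. Q x = 0" and YV: "Y \<subseteq> V"
      using Y(2) X by auto
    have rV: "r \<in> V" "Q r = 0"
      using r(1) X by auto
    have rY: "r \<in> perp Y"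
      using isotropic_orthogonal[OF X(1,3) r(1)] Y(2) by (auto simp: mem_perp_iff)
    define i where "i = dim Y"
    have dX: "dim X = Suc i"
      using Y(5) by (simp add: i_def)
    \<comment> \<open>The bound on totally isotropic subspaces guarantees that \<open>K - 1\<close>
      and \<open>2 * K - 1\<close> below are not truncated.\<close>
    have K: "K \<ge> 1"
    proof -
      have "radical X = X"
        using isotropic_orthogonal[OF X(1,3)] by (auto simp: radical_def)
      then show ?thesis
        using dim_isotropic_le[OF V X(1,2)] dV dX by simp
    qed
    have aniso: "complement_sum nondeg_weight (V \<inter> perp {y}) Y = total_count i 0 K 1 \<and>
        complement_sum sign_weight (V \<inter> perp {y}) Y
          = signed_count i 0 K 1 (sign V * qchar (if even i then Q y else - Q y))"
      if y: "y \<in> V" "y \<in> perp Y" "Q y \<noteq> 0" for y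
    proof -
      have "nondegenerate (V \<inter> perp {y})"
        by (rule nondegenerate_anisotropic_split[OF V y(1,3)])
      moreover have "Y \<subseteq> V \<inter> perp {y}"
        using YV y(2) by (auto simp: mem_perp_iff form_sym[of _ y])
      moreover have "dim (V \<inter> perp {y}) = 2 * K + i"
        using anisotropic_split(4)[OF subV y(1,3)] dV dX by simp
      ultimately have "complement_sum nondeg_weight (V \<inter> perp {y}) Y = total_count i 0 K 1 \<and>
        complement_sum sign_weight (V \<inter> perp {y}) Y = signed_count i 0 K 1 (sign (V \<inter> perp {y}))"
        using less.hyps[of Y "V \<inter> perp {y}" K] Y(1,5) Yiso by (simp add: i_def)
      moreover have "sign (V \<inter> perp {y}) = sign V * qchar (if even i then Q y else - Q y)"
        using sign_perp_singleton[OF V y(1,3), of "2 * K + i"] dV dX by simp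
      ultimately show ?thesis
        by simp
    qed
    have smaller: "complement_sum nondeg_weight V' Z = total_count (i - 1) 0 (K - 1) 1 \<and>
        complement_sum sign_weight V' Z = signed_count (i - 1) 0 (K - 1) 1 (sign V)"
      if "nondegenerate V'" "subspace Z" "Z \<subseteq> V'" "\<forall>x\<in>Z. Q x = 0"
        "dim V = dim V' + 4" "dim Y = dim Z + 1" "sign V' = sign V" for V' Z
      using less.hyps[of Z V' "K - 1"] that dV dX Y(5) K by (auto simp: i_def)
    have exps: "dim V - i - 2 = 2 * K - 1" "dim Y = i"
      using dV dX by (simp_all add: i_def)
    have rec: "complement_sum E V X = q ^ (2 * K - 1) * ((q - 1) * a
        + (q ^ i - 1) * (q ^ (2 * K - 1) * (q ^ (i - 1) * g)))"
      if E: "admissible E"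
        and a: "\<And>y. y \<in> V \<Longrightarrow> y \<in> perp Y \<Longrightarrow> Q y \<noteq> 0 \<Longrightarrow>
          complement_sum E (V \<inter> perp {y}) Y = a + b * qchar (Q y)"
        and g: "\<And>V' Z. nondegenerate V' \<Longrightarrow> subspace Z \<Longrightarrow> Z \<subseteq> V' \<Longrightarrow> \<forall>x\<in>Z. Q x = 0 \<Longrightarrow>
          dim V = dim V' + 4 \<Longrightarrow> dim Y = dim Z + 1 \<Longrightarrow> sign V' = sign V \<Longrightarrow>
          complement_sum E V' Z = g"
      for E a b g
    proof -
      have "reflection_invariant E"
        using E by (simp add: admissible_def)
      then have "complement_sum E V X
        = q ^ (dim V - dim Y - 2) * ((q - 1) * a + complement_sum E (V \<inter> perp {r}) Y)"
        unfolding Y(4) using a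
        by (intro complement_sum_insert_isotropic[OF _ V Y(1) YV rV(1) rY Y(3) rV(2)])
      also have "complement_sum E (V \<inter> perp {r}) Y
        = (q ^ dim Y - 1) * (q ^ (dim V - dim Y - 2) * (q ^ (dim Y - 1) * g))"
        by (rule complement_sum_isotropic_perp[OF E V Y(1) YV Yiso rV(1) rY Y(3) rV(2)]) (rule g)
      finally show ?thesis
        unfolding exps .
    qed
    have qK: "q ^ (2 * K - 1) = q powi (2 * int K - 1)"
      using K power_int_of_nat[of q "2 * K - 1"] by (simp add: of_nat_diff)
    have intK: "int (K - 1) = int K - 1"
      using K by (simp add: of_nat_diff)
    \<comment> \<open>For \<open>i = 0\<close> the index \<open>i - 1\<close> is truncated, but then
      the factor \<open>q ^ i - 1\<close> is zero. The number of complements does not depend on the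
      sign of the hyperplane, hence \<open>b = 0\<close>.\<close>
    have T: "complement_sum nondeg_weight V X = q ^ (2 * K - 1) * ((q - 1) * total_count i 0 K 1
        + (q ^ i - 1) * (q ^ (2 * K - 1) * (q ^ (i - 1) * total_count (i - 1) 0 (K - 1) 1)))"
      using aniso smaller by (intro rec[where b = 0] admissible_nondeg_weight) auto
    show ?thesis
    proof (cases "even i")
      case True
      then obtain I where I: "i = 2 * I"
        by (rule evenE)
      \<comment> \<open>The signed sum is linear in the sign of the ambient space, and the sign of a
        hyperplane carries the factor \<open>qchar (Q y)\<close>; so its constant part
        \<open>a\<close> is 0.\<close>
      have lin: "signed_count i 0 K 1 (x * y) = 0 + signed_count i 0 K 1 x * y" for x y
        by (simp add: signed_count_def I signed_ee_0[OF q_gt_1])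
      have S: "complement_sum sign_weight V X = q ^ (2 * K - 1) * ((q - 1) * 0
        + (q ^ i - 1) * (q ^ (2 * K - 1) * (q ^ (i - 1) * signed_count (i - 1) 0 (K - 1) 1 (sign V))))"
        by (intro rec[where b = "signed_count i 0 K 1 (sign V)"] admissible_sign_weight)
          (use aniso smaller True lin in auto)
      have "complement_sum nondeg_weight V X = total_eo q (int I) 0 (int K)"
      proof (cases "I = 0")
        case True
        then show ?thesis
          unfolding T total_eo_base[OF q_gt_1 of_nat_0_le_iff] using I qK
          by (simp add: total_count_def)
      next
        case False
        then have "total_count (i - 1) 0 (K - 1) 1 = total_eo q (int I - 1) 0 (int K - 1)"
          using I intK by (cases I) (simp_all add: total_count_def)
        moreover have "q ^ (i - 1) = q powi (2 * int I - 1)"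
          using False I power_int_of_nat[of q "i - 1"] by (simp add: of_nat_diff)
        moreover have "q ^ i = q powi (2 * int I)"
          using I power_int_of_nat[of q i] by simp
        ultimately show ?thesis
          unfolding T total_eo_base[OF q_gt_1 of_nat_0_le_iff] using I qK
          by (simp add: total_count_def)
      qed
      moreover have "complement_sum sign_weight V X = 0"
      proof (cases "I = 0")
        case True
        then show ?thesis
          unfolding S using I by simp
      next
        case False
        then have "odd (i - 1)"
          using I by simp
        then show ?thesis
          unfolding S by (simp add: signed_count_def signed_eo_0[OF q_gt_1])
      qed
      ultimately show ?thesis
        unfolding dX using True I by (simp add: total_count_def signed_count_def signed_eo_0[OF q_gt_1])
    next
      case False
      then obtain I where I: "i = 2 * I + 1"
        by (rule oddE)
      have z: "signed_count i 0 K 1 x = 0" for x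
        by (simp add: signed_count_def I signed_eo_0[OF q_gt_1])
      have S: "complement_sum sign_weight V X = q ^ (2 * K - 1) * ((q - 1) * 0
        + (q ^ i - 1) * (q ^ (2 * K - 1) * (q ^ (i - 1) * signed_count (i - 1) 0 (K - 1) 1 (sign V))))"
        by (intro rec[where b = 0] admissible_sign_weight) (use aniso smaller z in auto)
      have qi: "q ^ i = q powi (2 * (int I + 1) - 1)" "q ^ (i - 1) = q powi (2 * (int I + 1) - 2)"
        using I power_int_of_nat[of q i] power_int_of_nat[of q "i - 1"] by simp_all
      have "complement_sum nondeg_weight V X = total_ee q (int I + 1) 0 (int K)"
        unfolding T total_ee_base[OF q_gt_1, of "int I + 1", simplified] using I qK qi intK
        by (simp add: total_count_def)
      moreover have "complement_sum sign_weight V X = signed_ee q (int I + 1) 0 (int K) 1 (sign V)"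
        unfolding S signed_ee_base[OF q_gt_1, of "int I + 1", simplified] using I qK qi intK
        by (simp add: signed_count_def)
      ultimately show ?thesis
        unfolding dX using False I by (simp add: total_count_def signed_count_def add.commute)
    qed
  qed
qed


lemma exists_anisotropic:
  assumes "subspace X" and "rank X \<noteq> 0"
  obtains v where "v \<in> X" and "Q v \<noteq> 0"
proof (rule ccontr)
  assume "\<not> thesis"
  then have "\<forall>x\<in>X. Q x = 0"
    using that by blast
  then have "radical X = X"
    using isotropic_orthogonal[OF assms(1)] by (auto simp: radical_def)
  then show False
    using assms(2) by (simp add: rank_def)
qed

text \<open>Separates the value into the constant \<open>a\<close> and the coefficient
  \<open>b\<close> of \<open>qchar (Q y)\<close> in the recursion, the sign of a hyperplane being a
  fixed sign times this character.\<close>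

lemma total_oo_affine: "total_oo q I s K u = total_oo q I s K 0 + u * (total_oo q I s K 1 - total_oo q I s K 0)"
  by (simp add: total_oo_def algebra_simps)

lemma signed_ee_affine:
  "signed_ee q I s K b a = signed_ee q I s K b 0 + a * (signed_ee q I s K b 1 - signed_ee q I s K b 0)"
  by (simp add: signed_ee_def algebra_simps)

lemma signed_oe_affine:
  "signed_oe q I s K a = total_oe q I s K * q powi (- K) + a * (total_oe q I s K * q powi (- (I + s + 1)))"
  by (simp add: signed_oe_def algebra_simps)

lemma rank_radical: "subspace X \<Longrightarrow> dim X = rank X + dim (radical X)"
  using dim_subset[of "radical X" X] by (auto simp: rank_def radical_def)

lemma q_powi_diff:
  assumes "n \<le> m"
  shows "x / q ^ (m - n) = x * q powi (int n - int m)"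
proof -
  have "q ^ (m - n) = q powi (int m - int n)"
    using power_int_of_nat[of q "m - n"] assms by (simp add: of_nat_diff)
  then have "q powi (int n - int m) * q ^ (m - n) = 1"
    using powi_mult[OF q_gt_1, of "int n - int m" "int m - int n"] by simp
  then show ?thesis
    by (simp add: field_simps)
qed

text \<open>With \<open>Y\<close> the part of \<open>X\<close> orthogonal to an anisotropic
  \<open>v\<close>, the hyperplanes need the value for \<open>Y\<close> in spaces of dimension one
  less, and the elimination of the degenerate ones needs \<open>span (insert w Y)\<close> in
  \<open>V\<close> itself. Both subspaces have rank \<open>d\<close>, so the rank is the induction
  measure, with \<open>V\<close> and \<open>X\<close> arbitrary. In particular the sums depend only
  on the parameters of \<open>X\<close>.\<close>

theorem complement_sums:
  assumes "nondegenerate V" and "subspace X" and "X \<subseteq> V" and "dim V = 2 * K + dim X"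
  shows "complement_sum nondeg_weight V X
      = total_count (dim (radical X)) (rank X) K (sign V * sign X) \<and>
    complement_sum sign_weight V X = signed_count (dim (radical X)) (rank X) K (sign X) (sign V)"
  using assms
proof (induction "rank X" arbitrary: V X)
  case 0
  have "radical X = X"
  proof (rule subspace_dim_equal)
    show "dim X \<le> dim (radical X)"
      using rank_radical[OF 0(3)] 0(1) by simp
  qed (use 0 in \<open>auto intro: subspace_inter subspace_perp simp: radical_eq\<close>)
  then have iso: "\<forall>x\<in>X. Q x = 0"
    by (auto simp: radical_def quadratic_form)
  show ?case
    using complement_sum_totally_isotropic[OF 0(2,3,4) iso 0(5)] sign_isotropic[OF 0(3) iso]
    unfolding 0(1)[symmetric] \<open>radical X = X\<close> by (simp add: total_count_def)
next
  case (Suc d)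
  note V = Suc.prems(1) and X = Suc.prems(2,3)
  note subV = nondegenerateD(1)[OF V]
  define i where "i = dim (radical X)"
  have dX: "dim X = i + Suc d"
    using rank_radical[OF X(1)] Suc.hyps(2) by (simp add: i_def)
  have dV: "dim V = 2 * K + i + Suc d"
    using Suc.prems(4) dX by simp
  obtain v where v: "v \<in> X" "Q v \<noteq> 0"
    using exists_anisotropic[OF X(1)] Suc.hyps(2) by (metis Zero_not_Suc)
  define z where "z = Q v"
  define Y where "Y = X \<inter> perp {v}"
  note sX = anisotropic_split[OF X(1) v, folded Y_def]
  have rkY: "rank Y = d" and radY: "dim (radical Y) = i" and YV: "Y \<subseteq> V" and vY: "v \<in> perp Y"
    using sX(5,6) Suc.hyps(2) X(2) by (auto simp: i_def Y_def mem_perp_iff form_sym[of _ v])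
  have dY: "dim Y = i + d"
    using rank_radical[OF sX(1)] rkY radY by simp
  have sgX: "sign X = sign Y * qchar (if even d then z else - z)"
    using sign_step[OF X(1) v] rkY by (simp add: Y_def z_def)
  have IH1: "complement_sum nondeg_weight (V \<inter> perp {y}) Y = total_count i d K (sign (V \<inter> perp {y}) * sign Y) \<and>
      complement_sum sign_weight (V \<inter> perp {y}) Y = signed_count i d K (sign Y) (sign (V \<inter> perp {y})) \<and>
      sign (V \<inter> perp {y}) = sign V * qchar (if even (i + d) then Q y else - Q y)"
    if y: "y \<in> V" "y \<in> perp Y" "Q y \<noteq> 0" for y
  proof -
    have "nondegenerate (V \<inter> perp {y})"
      by (rule nondegenerate_anisotropic_split[OF V y(1,3)])
    moreover have "Y \<subseteq> V \<inter> perp {y}"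
      using YV y(2) by (auto simp: mem_perp_iff form_sym[of _ y])
    moreover have "dim (V \<inter> perp {y}) = 2 * K + dim Y"
      using anisotropic_split(4)[OF subV y(1,3)] dV dY by simp
    moreover have "sign (V \<inter> perp {y}) = sign V * qchar (if even (i + d) then Q y else - Q y)"
      using sign_perp_singleton[OF V y(1,3), of "2 * K + i + d"] dV by simp
    ultimately show ?thesis
      using Suc.hyps(1)[of Y "V \<inter> perp {y}"] rkY radY sX(1) by simp
  qed
  have IH2: "complement_sum nondeg_weight V (span (insert w Y)) = total_count (Suc i) d K (sign V * sign Y) \<and>
      complement_sum sign_weight V (span (insert w Y)) = signed_count (Suc i) d K (sign Y) (sign V)"
    if w: "w \<in> V" "w \<in> perp Y" "w \<notin> Y" "Q w = 0" for w
  proof -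
    note e = isotropic_extension[OF sX(1) w(3,2,4)]
    have "span (insert w Y) \<subseteq> V"
      using w(1) YV by (intro span_minimal subV) auto
    moreover have "dim V = 2 * K + dim (span (insert w Y))"
      using e(3) dV dY by simp
    ultimately show ?thesis
      using Suc.hyps(1)[of "span (insert w Y)" V] V rkY radY e by (simp del: dim_span)
  qed
  define u where "u = sign V * sign X"
  have radP: "dim (radical (V \<inter> perp X)) = i"
    using radical_perp[OF V X] by (simp add: i_def)
  \<comment> \<open>The level counts are those of \<open>V \<inter> perp X\<close>. Its rank has the
    parity of \<open>i\<close>, which decides between the even and the odd recursion.\<close>
  have rkP: "rank (V \<inter> perp X) = 2 * K - i" and iK: "i \<le> 2 * K"
    using dim_perp[OF V X] dV dX radP dim_isotropic_le[OF V X] by (auto simp: rank_def i_def)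
  have sgP: "sign (V \<inter> perp X) = u * (if odd i \<and> even d then qchar (- 1 :: 'a) else 1)"
    using sign_perp[OF V X] Suc.hyps(2)[symmetric] rkP iK by (auto simp: u_def)
  have even_rec: "complement_sum E V X = g + u * (q powi (int I + int K) * (a + b * qchar z) - g * q powi (int I - int K))"
    if E: "admissible E" and I: "i = 2 * I"
      and a: "\<And>y. y \<in> V \<Longrightarrow> y \<in> perp Y \<Longrightarrow> Q y \<noteq> 0 \<Longrightarrow> complement_sum E (V \<inter> perp {y}) Y = a + b * qchar (Q y)"
      and g: "\<And>w. w \<in> V \<Longrightarrow> w \<in> perp Y \<Longrightarrow> w \<notin> Y \<Longrightarrow> Q w = 0 \<Longrightarrow> complement_sum E V (span (insert w Y)) = g"
    for E I a b g
  proof -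
    have IK: "I \<le> K" and m: "rank (V \<inter> perp X) = 2 * (K - I)"
      using rkP iK I by auto
    have "complement_sum E V (span (insert v Y)) = g + sign (V \<inter> perp (span (insert v Y))) *
        (q ^ (i + (K - I)) * (a + b * qchar z) - g / q ^ (K - I))"
    proof (rule complement_sum_insert_anisotropic_even[OF _ V sX(1) YV _ vY])
      show "reflection_invariant E"
        using E by (simp add: admissible_def)
      show "dim (radical (V \<inter> perp (span (insert v Y)))) = i" "rank (V \<inter> perp (span (insert v Y))) = 2 * (K - I)"
        using radP m by (simp_all add: sX(3))
    qed (use v X a g z_def in auto)
    moreover have "q ^ (i + (K - I)) = q powi (int I + int K)"
      using power_int_of_nat[of q "i + (K - I)"] I IK by (simp add: of_nat_diff algebra_simps)
    ultimately show ?thesis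
      using q_powi_diff[OF IK] sgP I by (simp add: sX(3))
  qed
  have odd_rec: "complement_sum E V X = g + sign V * sign Y * (g * q powi (int I + 1 - int K) - q powi (int I + int K + 1) * a)
      - sign (V \<inter> perp X) * (q powi (int I + int K) * b)"
    if E: "admissible E" and I: "i = 2 * I + 1"
      and a: "\<And>y. y \<in> V \<Longrightarrow> y \<in> perp Y \<Longrightarrow> Q y \<noteq> 0 \<Longrightarrow> complement_sum E (V \<inter> perp {y}) Y = a + b * qchar (Q y)"
      and g: "\<And>w. w \<in> V \<Longrightarrow> w \<in> perp Y \<Longrightarrow> w \<notin> Y \<Longrightarrow> Q w = 0 \<Longrightarrow> complement_sum E V (span (insert w Y)) = g"
    for E I a b g
  proof -
    have IK: "I + 1 \<le> K" and m: "rank (V \<inter> perp X) = 2 * (K - (I + 1)) + 1"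
      using rkP iK I by auto
    have "complement_sum E V (span (insert v Y)) = g + sign (V \<inter> perp (span (insert v Y))) *
        (qchar (- z) * (g / q ^ (K - (I + 1)) - q ^ (i + (K - (I + 1)) + 1) * a) - q ^ (i + (K - (I + 1))) * b)"
    proof (rule complement_sum_insert_anisotropic_odd[OF _ V sX(1) YV _ vY])
      show "reflection_invariant E"
        using E by (simp add: admissible_def)
      show "dim (radical (V \<inter> perp (span (insert v Y)))) = i"
          "rank (V \<inter> perp (span (insert v Y))) = 2 * (K - (I + 1)) + 1"
        using radP m by (simp_all add: sX(3))
    qed (use v X a g z_def in auto)
    note main = this[unfolded sX(3)]
    have e1: "q ^ (i + (K - (I + 1))) = q powi (int I + int K)"
      using power_int_of_nat[of q "i + (K - (I + 1))"] I IK by (simp add: of_nat_diff algebra_simps)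
    have e2: "q ^ (i + (K - (I + 1)) + 1) = q powi (int I + int K + 1)"
      using power_int_of_nat[of q "i + (K - (I + 1)) + 1"] I IK by (simp add: of_nat_diff algebra_simps)
    have e3: "g / q ^ (K - (I + 1)) = g * q powi (int I + 1 - int K)"
      using q_powi_diff[OF IK, of g] by (simp add: add.commute)
    \<comment> \<open>For even \<open>d\<close> the factor \<open>qchar (- 1)\<close> from the sign
      of the orthogonal complement turns \<open>qchar z\<close> in \<open>sign X\<close> into
      \<open>qchar (- z)\<close>; for odd \<open>d\<close> that character is already there. Either
      way it is squared away.\<close>
    have e4: "sign (V \<inter> perp X) * qchar (- z) = sign V * sign Y"
    proof -
      have "qchar (- z) = qchar (- 1 :: 'a) * qchar z"
        by (simp flip: qchar_mult[OF odd_card])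
      moreover have "qchar (- z) * qchar (- z) = 1" "qchar (- 1 :: 'a) * qchar (- 1 :: 'a) = 1" "qchar z * qchar z = 1"
        using v(2) by (simp_all add: z_def qchar_mult_self)
      ultimately have "qchar z * qchar (- 1 :: 'a) * qchar (- z) = 1" "qchar (- z) * qchar (- z) = 1"
        by algebra+
      moreover have "sign (V \<inter> perp X) * qchar (- z) = sign V * sign Y *
          (if even d then qchar z * qchar (- 1 :: 'a) * qchar (- z) else qchar (- z) * qchar (- z))"
        unfolding sgP u_def sgX using I by simp
      ultimately show ?thesis
        by simp
    qed
    show ?thesis
      unfolding main e1 e2 e3 using e4 by algebra
  qed
  have sq: "sign V * sign V = 1" "sign Y * sign Y = 1" "sign X * sign X = 1" "qchar z * qchar z = 1" "u * u = 1"
    using sign_mult_self[OF subV] sign_mult_self[OF sX(1)] sign_mult_self[OF X(1)] v(2)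
    by (simp_all add: z_def qchar_mult_self u_def algebra_simps)
  have neg: "qchar (- c) = qchar (- 1 :: 'a) * qchar c" for c :: 'a
    by (simp flip: qchar_mult[OF odd_card])
  have rk: "rank X = Suc d" and i: "dim (radical X) = i"
    using Suc.hyps(2) by (simp_all add: i_def)
  show ?case
    unfolding rk i u_def[symmetric]
  proof (cases "even i"; cases "even d")
    assume "even i" "even d"
    then obtain I s where I: "i = 2 * I" and s: "d = 2 * s"
      by (auto elim!: evenE)
    \<comment> \<open>In this class the number of complements for a hyperplane does not see its
      sign, so the coefficient \<open>b\<close> is 0, while the signed sum is affine in the
      sign.\<close>
    have "complement_sum nondeg_weight V X = total_eo q I s K + u * (q powi (int I + int K) *
        (total_ee q I s K + 0 * qchar z) - total_eo q I s K * q powi (int I - int K))"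
      using IH1 IH2 I s by (intro even_rec admissible_nondeg_weight) (auto simp: total_count_def)
    moreover have "complement_sum sign_weight V X = signed_eo q I s K (sign Y) + u * (q powi (int I + int K) *
        (signed_ee q I s K (sign Y) 0 + sign V * (signed_ee q I s K (sign Y) 1 - signed_ee q I s K (sign Y) 0) * qchar z)
        - signed_eo q I s K (sign Y) * q powi (int I - int K))"
      using IH1 IH2 I s
      by (intro even_rec admissible_sign_weight)
        (auto simp: signed_count_def signed_ee_affine[where a = "x * y" for x y] ac_simps)
    moreover have "u = sign V * qchar z * sign Y"
      using sgX s by (simp add: u_def)
    moreover have "sign V * qchar z * (sign V * qchar z) = 1"
      using sq by algebra
    ultimately show "complement_sum nondeg_weight V X = total_count i (Suc d) K u \<and>
        complement_sum sign_weight V X = signed_count i (Suc d) K (sign X) (sign V)"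
      using total_oo_step[OF q_gt_1, of s I K u] signed_oo_step[OF q_gt_1, of "sign V * qchar z" "sign Y" I s K] sq I s
        signed_ee_affine[of I s K "sign Y" "sign V * qchar z"]
      by (simp add: total_count_def signed_count_def ac_simps)
  next
    assume "even i" "odd d"
    then obtain I s where I: "i = 2 * I" and s: "d = 2 * s + 1"
      by (auto elim!: evenE oddE)
    \<comment> \<open>\<open>a + b * qchar z\<close> is the value at the hyperplane orthogonal to
      \<open>v\<close>, and the sign of that hyperplane times \<open>sign Y\<close> is
      \<open>u\<close>.\<close>
    have ab: "total_oo q I s K 0 + sign V * sign Y * qchar (- 1 :: 'a) * (total_oo q I s K 1 - total_oo q I s K 0) * qchar z
      = total_oo q I s K u"
    proof -
      have "u = sign V * sign Y * qchar (- 1 :: 'a) * qchar z"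
        using s by (simp add: u_def sgX neg[of z])
      then show ?thesis
        by (simp add: total_oo_affine[where u = "x * y" for x y] ac_simps)
    qed
    have "complement_sum nondeg_weight V X = total_oe q I s K + u * (q powi (int I + int K) * total_oo q I s K u
        - total_oe q I s K * q powi (int I - int K))"
      unfolding ab[symmetric] using IH1 IH2 I s
      by (intro even_rec admissible_nondeg_weight)
        (auto simp: total_count_def total_oo_affine[where u = "x * y" for x y] neg[of "Q y" for y] ac_simps)
    moreover have "complement_sum sign_weight V X = signed_oe q I s K (sign V) + u * (q powi (int I + int K) *
        (signed_oo q I s K + 0 * qchar z) - signed_oe q I s K (sign V) * q powi (int I - int K))"
      using IH1 IH2 I s by (intro even_rec admissible_sign_weight) (auto simp: signed_count_def)
    ultimately show "complement_sum nondeg_weight V X = total_count i (Suc d) K u \<and>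
        complement_sum sign_weight V X = signed_count i (Suc d) K (sign X) (sign V)"
      using total_ee_step[OF q_gt_1, of "s + 1" u I K] sq I s
        signed_ee_step[OF q_gt_1, of "s + 1" I "sign V" "sign X" K]
      by (simp add: total_count_def signed_count_def u_def add.commute)
  next
    assume "odd i" "even d"
    then obtain I s where I: "i = 2 * I + 1" and s: "d = 2 * s"
      by (auto elim!: evenE oddE)
    have "complement_sum nondeg_weight V X = total_ee q (I + 1) s K + sign V * sign Y *
        (total_ee q (I + 1) s K * q powi (int I + 1 - int K) - q powi (int I + int K + 1) * total_eo q I s K)
        - sign (V \<inter> perp X) * (q powi (int I + int K) * 0)"
      using IH1 IH2 I s by (intro odd_rec admissible_nondeg_weight) (auto simp: total_count_def add.commute)
    moreover have "complement_sum sign_weight V X = signed_ee q (I + 1) s K (sign Y) (sign V) + sign V * sign Y *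
        (signed_ee q (I + 1) s K (sign Y) (sign V) * q powi (int I + 1 - int K) - q powi (int I + int K + 1) * signed_eo q I s K (sign Y))
        - sign (V \<inter> perp X) * (q powi (int I + int K) * 0)"
      using IH1 IH2 I s by (intro odd_rec admissible_sign_weight) (auto simp: signed_count_def add.commute)
    \<comment> \<open>The side condition of the recursion at \<open>s = 0\<close>, where
      \<open>Y\<close> has rank 0.\<close>
    moreover have "sign Y = 1" if "s = 0"
    proof -
      have "\<forall>x\<in>Y. Q x = 0"
        using exists_anisotropic[OF sX(1)] rkY that s
        by (metis (no_types, lifting) anisotropic_split(6) mult_0_right nat.distinct(1) sX(1))
      then show ?thesis
        by (rule sign_isotropic[OF sX(1)])
    qed
    ultimately show "complement_sum nondeg_weight V X = total_count i (Suc d) K u \<and>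
        complement_sum sign_weight V X = signed_count i (Suc d) K (sign X) (sign V)"
      using total_oe_step[OF q_gt_1, of I s K "sign V * sign Y"]
        signed_oe_step[OF q_gt_1, of s I "sign V" "sign Y" K] sq I s
      by (simp add: total_count_def signed_count_def add.commute)
  next
    assume "odd i" "odd d"
    then obtain I s where I: "i = 2 * I + 1" and s: "d = 2 * s + 1"
      by (auto elim!: oddE)
    have "complement_sum nondeg_weight V X = total_oo q (I + 1) s K (sign V * sign Y) + sign V * sign Y *
        (total_oo q (I + 1) s K (sign V * sign Y) * q powi (int I + 1 - int K) - q powi (int I + int K + 1) * total_oe q I s K)
        - sign (V \<inter> perp X) * (q powi (int I + int K) * 0)"
      using IH1 IH2 I s by (intro odd_rec admissible_nondeg_weight) (auto simp: total_count_def add.commute)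
    moreover have "complement_sum sign_weight V X = signed_oo q (I + 1) s K + sign V * sign Y *
        (signed_oo q (I + 1) s K * q powi (int I + 1 - int K) - q powi (int I + int K + 1) * (total_oe q I s K * q powi (- int K)))
        - sign (V \<inter> perp X) * (q powi (int I + int K) * (total_oe q I s K * (sign V * q powi (- (int I + int s + 1)))))"
      using IH1 IH2 I s
      by (intro odd_rec admissible_sign_weight)
        (auto simp: signed_count_def signed_oe_affine[where a = "x * y" for x y] ac_simps)
    moreover have "sign (V \<inter> perp X) = sign V * sign X"
      using sgP s by (simp add: u_def)
    moreover have "sign V * sign Y * (sign V * sign Y) = 1"
      using sq by algebra
    ultimately show "complement_sum nondeg_weight V X = total_count i (Suc d) K u \<and>
        complement_sum sign_weight V X = signed_count i (Suc d) K (sign X) (sign V)"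
      using total_eo_step[OF q_gt_1, of "s + 1" I "sign V * sign Y" K]
        signed_eo_step[OF q_gt_1, of "s + 1" "sign V" I K "sign X" "sign V * sign Y"] sq I s
      by (simp add: total_count_def signed_count_def u_def add.commute add.left_commute)
  qed
qed

section \<open>Types\<close>

text \<open>By dimension \<open>W\<close> is its own orthogonal space in \<open>U\<close>; as the
  zero form it has sign 1, and as the orthogonal space of an isotropic subspace it has the sign of
  \<open>U\<close>.\<close>

lemma sign_eq_1_if_lagrangian:
  assumes "nondegenerate U" and "subspace W" and "W \<subseteq> U" and "\<forall>v\<in>W. Q v = 0" and "dim U = 2 * dim W"
  shows "sign U = 1"
proof -
  have "W = U \<inter> perp W"
  proof (rule subspace_dim_equal)
    show "W \<subseteq> U \<inter> perp W"
      using assms(3) isotropic_orthogonal[OF assms(2,4)] by (auto simp: mem_perp_iff)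
    show "dim (U \<inter> perp W) \<le> dim W"
      using dim_perp[OF assms(1-3)] assms(5) by simp
  qed (auto intro!: subspace_inter subspace_perp assms nondegenerateD(1)[OF assms(1)])
  then show ?thesis
    using sign_perp_isotropic[OF assms(1-4)] sign_isotropic[OF assms(2,4)] by simp
qed

text \<open>Hyperbolic planes split off as long as there is a non-zero isotropic vector. Otherwise
  level 0 has a single element, and the size of the level formula then leaves only dimension 2 and
  sign -1.\<close>

lemma exists_totally_isotropic:
  assumes "nondegenerate U" and "dim U = 2 * r"
  shows "\<exists>W. subspace W \<and> W \<subseteq> U \<and> (\<forall>v\<in>W. Q v = 0) \<and> (if sign U = 1 then dim W = r else dim W + 1 = r)"
  using assms
proof (induction r arbitrary: U)
  case 0
  then have "U = {0}"
    using nondegenerateD(1) subspace_0 by auto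
  then show ?case
    using sign_isotropic[of U] by (intro exI[of _ "{0}"]) auto
next
  case (Suc r)
  note U = nondegenerateD(1)[OF Suc.prems(1)]
  show ?case
  proof (cases "\<exists>s\<in>U. s \<noteq> 0 \<and> Q s = 0")
    case True
    then obtain s where s: "s \<in> U" "s \<noteq> 0" "Q s = 0"
      by blast
    obtain p where p: "p \<in> U" "f p s = 1" "Q p = 0"
      by (rule exists_isotropic_dual_vector[OF Suc.prems(1), of "{0}" s])
        (use s U in \<open>auto simp: subspace_0 mem_perp_iff\<close>)
    have sp: "f s p \<noteq> 0"
      using p by (simp add: form_sym[of s])
    define U' where "U' = U \<inter> perp {s, p}"
    note h = hyperbolic_split[OF U s(1) p(1) s(3) p(3) sp, folded U'_def]
    have "nondegenerate U'"
      unfolding U'_def by (rule nondegenerate_hyperbolic_split[OF Suc.prems(1) s(1) p(1) s(3) p(3) sp])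
    then obtain W where W: "subspace W" "W \<subseteq> U'" "\<forall>v\<in>W. Q v = 0"
        "if sign U = 1 then dim W = r else dim W + 1 = r"
      using Suc.IH[of U'] h(2,5) Suc.prems(2) by auto
    have Wsp: "f x s = 0" "f s x = 0" "f x p = 0" if "x \<in> W" for x
      using that W(2) form_sym[of s x] by (auto simp: U'_def mem_perp_iff)
    then have sW: "s \<notin> W" "s \<in> perp W"
      using sp by (auto simp: mem_perp_iff)
    have "\<forall>v\<in>span (insert s W). Q v = 0"
      unfolding span_insert_subspace[OF W(1)]
      using W(3) Wsp s(3) by (auto simp: Q_add Q_scale f_simps)
    moreover have "span (insert s W) \<subseteq> U"
      using W(2) s(1) by (intro span_minimal U) (auto simp: U'_def)
    moreover have "if sign U = 1 then dim (span (insert s W)) = Suc r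
        else dim (span (insert s W)) + 1 = Suc r"
      using W(4) unfolding dim_span_insert[OF W(1) sW(1)] by (simp split: if_splits)
    ultimately show ?thesis
      using subspace_span by blast
  next
    case False
    then have "{v \<in> U. Q v = 0} = {0}"
      using subspace_0[OF U] by auto
    then have "level_count U 0 = 1"
      by (simp add: level_count_def)
    moreover have "level_count U 0 = q ^ (2 * Suc r) / q - sign U * q ^ Suc r / q + sign U * q ^ Suc r"
      using level_count_sign[OF U, of 0] Suc.prems
      by (simp add: level_formula_def rank_nondegenerate nondegenerate_def)
    moreover have "q ^ (2 * Suc r) = q ^ r * q ^ r * q * q"
      by (simp add: power_add mult_2)
    ultimately have *: "q ^ r * q ^ r * q - sign U * q ^ r + sign U * (q ^ r * q) = 1"
      by (simp add: ac_simps)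
    have ge: "q ^ r \<ge> 1" and q2: "q > 1"
      using q_gt_1 by (simp_all add: one_le_power)
    have "sign U = - 1 \<and> r = 0"
    proof (cases "sign U = 1")
      case True
      have "1 * q \<le> q ^ r * q"
        using q2 by (intro mult_right_mono[OF ge]) simp
      then have "1 < q ^ r * q"
        using q2 by linarith
      moreover from this have "1 * (q ^ r * q) \<le> q ^ r * (q ^ r * q)"
        by (intro mult_right_mono[OF ge]) linarith
      ultimately have "1 < q ^ r * (q ^ r * q)"
        by linarith
      moreover have "q ^ r * 1 \<le> q ^ r * q"
        using q2 by (intro mult_left_mono) simp_all
      moreover have "q ^ r * (q ^ r * q) - q ^ r + q ^ r * q = 1"
        using * True by (simp add: mult.assoc)
      ultimately show ?thesis
        by linarith
    next
      case False
      then have sg: "sign U = - 1"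
        using sign_values[OF U] by simp
      have "r = 0"
      proof (rule ccontr)
        assume "r \<noteq> 0"
        then have "q ^ r > 1"
          using q2 by (simp add: one_less_power)
        have "q ^ r * (q ^ r * q - q + 1) = 1"
          using * sg by (simp add: algebra_simps)
        moreover have "q ^ r * q - q + 1 \<ge> 1"
          using mult_right_mono[OF ge, of q] q2 by simp
        then have "q ^ r * (q ^ r * q - q + 1) \<ge> q ^ r * 1"
          using ge by (intro mult_left_mono) auto
        ultimately show False
          using \<open>q ^ r > 1\<close> by linarith
      qed
      then show ?thesis
        using sg by simp
    qed
    then show ?thesis
      using U by (intro exI[of _ "{0}"]) (auto simp: subspace_0)
  qed
qed

text \<open>Orthogonality bounds totally isotropic subspaces by half the dimension, and that bound
  is excluded for sign -1 since attaining it forces sign 1.\<close>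

lemma isotropic_index:
  assumes "nondegenerate U" and "dim U = 2 * r"
  shows "if sign U = 1 then isotropic_index U = r else isotropic_index U + 1 = r"
proof -
  let ?S = "{dim W | W. subspace W \<and> W \<subseteq> U \<and> (\<forall>v\<in>W. Q v = 0)}"
  obtain W where W: "subspace W" "W \<subseteq> U" "\<forall>v\<in>W. Q v = 0" "if sign U = 1 then dim W = r else dim W + 1 = r"
    using exists_totally_isotropic[OF assms] by blast
  have "finite ?S"
    by (rule finite_subset[of _ "dim ` (UNIV :: 'v set set)"]) auto
  moreover have "y \<le> dim W" if y: "y \<in> ?S" for y
  proof -
    obtain W' where W': "y = dim W'" "subspace W'" "W' \<subseteq> U" "\<forall>v\<in>W'. Q v = 0"
      using y by blast
    have "radical W' = W'"
      using isotropic_orthogonal[OF W'(2,4)] by (auto simp: radical_def)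
    then have "y \<le> r"
      using dim_isotropic_le[OF assms(1) W'(2,3)] assms(2) W'(1) by simp
    moreover have "y \<noteq> r" if "sign U \<noteq> 1"
      using sign_eq_1_if_lagrangian[OF assms(1) W'(2,3,4)] assms(2) W'(1) that by auto
    ultimately show ?thesis
      using W(4) by (auto split: if_splits)
  qed
  ultimately have "isotropic_index U = dim W"
    unfolding isotropic_index_def using W by (intro Max_eqI) blast+
  then show ?thesis
    using W(4) by (simp split: if_splits)
qed

lemma type_by_index_iff:
  assumes "nondegenerate U"
  shows "type_by_index (dim U) (isotropic_index U) \<epsilon>
    \<longleftrightarrow> (if even (dim U) then of_int \<epsilon> = sign U else \<epsilon> = 0)"
proof (cases "even (dim U)")
  case True
  then obtain r where r: "dim U = 2 * r"
    by (rule evenE)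
  show ?thesis
    using isotropic_index[OF assms r] sign_values[OF nondegenerateD(1)[OF assms]] r
    by (auto simp: type_by_index_def of_int_eq_iff[where 'a = real, of _ 1, simplified]
        of_int_eq_iff[where 'a = real, of _ "- 1", simplified] split: if_splits)
qed (auto simp: type_by_index_def)

lemma nonsingular_of_type_iff:
  "nonsingular_of_type m \<epsilon> U \<longleftrightarrow> nondegenerate U \<and> int (dim U) = m \<and>
    (if even m then of_int \<epsilon> = sign U else \<epsilon> = 0)"
proof -
  have "singular_space 0 m U \<longleftrightarrow> nondegenerate U \<and> int (dim U) = m"
    using subspace_0 by (auto simp: singular_space_def nondegenerate_def radical_def)
  then show ?thesis
    using type_by_index_iff[of U \<epsilon>] by (auto simp: nonsingular_of_type_def)
qed

section \<open>Quotients by a subspace, represented on a complement\<close>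

context
  fixes R :: "'v set"
  assumes R: "subspace R"
begin

lemma mem_coset_iff: "x \<in> v +o R \<longleftrightarrow> x - v \<in> R"
  by (auto simp: elt_set_plus_def) (metis add.commute diff_add_cancel)

lemma coset_eq_iff: "v +o R = w +o R \<longleftrightarrow> v - w \<in> R"
proof
  assume "v +o R = w +o R"
  moreover have "v \<in> v +o R"
    using subspace_0[OF R] by (simp add: mem_coset_iff)
  ultimately show "v - w \<in> R"
    by (simp add: mem_coset_iff)
next
  assume *: "v - w \<in> R"
  have "x - v \<in> R \<longleftrightarrow> x - w \<in> R" for x
    using subspace_add[OF R _ *, of "x - v"] subspace_diff[OF R _ *, of "x - w"] by auto
  then show "v +o R = w +o R"
    by (auto simp: mem_coset_iff)
qed

lemma coset_add: "(v +o R) + (w +o R) = (v + w) +o R"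
proof -
  have "R + R = R"
    using R by (auto simp: set_plus_def subspace_add) (metis add.right_neutral subspace_0)
  then show ?thesis
    by (simp add: set_plus_rearrange)
qed

lemma coset_zero: "0 +o R = R"
  by simp

lemma coset_scale_coset: "coset_scale R c (v +o R) = scale c v +o R"
proof (intro set_eqI iffI)
  fix x assume "x \<in> coset_scale R c (v +o R)"
  then obtain r r' where "r \<in> R" "r' \<in> R" "x = scale c (v + r) + r'"
    by (auto simp: coset_scale_def set_plus_def elt_set_plus_def)
  then show "x \<in> scale c v +o R"
    using R by (simp add: mem_coset_iff scale_right_distrib subspace_add subspace_scale)
next
  fix x assume "x \<in> scale c v +o R"
  then obtain r where "r \<in> R" "x = scale c v + r"
    by (auto simp: elt_set_plus_def)
  moreover have "v \<in> v +o R"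
    using subspace_0[OF R] by (simp add: mem_coset_iff)
  ultimately show "x \<in> coset_scale R c (v +o R)"
    by (auto simp: coset_scale_def set_plus_def)
qed

lemma coset_subspace_image:
  assumes "subspace W"
  shows "coset_subspace R ((\<lambda>v. v +o R) ` W)"
proof -
  have "R \<in> (\<lambda>v. v +o R) ` W"
    using subspace_0[OF assms] coset_zero by (metis image_eqI)
  then show ?thesis
    using assms unfolding coset_subspace_def quotient_space_def
    by (auto simp: coset_add coset_scale_coset subspace_add subspace_scale)
qed

lemma subspace_coset_preimage:
  assumes "coset_subspace R \<W>"
  shows "subspace {v. v +o R \<in> \<W>}"
  using assms unfolding coset_subspace_def subspace_def
  by (auto simp: coset_zero simp flip: coset_add coset_scale_coset)

lemma coset_span_image: "coset_span R ((\<lambda>v. v +o R) ` B) = (\<lambda>v. v +o R) ` span B"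
proof
  show "coset_span R ((\<lambda>v. v +o R) ` B) \<subseteq> (\<lambda>v. v +o R) ` span B"
    unfolding coset_span_def
    by (rule hull_minimal) (auto intro: span_base coset_subspace_image)
  show "(\<lambda>v. v +o R) ` span B \<subseteq> coset_span R ((\<lambda>v. v +o R) ` B)"
    unfolding coset_span_def hull_def
  proof (rule Inter_greatest)
    fix \<W> assume "\<W> \<in> {t. coset_subspace R t \<and> (\<lambda>v. v +o R) ` B \<subseteq> t}"
    then have "span B \<subseteq> {v. v +o R \<in> \<W>}"
      by (intro span_minimal subspace_coset_preimage) auto
    then show "(\<lambda>v. v +o R) ` span B \<subseteq> \<W>"
      by auto
  qed
qed

context
  fixes C :: "'v set"
  assumes C: "subspace C" "R \<inter> C = {0}" "span (R \<union> C) = UNIV"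
begin

lemma inj_on_coset: "inj_on (\<lambda>v. v +o R) C"
proof (rule inj_onI)
  fix v w assume vw: "v \<in> C" "w \<in> C" "v +o R = w +o R"
  then have "v - w \<in> R \<inter> C"
    using C(1) by (simp add: coset_eq_iff subspace_diff)
  then show "v = w"
    using C(2) by simp
qed

lemma exists_complement_part: "\<exists>c\<in>C. v - c \<in> R"
proof -
  have "v \<in> span (R \<union> C)"
    by (simp add: C(3))
  then obtain r c where "r \<in> R" "c \<in> C" "v = r + c"
    using R C(1) by (auto simp: span_Un span_eq_iff[THEN iffD2])
  then show ?thesis
    by (intro bexI[of _ c]) auto
qed

lemma quotient_space_eq:
  assumes "subspace U" and "R \<subseteq> U"
  shows "quotient_space U R = (\<lambda>v. v +o R) ` (U \<inter> C)"
proof -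
  have "\<exists>c\<in>U \<inter> C. v +o R = c +o R" if v: "v \<in> U" for v
  proof -
    obtain c where c: "c \<in> C" "v - c \<in> R"
      using exists_complement_part by blast
    have "c \<in> U"
      using subspace_diff[OF assms(1) v, of "v - c"] c(2) assms(2) by auto
    then show ?thesis
      using c by (intro bexI[of _ c]) (auto simp: coset_eq_iff)
  qed
  then show ?thesis
    by (auto simp: quotient_space_def)
qed

text \<open>\<open>coset_dim\<close> is the size of an arbitrarily chosen basis, so all bases of
  cosets must have the same size. Cosets are injective on the complement \<open>C\<close>, and a
  basis of cosets comes from a basis of \<open>W\<close>.\<close>

lemma card_coset_basis:
  assumes "subspace W" and "W \<subseteq> C" and "coset_basis R ((\<lambda>v. v +o R) ` W) \<B>"
  shows "card \<B> = dim W"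
proof -
  have \<B>: "\<B> \<subseteq> (\<lambda>v. v +o R) ` W" "coset_span R \<B> = (\<lambda>v. v +o R) ` W"
      "\<forall>A\<in>\<B>. A \<notin> coset_span R (\<B> - {A})"
    using assms(3) by (auto simp: coset_basis_def)
  obtain B where B: "B \<subseteq> W" "\<B> = (\<lambda>v. v +o R) ` B"
    using \<B>(1) by (auto simp: subset_image_iff)
  have spB: "span B \<subseteq> W"
    using B(1) assms(1) by (rule span_minimal)
  have "(\<lambda>v. v +o R) ` span B = (\<lambda>v. v +o R) ` W"
    using \<B>(2) by (simp add: B(2) coset_span_image)
  then have "span B = W"
    using inj_on_image_eq_iff[OF inj_on_coset, of "span B" W] spB assms(2) by auto
  moreover have "independent B"
    unfolding dependent_def
  proof
    assume "\<exists>b\<in>B. b \<in> span (B - {b})"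
    then obtain b where b: "b \<in> B" "b \<in> span (B - {b})"
      by blast
    have "\<B> - {b +o R} = (\<lambda>v. v +o R) ` (B - {b})"
      using inj_on_image_set_diff[OF inj_on_coset, of B "{b}"] B assms(2) b(1) by auto
    then have "b +o R \<in> coset_span R (\<B> - {b +o R})"
      using b(2) by (simp add: coset_span_image)
    then show False
      using \<B>(3) b(1) B(2) by blast
  qed
  moreover have "card \<B> = card B"
    unfolding B(2) using B(1) assms(2) by (intro card_image inj_on_subset[OF inj_on_coset]) auto
  ultimately show ?thesis
    using dim_eq_card_independent dim_span by metis
qed

lemma coset_dim_eq:
  assumes "subspace W" and "W \<subseteq> C"
  shows "coset_dim R ((\<lambda>v. v +o R) ` W) = dim W"
proof -
  obtain B where B: "B \<subseteq> W" "independent B" "W \<subseteq> span B"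
    using basis_exists by metis
  have spB: "span B = W"
    using B assms(1) by (metis span_minimal subset_antisym)
  have "coset_basis R ((\<lambda>v. v +o R) ` W) ((\<lambda>v. v +o R) ` B)"
    unfolding coset_basis_def
  proof (intro conjI ballI)
    show "(\<lambda>v. v +o R) ` B \<subseteq> (\<lambda>v. v +o R) ` W"
      using B(1) by auto
    show "coset_span R ((\<lambda>v. v +o R) ` B) = (\<lambda>v. v +o R) ` W"
      by (simp add: coset_span_image spB)
    fix A assume "A \<in> (\<lambda>v. v +o R) ` B"
    then obtain b where b: "b \<in> B" "A = b +o R"
      by blast
    have "(\<lambda>v. v +o R) ` B - {A} = (\<lambda>v. v +o R) ` (B - {b})"
      using inj_on_image_set_diff[OF inj_on_coset, of B "{b}"] B(1) assms(2) b by auto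
    then have "coset_span R ((\<lambda>v. v +o R) ` B - {A}) = (\<lambda>v. v +o R) ` span (B - {b})"
      by (simp add: coset_span_image)
    moreover have "span (B - {b}) \<subseteq> C"
      using spB assms(2) span_mono[of "B - {b}" B] by auto
    moreover have "b \<notin> span (B - {b})"
      using B(2) b(1) by (auto simp: dependent_def)
    ultimately show "A \<notin> coset_span R ((\<lambda>v. v +o R) ` B - {A})"
      using inj_on_image_mem_iff[OF inj_on_coset, of b "span (B - {b})"] b B(1) assms(2) by auto
  qed
  then show ?thesis
    unfolding coset_dim_def by (rule someI2[where Q = "\<lambda>\<B>. card \<B> = dim W"])
      (rule card_coset_basis[OF assms])
qed

end

end

text \<open>A complement \<open>U0\<close> of the radical in \<open>U\<close> carries the same form
  as the quotient, so its Witt index is that of the quotient. The level counts of \<open>U\<close>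
  are those of \<open>U0\<close> times a power of \<open>q\<close>, hence the signs agree.\<close>

lemma has_type_iff:
  assumes "subspace U"
  shows "has_type U \<delta> \<longleftrightarrow> (if even (rank U) then of_int \<delta> = sign U else \<delta> = 0)"
proof -
  define R where "R = radical U"
  have R: "subspace R" "R \<subseteq> U"
    using subspace_radical[OF assms] by (auto simp: R_def radical_def)
  obtain C where C: "subspace C" "R \<inter> C = {0}" "span (R \<union> C) = UNIV"
    by (rule exists_complement[OF R(1), of UNIV]) (auto simp: subspace_UNIV)
  define U0 where "U0 = U \<inter> C"
  have U0: "subspace U0" "U0 \<subseteq> C" "U0 \<subseteq> U"
    by (auto simp: U0_def intro!: subspace_inter assms C)
  have fR: "f u r = 0" "f r u = 0" if "r \<in> R" "u \<in> U" for r u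
    using that by (auto simp: R_def radical_def form_sym[of u])
  have QR: "Q (u + r) = Q u" if "r \<in> R" "u \<in> U" for r u
    using fR[OF that] fR[OF that(1), of r] that R(2) by (auto simp: quadratic_form f_simps)
  have bij: "bij_betw (\<lambda>(r, u). u + r) (R \<times> U0) U"
    unfolding bij_betw_def
  proof
    show "inj_on (\<lambda>(r, u). u + r) (R \<times> U0)"
    proof (rule inj_onI, clarsimp)
      fix r u r' u' assume *: "r \<in> R" "u \<in> U0" "r' \<in> R" "u' \<in> U0" "u + r = u' + r'"
      then have "u - u' = r' - r"
        by (simp add: algebra_simps)
      moreover have "u - u' \<in> C" "r' - r \<in> R"
        using * U0 R C by (auto intro: subspace_diff)
      ultimately have "u - u' = 0"
        using C(2) by (metis IntI singletonD)
      then show "r = r' \<and> u = u'"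
        using * by simp
    qed
    show "(\<lambda>(r, u). u + r) ` (R \<times> U0) = U"
    proof (intro set_eqI iffI)
      fix v assume v: "v \<in> U"
      obtain c where c: "c \<in> C" "v - c \<in> R"
        using exists_complement_part[OF R(1) C] by blast
      have "c \<in> U0"
        using subspace_diff[OF assms v, of "v - c"] c R(2) by (auto simp: U0_def)
      then show "v \<in> (\<lambda>(r, u). u + r) ` (R \<times> U0)"
        using c(2) by (intro image_eqI[of _ _ "(v - c, c)"]) auto
    next
      fix v assume "v \<in> (\<lambda>(r, u). u + r) ` (R \<times> U0)"
      then show "v \<in> U"
        using U0(3) R(2) assms by (auto intro: subspace_add)
    qed
  qed
  have "card U = card R * card U0"
    using bij_betw_same_card[OF bij] by (simp add: card_cartesian_product)
  then have "q ^ dim U = q ^ (dim R + dim U0)"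
    using card_subspace[OF assms] card_subspace[OF R(1)] card_subspace[OF U0(1)] by (simp add: power_add)
  then have dU: "dim U = dim R + dim U0"
    using q_gt_1 by (simp add: power_inject_exp)
  have radU0: "radical U0 = {0}"
  proof -
    have "v = 0" if v: "v \<in> radical U0" for v
    proof -
      have "f v x = 0" if "x \<in> U" for x
      proof -
        obtain r u where "r \<in> R" "u \<in> U0" "x = u + r"
          using \<open>x \<in> U\<close> bij unfolding bij_betw_def by fastforce
        then show ?thesis
          using v fR[of r v] U0(3) by (auto simp: radical_def f_simps)
      qed
      then have "v \<in> R \<inter> C"
        using v U0 by (auto simp: R_def radical_def)
      then show ?thesis
        using C(2) by simp
    qed
    then show ?thesis
      using subspace_0[OF subspace_radical[OF U0(1)]] by blast
  qed
  have nd: "nondegenerate U0"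
    using U0(1) radU0 by (simp add: nondegenerate_def)
  have rk: "dim U0 = rank U"
    using dU by (simp add: rank_def R_def)
  have sg: "sign U0 = sign U"
  proof (rule sign_unique[symmetric])
    have "level_count U c = q ^ dim R * level_count U0 c" for c
    proof -
      have "level_count U c = (\<Sum>p\<in>R \<times> U0. if Q (case p of (r, u) \<Rightarrow> u + r) = c then 1 else 0)"
        unfolding level_count_eq_sum by (rule sum.reindex_bij_betw[OF bij, symmetric])
      also have "\<dots> = (\<Sum>p\<in>R \<times> U0. if Q (snd p) = c then 1 else 0)"
        using QR U0(3) by (intro sum.cong) auto
      also have "\<dots> = (\<Sum>r\<in>R. level_count U0 c)"
        unfolding level_count_eq_sum
        by (simp add: sum.cartesian_product case_prod_unfold del: sum_constant)
      finally show ?thesis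
        using card_subspace[OF R(1)] by simp
    qed
    then show "has_sign U (sign U0)"
      using has_sign_sign[OF U0(1)] radU0 rk rank_nondegenerate[OF nd]
      by (simp add: has_sign_def R_def)
  qed
  let ?k = "\<lambda>v. v +o R"
  have quot: "quotient_space U R = ?k ` U0"
    unfolding U0_def by (rule quotient_space_eq[OF R(1) C assms R(2)])
  have form: "induced_form (?k v) = Q v" if "v \<in> U" for v
  proof -
    have "Q ` (?k v) = {Q v}"
      using QR[OF _ that] subspace_0[OF R(1)] by (auto simp: elt_set_plus_def image_iff)
    then show ?thesis
      by (simp add: induced_form_def)
  qed
  have "{coset_dim R \<W> | \<W>. coset_subspace R \<W> \<and> \<W> \<subseteq> quotient_space U R \<and> (\<forall>A\<in>\<W>. induced_form A = 0)}
    = {dim W | W. subspace W \<and> W \<subseteq> U0 \<and> (\<forall>v\<in>W. Q v = 0)}" (is "?A = ?B")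
  proof (intro set_eqI iffI)
    fix m assume "m \<in> ?A"
    then obtain \<W> where \<W>: "m = coset_dim R \<W>" "coset_subspace R \<W>" "\<W> \<subseteq> ?k ` U0"
        "\<forall>A\<in>\<W>. induced_form A = 0"
      unfolding quot by blast
    define W where "W = U0 \<inter> {v. ?k v \<in> \<W>}"
    have W: "subspace W" "W \<subseteq> U0" "?k ` W = \<W>"
      using \<W>(3) by (auto simp: W_def intro!: subspace_inter U0(1) subspace_coset_preimage[OF R(1) \<W>(2)])
    moreover have "\<forall>v\<in>W. Q v = 0"
    proof
      fix v assume "v \<in> W"
      then have "v \<in> U" "?k v \<in> \<W>"
        using U0(3) by (auto simp: W_def)
      then show "Q v = 0"
        using \<W>(4) form[of v] by simp
    qed
    moreover have "m = dim W"
      using coset_dim_eq[OF R(1) C W(1)] W(2,3) U0(2) \<W>(1) by auto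
    ultimately show "m \<in> ?B"
      by blast
  next
    fix m assume "m \<in> ?B"
    then obtain W where W: "m = dim W" "subspace W" "W \<subseteq> U0" "\<forall>v\<in>W. Q v = 0"
      by blast
    have "m = coset_dim R (?k ` W)"
      using coset_dim_eq[OF R(1) C W(2)] W(1,3) U0(2) by auto
    moreover have "\<forall>A\<in>?k ` W. induced_form A = 0"
      using W(3,4) form U0(3) by auto
    moreover have "?k ` W \<subseteq> quotient_space U R"
      unfolding quot using W(3) by auto
    ultimately show "m \<in> ?A"
      using coset_subspace_image[OF R(1) W(2)] by blast
  qed
  then have "quotient_isotropic_index U R = isotropic_index U0"
    by (simp add: quotient_isotropic_index_def isotropic_index_def)
  moreover have "coset_dim R (quotient_space U R) = dim U0"
    unfolding quot by (rule coset_dim_eq[OF R(1) C U0(1,2)])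
  ultimately show ?thesis
    using type_by_index_iff[OF nd, of \<delta>] rk sg by (simp add: has_type_def flip: R_def)
qed

end

section \<open>The formula\<close>

text \<open>The summand of the theorem, named so that each parity class can rewrite it. Under the
  parity conditions of the theorem \<open>div\<close> rounds only in summands whose coefficient is
  zero.\<close>

definition gamma_term :: "real \<Rightarrow> int \<Rightarrow> int \<Rightarrow> int \<Rightarrow> int \<Rightarrow> int \<Rightarrow> int \<Rightarrow> int \<Rightarrow> int \<Rightarrow> real" where
  "gamma_term q n j i \<delta> \<epsilon> \<zeta> lam m =
        chi 1 ((j + 1 - \<epsilon>\<^sup>2) div 2 - m) q * gauss_coeff ((j - i - 1 + \<delta>\<^sup>2) div 2) m (q\<^sup>2)
          * q powi (m * (j + i - n + m + 1 - \<delta>\<^sup>2 - \<epsilon>\<^sup>2))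
      + of_int \<zeta> * q powi ((j - n) div 2 + (1 - \<epsilon>\<^sup>2) * j)
          * chi 1 ((j - 1 + \<epsilon>\<^sup>2) div 2 - m) q * gauss_coeff ((j - i - 1 - \<delta>\<^sup>2) div 2) m (q\<^sup>2)
          * q powi (m * (j + i - n + m - 1 + \<delta>\<^sup>2 + \<epsilon>\<^sup>2))
      - of_int (\<delta> * \<zeta>) * q powi ((i - n) div 2 + (1 - \<epsilon>\<^sup>2) * j)
          * chi 1 ((j - 1 + \<epsilon>\<^sup>2) div 2 - m) q * gauss_coeff ((j - i) div 2 - 1) m (q\<^sup>2)
          * q powi (m * (j + i - n + m + \<epsilon>\<^sup>2))
      + of_int (\<epsilon> * \<zeta>) * q powi (- (j div 2))
          * chi 1 (j div 2 - m) q * gauss_coeff ((j - i - 1 - \<delta>\<^sup>2) div 2) m (q\<^sup>2)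
          * q powi (m * (j + i - n + m + \<delta>\<^sup>2))
      + of_int (\<delta> * \<epsilon> * \<zeta>) * q powi (- (i div 2))
          * chi 1 (j div 2 - m) q * gauss_coeff ((j - i) div 2 - 1) (m - 1) (q\<^sup>2)
          * q powi (m * (j + i - n + m - 1))
      + (if odd (n * (j - i)) then of_int lam else 0) * q powi ((j + i - n) div 2)
          * chi 1 ((j - 1) div 2 - m) q * gauss_coeff ((j - i - 1) div 2) m (q\<^sup>2)
          * q powi (m * (j + i - n + m + 1))"

definition gamma_formula :: "real \<Rightarrow> int \<Rightarrow> int \<Rightarrow> int \<Rightarrow> int \<Rightarrow> int \<Rightarrow> int \<Rightarrow> int \<Rightarrow> real" where
  "gamma_formula q n j i \<delta> \<epsilon> \<zeta> lam =
     1 / 2 * q powi (j * (n - j) - ((j + 1 - \<epsilon>\<^sup>2) div 2)\<^sup>2) *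
     (\<Sum>m = 0..(j - i - 1 + \<delta>\<^sup>2) div 2. gamma_term q n j i \<delta> \<epsilon> \<zeta> lam m)"

section \<open>The formula in the four parity classes\<close>

lemma gamma_formula_ee:
  fixes I s K n j i :: int
  assumes "\<delta> = 1 \<or> \<delta> = - 1" and "\<epsilon> = 1 \<or> \<epsilon> = - 1"
    and "i = 2 * I" and "j = 2 * I + 2 * s" and "n = 2 * K + (2 * I + 2 * s)"
  shows "gamma_formula q n j i \<delta> \<epsilon> \<zeta> lam
    = (total_ee q I s K + of_int \<zeta> * signed_ee q I s K (of_int \<delta>) (of_int \<epsilon>)) / 2"
proof -
  have sq: "\<delta>\<^sup>2 = 1" "\<epsilon>\<^sup>2 = 1"
    using assms(1,2) by auto
  have D: "(j + 1 - 1) div 2 = I + s" "(j - i - 1 + 1) div 2 = s" "(j - n) div 2 + (1 - 1) * j = - K"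
      "(j - 1 + 1) div 2 = I + s" "(j - i - 1 - 1) div 2 = s - 1" "(i - n) div 2 + (1 - 1) * j = - (K + s)"
      "(j - i) div 2 - 1 = s - 1" "j div 2 = I + s" "i div 2 = I"
    using assms(3-5) by simp_all
  have E: "j + i - n + m + 1 - 1 - 1 = m + (2 * I - 2 * K - 1)" "j + i - n + m - 1 + 1 + 1 = m + (2 * I - 2 * K + 1)"
      "j + i - n + m + 1 = m + (2 * I - 2 * K + 1)" "j + i - n + m - 1 = m + (2 * I - 2 * K - 1)" for m
    using assms(3-5) by simp_all
  have nodd: "\<not> odd (n * (j - i))" and P: "j * (n - j) - (I + s)\<^sup>2 = 4 * (I + s) * K - (I + s)\<^sup>2"
    using assms(3-5) by (simp_all add: algebra_simps)
  let ?c = "of_int \<zeta> * (q powi (- K) - of_int \<delta> * q powi (- (K + s)) + of_int \<epsilon> * q powi (- (I + s)))"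
  let ?d = "of_int \<zeta> * (of_int \<epsilon> * of_int \<delta> * q powi (- I))"
  have S: "(\<Sum>m = 0..s. gamma_term q n j i \<delta> \<epsilon> \<zeta> lam m)
    = gsum q (I + s) s s 0 (2 * I - 2 * K - 1) + ?c * gsum q (I + s) s (s - 1) 0 (2 * I - 2 * K + 1)
      + ?d * gsum q (I + s) s (s - 1) 1 (2 * I - 2 * K - 1)"
    unfolding gsum_def sum_distrib_left sum.distrib[symmetric] gamma_term_def sq D E if_not_P[OF nodd]
    by (rule sum.cong) (simp_all add: algebra_simps)
  show ?thesis
    unfolding gamma_formula_def sq D P S total_ee_def signed_ee_def by (simp add: algebra_simps)
qed

lemma gamma_formula_eo:
  fixes I s K n j i :: int
  assumes "\<delta> = 1 \<or> \<delta> = - 1" and "\<epsilon> = 0"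
    and "i = 2 * I + 1" and "j = 2 * I + 2 * s + 1" and "n = 2 * K + (2 * I + 2 * s + 1)"
  shows "gamma_formula q n j i \<delta> \<epsilon> \<zeta> lam
    = (total_eo q I s K + of_int \<zeta> * signed_eo q I s K (of_int \<delta>)) / 2"
proof -
  have sq: "\<delta>\<^sup>2 = 1" "\<epsilon>\<^sup>2 = 0"
    using assms(1,2) by auto
  have D: "(j + 1 - 0) div 2 = I + s + 1" "(j - i - 1 + 1) div 2 = s"
      "(j - n) div 2 + (1 - 0) * j = 2 * (I + s) + 1 - K"
      "(j - 1 + 0) div 2 = I + s" "(j - i - 1 - 1) div 2 = s - 1"
      "(i - n) div 2 + (1 - 0) * j = 2 * (I + s) + 1 - K - s" "(j - i) div 2 - 1 = s - 1"
    using assms(3-5) by simp_all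
  have E: "j + i - n + m + 1 - 1 - 0 = m + (2 * I - 2 * K + 1)" "j + i - n + m - 1 + 1 + 0 = m + (2 * I - 2 * K + 1)"
      "j + i - n + m + 0 = m + (2 * I - 2 * K + 1)" for m
    using assms(3-5) by simp_all
  have nodd: "\<not> odd (n * (j - i))"
    and P: "j * (n - j) - (I + s + 1)\<^sup>2 = (2 * (I + s) + 1) * (2 * K) - (I + s + 1)\<^sup>2"
    using assms(3-5) by (simp_all add: algebra_simps)
  let ?c = "of_int \<zeta> * (q powi (2 * (I + s) + 1 - K) - of_int \<delta> * q powi (2 * (I + s) + 1 - K - s))"
  have S: "(\<Sum>m = 0..s. gamma_term q n j i \<delta> \<epsilon> \<zeta> lam m)
    = gsum q (I + s + 1) s s 0 (2 * I - 2 * K + 1) + ?c * gsum q (I + s) s (s - 1) 0 (2 * I - 2 * K + 1)"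
    unfolding gsum_def sum_distrib_left sum.distrib[symmetric] gamma_term_def sq D E if_not_P[OF nodd]
    by (rule sum.cong) (simp_all add: assms(2) algebra_simps)
  show ?thesis
    unfolding gamma_formula_def sq D P S total_eo_def signed_eo_def by (simp add: algebra_simps)
qed

lemma gamma_formula_oe:
  fixes I s K n j i :: int
  assumes "\<delta> = 0" and "\<epsilon> = 1 \<or> \<epsilon> = - 1"
    and "i = 2 * I + 1" and "j = 2 * I + 2 * s + 2" and "n = 2 * K + (2 * I + 2 * s + 2)"
  shows "gamma_formula q n j i \<delta> \<epsilon> \<zeta> lam
    = (total_oe q I s K + of_int \<zeta> * signed_oe q I s K (of_int \<epsilon>)) / 2"
proof -
  have sq: "\<delta>\<^sup>2 = 0" "\<epsilon>\<^sup>2 = 1"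
    using assms(1,2) by auto
  have D: "(j + 1 - 1) div 2 = I + s + 1" "(j - i - 1 + 0) div 2 = s"
      "(j - n) div 2 + (1 - 1) * j = - K" "(j - 1 + 1) div 2 = I + s + 1"
      "(j - i - 1 - 0) div 2 = s" "j div 2 = I + s + 1"
    using assms(3-5) by simp_all
  have E: "j + i - n + m + 1 - 0 - 1 = m + (2 * I - 2 * K + 1)" "j + i - n + m - 1 + 0 + 1 = m + (2 * I - 2 * K + 1)"
      "j + i - n + m + 0 = m + (2 * I - 2 * K + 1)" for m
    using assms(3-5) by simp_all
  have nodd: "\<not> odd (n * (j - i))"
    and P: "j * (n - j) - (I + s + 1)\<^sup>2 = (2 * (I + s) + 2) * (2 * K) - (I + s + 1)\<^sup>2"
    using assms(3-5) by (simp_all add: algebra_simps)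
  let ?c = "of_int \<zeta> * (q powi (- K) + of_int \<epsilon> * q powi (- (I + s + 1)))"
  have S: "(\<Sum>m = 0..s. gamma_term q n j i \<delta> \<epsilon> \<zeta> lam m)
    = gsum q (I + s + 1) s s 0 (2 * I - 2 * K + 1) + ?c * gsum q (I + s + 1) s s 0 (2 * I - 2 * K + 1)"
    unfolding gsum_def sum_distrib_left sum.distrib[symmetric] gamma_term_def sq D E if_not_P[OF nodd]
    by (rule sum.cong) (simp_all add: assms(1) algebra_simps)
  show ?thesis
    unfolding gamma_formula_def sq D P S total_oe_def signed_oe_def by (simp add: algebra_simps)
qed

lemma gamma_formula_oo:
  fixes I s K n j i :: int
  assumes "\<delta> = 0" and "\<epsilon> = 0"
    and "i = 2 * I" and "j = 2 * I + 2 * s + 1" and "n = 2 * K + (2 * I + 2 * s + 1)"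
  shows "gamma_formula q n j i \<delta> \<epsilon> \<zeta> lam
    = (total_oo q I s K (of_int lam) + of_int \<zeta> * signed_oo q I s K) / 2"
proof -
  have sq: "\<delta>\<^sup>2 = 0" "\<epsilon>\<^sup>2 = 0"
    using assms(1,2) by auto
  have D: "(j + 1 - 0) div 2 = I + s + 1" "(j - i - 1 + 0) div 2 = s"
      "(j - n) div 2 + (1 - 0) * j = 2 * (I + s) + 1 - K" "(j - 1 + 0) div 2 = I + s"
      "(j - i - 1 - 0) div 2 = s" "(j + i - n) div 2 = I - K" "(j - 1) div 2 = I + s" "(j - i - 1) div 2 = s"
    using assms(3-5) by simp_all
  have E: "j + i - n + m + 1 - 0 - 0 = m + (2 * I - 2 * K + 1)" "j + i - n + m - 1 + 0 + 0 = m + (2 * I - 2 * K - 1)"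
      "j + i - n + m + 1 = m + (2 * I - 2 * K + 1)" for m
    using assms(3-5) by simp_all
  have nodd: "odd (n * (j - i))"
    and P: "j * (n - j) - (I + s + 1)\<^sup>2 = (2 * (I + s) + 1) * (2 * K) - (I + s + 1)\<^sup>2"
    using assms(3-5) by (simp_all add: algebra_simps)
  have S: "(\<Sum>m = 0..s. gamma_term q n j i \<delta> \<epsilon> \<zeta> lam m)
    = gsum q (I + s + 1) s s 0 (2 * I - 2 * K + 1)
      + of_int \<zeta> * q powi (2 * (I + s) + 1 - K) * gsum q (I + s) s s 0 (2 * I - 2 * K - 1)
      + of_int lam * q powi (I - K) * gsum q (I + s) s s 0 (2 * I - 2 * K + 1)"
    unfolding gsum_def sum_distrib_left sum.distrib[symmetric] gamma_term_def sq D E if_P[OF nodd]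
    by (rule sum.cong) (simp_all add: assms(1,2) algebra_simps)
  show ?thesis
    unfolding gamma_formula_def sq D P S total_oo_def signed_oo_def by (simp add: algebra_simps)
qed

context odd_quadratic_space
begin

text \<open>On non-degenerate \<sigma> the indicator of type \<zeta> is half of 1 plus \<zeta> times
  the sign. The span of a complement with \<open>X\<close> is the whole space, whose type is
  given.\<close>

lemma gamma_eq_complement_sums:
  assumes "nondegenerate UNIV" and "subspace X" and "dim UNIV = 2 * K + dim X"
    and "\<zeta> \<in> {1, - 1}" and "nonsingular_of_type (int (dim UNIV)) \<epsilon> UNIV"
  shows "real (gamma X (int (2 * K)) \<zeta> \<epsilon>)
    = (complement_sum nondeg_weight UNIV X + of_int \<zeta> * complement_sum sign_weight UNIV X) / 2"
proof -
  have "{\<sigma>. nonsingular_of_type (int (2 * K)) \<zeta> \<sigma> \<and> \<sigma> \<inter> X = {0} \<and>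
      nonsingular_of_type (int (2 * K) + int (dim X)) \<epsilon> (span (X \<union> \<sigma>))}
    = {\<sigma> \<in> complements UNIV X. nondegenerate \<sigma> \<and> sign \<sigma> = of_int \<zeta>}" (is "?A = ?B")
  proof (intro set_eqI iffI)
    fix \<sigma> assume "\<sigma> \<in> ?A"
    then show "\<sigma> \<in> ?B"
      using assms(3) nondegenerateD(1)[of \<sigma>] by (auto simp: nonsingular_of_type_iff complements_def)
  next
    fix \<sigma> assume \<sigma>: "\<sigma> \<in> ?B"
    have "span (X \<union> \<sigma>) = UNIV"
      using span_complement[of \<sigma> UNIV X] \<sigma> assms(2) by (simp add: Un_commute subspace_UNIV)
    moreover have "nonsingular_of_type (int (2 * K)) \<zeta> \<sigma>"
      using \<sigma> assms(3) by (auto simp: nonsingular_of_type_iff complements_def)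
    ultimately show "\<sigma> \<in> ?A"
      using \<sigma> assms(3,5) by (auto simp: complements_def)
  qed
  then have "real (gamma X (int (2 * K)) \<zeta> \<epsilon>)
    = (\<Sum>\<sigma>\<in>complements UNIV X. if nondegenerate \<sigma> \<and> sign \<sigma> = of_int \<zeta> then 1 else 0)"
    by (simp add: gamma_def sum.If_cases Int_def)
  also have "\<dots> = (\<Sum>\<sigma>\<in>complements UNIV X. (nondeg_weight \<sigma> + of_int \<zeta> * sign_weight \<sigma>) / 2)"
  proof (rule sum.cong)
    fix \<sigma>
    show "(if nondegenerate \<sigma> \<and> sign \<sigma> = of_int \<zeta> then 1 else 0)
      = (nondeg_weight \<sigma> + of_int \<zeta> * sign_weight \<sigma>) / 2"
      using sign_values[of \<sigma>] nondegenerateD(1)[of \<sigma>] assms(4)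
      by (auto simp: nondeg_weight_def sign_weight_def)
  qed simp
  finally show ?thesis
    by (simp add: complement_sum_def sum.distrib sum_distrib_left flip: sum_divide_distrib)
qed

end

theorem theorem4p12:
  fixes scale :: "'a::{field,finite} \<Rightarrow> 'v::{ab_group_add,finite} \<Rightarrow> 'v"
    and Q :: "'v \<Rightarrow> 'a" and f :: "'v \<Rightarrow> 'v \<Rightarrow> 'a"
    and \<pi> :: "'v set"
    and q :: real and n j i \<delta> \<epsilon> \<zeta> lam :: int
  assumes "quadratic_space scale Q f"
    and "q = real CARD('a)" and "odd CARD('a)"
    and "0 \<le> i" and "i \<le> j" and "i + j \<le> n" and "even (n - j)"
    and "\<delta> \<in> {0, 1, - 1}" and "\<epsilon> \<in> {0, 1, - 1}" and "\<zeta> \<in> {1, - 1}" and "lam \<in> {1, - 1}"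
    and "odd (j - i - \<delta>)" and "odd (n - \<epsilon>)"
    and "quadratic_space.nonsingular_of_type scale Q f n \<epsilon> UNIV"
    and "quadratic_space.singular_space scale f i j \<pi>"
    and "quadratic_space.has_type scale Q f \<pi> \<delta>"
    and "odd (n * (j - i)) \<longrightarrow> quadratic_space.has_perp_type scale Q f \<pi> lam"
  shows "real (quadratic_space.gamma scale Q f \<pi> (n - j) \<zeta> \<epsilon>) =
    1 / 2 * q powi (j * (n - j) - ((j + 1 - \<epsilon>\<^sup>2) div 2)\<^sup>2) *
    (\<Sum>m = 0..(j - i - 1 + \<delta>\<^sup>2) div 2.
        chi 1 ((j + 1 - \<epsilon>\<^sup>2) div 2 - m) q * gauss_coeff ((j - i - 1 + \<delta>\<^sup>2) div 2) m (q\<^sup>2)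
          * q powi (m * (j + i - n + m + 1 - \<delta>\<^sup>2 - \<epsilon>\<^sup>2))
      + of_int \<zeta> * q powi ((j - n) div 2 + (1 - \<epsilon>\<^sup>2) * j)
          * chi 1 ((j - 1 + \<epsilon>\<^sup>2) div 2 - m) q * gauss_coeff ((j - i - 1 - \<delta>\<^sup>2) div 2) m (q\<^sup>2)
          * q powi (m * (j + i - n + m - 1 + \<delta>\<^sup>2 + \<epsilon>\<^sup>2))
      - of_int (\<delta> * \<zeta>) * q powi ((i - n) div 2 + (1 - \<epsilon>\<^sup>2) * j)
          * chi 1 ((j - 1 + \<epsilon>\<^sup>2) div 2 - m) q * gauss_coeff ((j - i) div 2 - 1) m (q\<^sup>2)
          * q powi (m * (j + i - n + m + \<epsilon>\<^sup>2))
      + of_int (\<epsilon> * \<zeta>) * q powi (- (j div 2))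
          * chi 1 (j div 2 - m) q * gauss_coeff ((j - i - 1 - \<delta>\<^sup>2) div 2) m (q\<^sup>2)
          * q powi (m * (j + i - n + m + \<delta>\<^sup>2))
      + of_int (\<delta> * \<epsilon> * \<zeta>) * q powi (- (i div 2))
          * chi 1 (j div 2 - m) q * gauss_coeff ((j - i) div 2 - 1) (m - 1) (q\<^sup>2)
          * q powi (m * (j + i - n + m - 1))
      + (if odd (n * (j - i)) then of_int lam else 0) * q powi ((j + i - n) div 2)
          * chi 1 ((j - 1) div 2 - m) q * gauss_coeff ((j - i - 1) div 2) m (q\<^sup>2)
          * q powi (m * (j + i - n + m + 1)))"
proof -
  interpret odd_quadratic_space scale Q f q
    using assms(1-3) by (simp add: odd_quadratic_space_def odd_quadratic_space_axioms_def)
  have nd: "nondegenerate UNIV" and n: "int (dim UNIV) = n"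
    and type_UNIV: "if even n then of_int \<epsilon> = sign UNIV else \<epsilon> = 0"
    using assms(14) by (auto simp: nonsingular_of_type_iff)
  have \<pi>: "subspace \<pi>" and j: "int (dim \<pi>) = j" and i: "int (dim (radical \<pi>)) = i"
    using assms(15) by (auto simp: singular_space_def)
  define d where "d = rank \<pi>"
  define K where "K = nat ((n - j) div 2)"
  have K: "n - j = 2 * int K"
    using assms(4,6,7) by (simp add: K_def)
  have ji: "j = i + int d"
    using rank_radical[OF \<pi>] i j by (simp add: d_def)
  have type_\<pi>: "if even d then of_int \<delta> = sign \<pi> else \<delta> = 0"
    using assms(16) has_type_iff[OF \<pi>] by (simp add: d_def)
  have dU: "dim UNIV = 2 * K + dim \<pi>"
    using n j K by linarith
  define u where "u = sign UNIV * sign \<pi>"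
  \<comment> \<open>Here the signs of the whole space and of \<pi> belong to odd ranks and are not
    types. But \<open>perp \<pi>\<close> has even rank, so \<open>sign_perp\<close> contributes no
    \<open>qchar (- 1)\<close> and the product \<open>u\<close> is the perp type.\<close>
  have type_perp: "of_int lam = u" if "odd (n * (j - i))"
  proof -
    have "rank (perp \<pi>) + dim (radical \<pi>) = 2 * K"
      using rank_radical[OF subspace_perp] radical_perp[OF nd \<pi>] dim_perp[OF nd \<pi>] dU by simp
    moreover have "odd n" "odd d"
      using that ji by auto
    moreover from this have "even (int (dim (radical \<pi>)))"
      using n j K ji i by presburger
    ultimately have "even (rank (perp \<pi>))"
      by (metis dvd_triv_left even_add even_of_nat)
    then show ?thesis
      using that assms(17) has_type_iff[OF subspace_perp] sign_perp[OF nd \<pi>]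
      by (simp add: has_perp_type_def u_def)
  qed
  have "real (gamma \<pi> (n - j) \<zeta> \<epsilon>)
    = (total_count (nat i) d K u + of_int \<zeta> * signed_count (nat i) d K (sign \<pi>) (sign UNIV)) / 2"
    using gamma_eq_complement_sums[OF nd \<pi> dU assms(10), of \<epsilon>] complement_sums[OF nd \<pi> _ dU] assms(14) n K i
    by (auto simp: d_def u_def)
  also have "\<dots> = gamma_formula q n j i \<delta> \<epsilon> \<zeta> lam"
  proof -
    have sg: "sign \<pi> = 1 \<or> sign \<pi> = - 1" "sign UNIV = 1 \<or> sign UNIV = - 1"
      using sign_values \<pi> nondegenerateD(1)[OF nd] by blast+
    define i' where "i' = nat i"
    have i': "i = int i'"
      using assms(4) by (simp add: i'_def)
    show ?thesis
    proof (cases "even i'"; cases "even d")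
      assume "even i'" "even d"
      then obtain I s where I: "i' = 2 * I" and s: "d = 2 * s"
        by (auto elim!: evenE)
      have "even n"
        using K ji i' I s by presburger
      then have t: "of_int \<delta> = sign \<pi>" "of_int \<epsilon> = sign UNIV"
        using type_\<pi> type_UNIV s by simp_all
      have "\<delta> = 1 \<or> \<delta> = - 1" "\<epsilon> = 1 \<or> \<epsilon> = - 1"
        using assms(8,9) sg t by auto
      then have "gamma_formula q n j i \<delta> \<epsilon> \<zeta> lam
        = (total_ee q I s K + of_int \<zeta> * signed_ee q I s K (of_int \<delta>) (of_int \<epsilon>)) / 2"
        by (rule gamma_formula_ee) (use K ji i' I s in auto)
      then show ?thesis
        using I s t by (simp add: total_count_def signed_count_def flip: i'_def)
    next
      assume "even i'" "odd d"
      then obtain I s where I: "i' = 2 * I" and s: "d = 2 * s + 1"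
        by (auto elim!: evenE oddE)
      have "odd n"
        using K ji i' I s by presburger
      then have "\<delta> = 0" "\<epsilon> = 0" "of_int lam = u"
        using type_\<pi> type_UNIV type_perp s ji by simp_all
      moreover from this have "gamma_formula q n j i \<delta> \<epsilon> \<zeta> lam
        = (total_oo q I s K (of_int lam) + of_int \<zeta> * signed_oo q I s K) / 2"
        by (intro gamma_formula_oo) (use K ji i' I s in auto)
      ultimately show ?thesis
        using I s by (simp add: total_count_def signed_count_def flip: i'_def)
    next
      assume "odd i'" "even d"
      then obtain I s where I: "i' = 2 * I + 1" and s: "d = 2 * s"
        by (auto elim!: evenE oddE)
      have "odd n"
        using K ji i' I s by presburger
      then have t: "of_int \<delta> = sign \<pi>" "\<epsilon> = 0"
        using type_\<pi> type_UNIV s by simp_all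
      have "\<delta> = 1 \<or> \<delta> = - 1"
        using assms(8) sg t by auto
      then have "gamma_formula q n j i \<delta> \<epsilon> \<zeta> lam
        = (total_eo q I s K + of_int \<zeta> * signed_eo q I s K (of_int \<delta>)) / 2"
        by (rule gamma_formula_eo) (use t K ji i' I s in auto)
      then show ?thesis
        using I s t by (simp add: total_count_def signed_count_def flip: i'_def)
    next
      assume "odd i'" "odd d"
      then obtain I s where I: "i' = 2 * I + 1" and s: "d = 2 * s + 1"
        by (auto elim!: oddE)
      have "even n"
        using K ji i' I s by presburger
      then have t: "\<delta> = 0" "of_int \<epsilon> = sign UNIV"
        using type_\<pi> type_UNIV s by simp_all
      have "\<epsilon> = 1 \<or> \<epsilon> = - 1"
        using assms(9) sg t by auto
      then have "gamma_formula q n j i \<delta> \<epsilon> \<zeta> lam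
        = (total_oe q I s K + of_int \<zeta> * signed_oe q I s K (of_int \<epsilon>)) / 2"
        by (intro gamma_formula_oe) (use t K ji i' I s in auto)
      then show ?thesis
        using I s t by (simp add: total_count_def signed_count_def flip: i'_def)
    qed
  qed
  finally show ?thesis
    unfolding gamma_formula_def gamma_term_def .
qed

end
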